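(* Let $\kappa_1>0$, let $\rho_0\in L^\infty(\mathbb{R};\mathbb{R}_{\ge 0})$, and let $V\in W^{2,\infty}_{\mathrm{loc}}(\mathbb{R})$ be a nonincreasing function such that at least one of the following two conditions is satisfied: (C) $0\le\big(-V'(\xi)-V''(\xi)\,\xi\big)\big(\operatorname{ess\,sup}\rho_0-\operatorname{ess\,inf}\rho_0\big)\le-V'(\xi)\,\xi$ for all $\xi\in[\operatorname{ess\,inf}\rho_0,\operatorname{ess\,sup}\rho_0]$; (D) $-V'(\xi)\le V''(\xi)\,\xi\le-(2-\kappa_1)V'(\xi)$ for all $\xi\in[\operatorname{ess\,inf}\rho_0,\operatorname{ess\,sup}\rho_0]$. Let $\varepsilon>0$ and let $\rho_\varepsilon$ be the weak solution of the nonlocal Cauchy problem $$\partial_t\rho_\varepsilon+\partial_x\big(V(W_\varepsilon)\rho_\varepsilon\big)=0,\qquad \rho_\varepsilon(0,x)=\rho_0(x),\qquad W_\varepsilon(t,x)=\frac1\varepsilon\int_x^\infty \exp\Big(\frac{x-y}{\varepsilon}\Big)\rho_\varepsilon(t,y)\,\mathrm{d}y .$$ Then $$\sup_{\mathbb{R}}\,V'(W_\varepsilon(t,\cdot))\,W_\varepsilon(t,\cdot)\,\partial_xW_\varepsilon(t,\cdot)\le\frac{\|\rho_0\|_{L^\infty(\mathbb{R})}}{\kappa t}\qquad\text{for all } t>0,$$ where $\kappa:=1$ in case (C) holds, or $\kappa:=\kappa_1$ in case (D) holds.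
   Context: For $V\in W^{2,\infty}_{\mathrm{loc}}(\mathbb{R})$ nonincreasing, $\rho_0\in L^\infty(\mathbb{R};\mathbb{R}_{\ge0})$, $\varepsilon>0$ and $T>0$, a weak solution of the nonlocal Cauchy problem on $(0,T)\times\mathbb{R}$ is a function $\rho_\varepsilon\in C([0,T];L^1_{\mathrm{loc}}(\mathbb{R}))\cap L^\infty((0,T);L^\infty(\mathbb{R}))$ such that, with $W_\varepsilon$ given by the exponential integral of $\rho_\varepsilon$, $\int_0^T\!\int_{\mathbb{R}}\big(\rho_\varepsilon\,\partial_t\varphi+V(W_\varepsilon)\rho_\varepsilon\,\partial_x\varphi\big)\,\mathrm{d}x\,\mathrm{d}t+\int_{\mathbb{R}}\rho_0\,\varphi(0,\cdot)\,\mathrm{d}x=0$ for all $\varphi\in C_c^\infty([0,T)\times\mathbb{R})$. It is known that such a solution exists and is unique for every $T>0$ (so it is defined for all $t>0$), that $\operatorname{ess\,inf}\rho_0\le\rho_\varepsilon\le\operatorname{ess\,sup}\rho_0$ a.e. (and the same bounds hold for $W_\varepsilon$), and that $W_\varepsilon\in W^{1,\infty}([0,T]\times\mathbb{R})$, with $\partial_xW_\varepsilon=\frac1\varepsilon(W_\varepsilon-\rho_\varepsilon)$. Since $\partial_xW_\varepsilon(t,\cdot)$ is in general defined only almost everywhere, the supremum over $\mathbb{R}$ is understood as an essential supremum. *)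

theory Defs
  imports "HOL-Analysis.Analysis" "HOL-Probability.Essential_Supremum"
begin

text \<open>
  Lebesgue and Sobolev classes are rendered through arbitrary Lebesgue measurable representatives.
\<close>

definition Linf :: "(real \<Rightarrow> real) \<Rightarrow> bool" where
  "Linf f \<longleftrightarrow> f \<in> borel_measurable lebesgue \<and> (\<exists>M. AE x in lebesgue. \<bar>f x\<bar> \<le> M)"

definition Linf_loc :: "(real \<Rightarrow> real) \<Rightarrow> bool" where
  "Linf_loc f \<longleftrightarrow> f \<in> borel_measurable lebesgue \<and>
     (\<forall>K. compact K \<longrightarrow> (\<exists>M. AE x in lebesgue. x \<in> K \<longrightarrow> \<bar>f x\<bar> \<le> M))"

definition L1_loc :: "(real \<Rightarrow> real) \<Rightarrow> bool" where
  "L1_loc f \<longleftrightarrow> (\<forall>K. compact K \<longrightarrow> set_integrable lebesgue K f)"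

text \<open>
  The following are meant for \<^term>\<open>f\<close> satisfying \<^term>\<open>Linf f\<close>, for which the extended real
  essential supremum is finite.
\<close>

definition ess_sup :: "(real \<Rightarrow> real) \<Rightarrow> real" where
  "ess_sup f = real_of_ereal (esssup lebesgue (\<lambda>x. ereal (f x)))"

definition ess_inf :: "(real \<Rightarrow> real) \<Rightarrow> real" where
  "ess_inf f = - ess_sup (\<lambda>x. - f x)"

definition Linf_norm :: "(real \<Rightarrow> real) \<Rightarrow> real" where
  "Linf_norm f = ess_sup (\<lambda>x. \<bar>f x\<bar>)"

definition test_fun :: "(real \<Rightarrow> real) \<Rightarrow> bool" where
  "test_fun \<phi> \<longleftrightarrow> (\<forall>n x. (deriv ^^ n) \<phi> field_differentiable (at x)) \<and>
     compact (closure {x. \<phi> x \<noteq> 0})"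

definition has_weak_deriv :: "(real \<Rightarrow> real) \<Rightarrow> (real \<Rightarrow> real) \<Rightarrow> bool" where
  "has_weak_deriv f g \<longleftrightarrow> L1_loc f \<and> L1_loc g \<and>
     (\<forall>\<phi>. test_fun \<phi> \<longrightarrow>
        (LINT x|lebesgue. f x * deriv \<phi> x) = - (LINT x|lebesgue. g x * \<phi> x))"

text \<open>
  A representative of the weak derivative. It is determined only up to null sets, so it is to be
  used only under almost-everywhere quantifiers and essential suprema.
\<close>

definition weak_deriv :: "(real \<Rightarrow> real) \<Rightarrow> real \<Rightarrow> real" where
  "weak_deriv f = (SOME g. has_weak_deriv f g)"

text \<open>
  A nonincreasing function in this class is automatically its own continuous, hence continuously
  differentiable, representative: for such \<^term>\<open>V\<close>, the first derivative is the classical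
  \<^term>\<open>deriv V\<close>, and the second one is \<^term>\<open>weak_deriv (deriv V)\<close>.
\<close>

definition W2inf_loc :: "(real \<Rightarrow> real) \<Rightarrow> bool" where
  "W2inf_loc V \<longleftrightarrow> Linf_loc V \<and>
     (\<exists>V1 V2. Linf_loc V1 \<and> Linf_loc V2 \<and> has_weak_deriv V V1 \<and> has_weak_deriv V1 V2)"

definition condition_C :: "(real \<Rightarrow> real) \<Rightarrow> (real \<Rightarrow> real) \<Rightarrow> bool" where
  "condition_C V \<rho>0 \<longleftrightarrow>
     (AE \<xi> in lebesgue. \<xi> \<in> {ess_inf \<rho>0..ess_sup \<rho>0} \<longrightarrow>
        0 \<le> (- deriv V \<xi> - weak_deriv (deriv V) \<xi> * \<xi>) * (ess_sup \<rho>0 - ess_inf \<rho>0) \<and>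
        (- deriv V \<xi> - weak_deriv (deriv V) \<xi> * \<xi>) * (ess_sup \<rho>0 - ess_inf \<rho>0)
          \<le> - deriv V \<xi> * \<xi>)"

definition condition_D :: "real \<Rightarrow> (real \<Rightarrow> real) \<Rightarrow> (real \<Rightarrow> real) \<Rightarrow> bool" where
  "condition_D \<kappa>1 V \<rho>0 \<longleftrightarrow>
     (AE \<xi> in lebesgue. \<xi> \<in> {ess_inf \<rho>0..ess_sup \<rho>0} \<longrightarrow>
        - deriv V \<xi> \<le> weak_deriv (deriv V) \<xi> * \<xi> \<and>
        weak_deriv (deriv V) \<xi> * \<xi> \<le> - (2 - \<kappa>1) * deriv V \<xi>)"

definition nonlocal :: "real \<Rightarrow> (real \<Rightarrow> real \<Rightarrow> real) \<Rightarrow> real \<Rightarrow> real \<Rightarrow> real" where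
  "nonlocal \<epsilon> \<rho> t x = 1 / \<epsilon> * (LINT y:{x..}|lebesgue. exp ((x - y) / \<epsilon>) * \<rho> t y)"

text \<open>
  \<^term>\<open>C_on k S f\<close> is used for sets such as \<open>[0,T) \<times> \<real>\<close>, at whose boundary points the
  derivatives are one-sided.
\<close>

primrec C_on :: "nat \<Rightarrow> (real \<times> real) set \<Rightarrow> (real \<times> real \<Rightarrow> real) \<Rightarrow> bool" where
  "C_on 0 S f \<longleftrightarrow> continuous_on S f"
| "C_on (Suc k) S f \<longleftrightarrow>
     (\<exists>ft fx. C_on k S ft \<and> C_on k S fx \<and>
        (\<forall>p\<in>S. (f has_derivative (\<lambda>(s, y). ft p * s + fx p * y)) (at p within S)))"

definition spacetime_test_fun :: "real \<Rightarrow> (real \<times> real \<Rightarrow> real) \<Rightarrow> bool" where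
  "spacetime_test_fun T \<phi> \<longleftrightarrow> (\<forall>k. C_on k ({0..<T} \<times> UNIV) \<phi>) \<and>
     (\<exists>K. compact K \<and> K \<subseteq> {0..<T} \<times> UNIV \<and> (\<forall>p \<in> {0..<T} \<times> UNIV - K. \<phi> p = 0))"

text \<open>\<open>\<rho> \<in> C([0,T]; L\<^sup>1\<^sub>l\<^sub>o\<^sub>c(\<real>))\<close>, where each \<^term>\<open>\<rho> t\<close> represents a class of functions.\<close>

definition C_L1_loc :: "real \<Rightarrow> (real \<Rightarrow> real \<Rightarrow> real) \<Rightarrow> bool" where
  "C_L1_loc T \<rho> \<longleftrightarrow> (\<forall>t\<in>{0..T}. L1_loc (\<rho> t)) \<and>
     (\<forall>K. compact K \<longrightarrow> (\<forall>t0\<in>{0..T}.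
        ((\<lambda>t. LINT x:K|lebesgue. \<bar>\<rho> t x - \<rho> t0 x\<bar>) \<longlongrightarrow> 0) (at t0 within {0..T})))"

definition Linf_Linf :: "real \<Rightarrow> (real \<Rightarrow> real \<Rightarrow> real) \<Rightarrow> bool" where
  "Linf_Linf T \<rho> \<longleftrightarrow>
     (\<exists>M. AE t in lebesgue. t \<in> {0<..<T} \<longrightarrow> Linf (\<rho> t) \<and> (AE x in lebesgue. \<bar>\<rho> t x\<bar> \<le> M))"

text \<open>
  No joint measurability of \<^term>\<open>\<rho>\<close> is imposed: by continuity in time the inner integral is a
  continuous function of \<^term>\<open>t\<close> that depends only on the classes of the functions \<^term>\<open>\<rho> t\<close>.
\<close>

definition weak_solution ::
  "(real \<Rightarrow> real) \<Rightarrow> real \<Rightarrow> (real \<Rightarrow> real) \<Rightarrow> real \<Rightarrow> (real \<Rightarrow> real \<Rightarrow> real) \<Rightarrow> bool" where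
  "weak_solution V \<epsilon> \<rho>0 T \<rho> \<longleftrightarrow> C_L1_loc T \<rho> \<and> Linf_Linf T \<rho> \<and>
     (\<forall>\<phi>. spacetime_test_fun T \<phi> \<longrightarrow>
        (LINT t:{0<..<T}|lebesgue. (LINT x|lebesgue.
             \<rho> t x * deriv (\<lambda>s. \<phi> (s, x)) t
           + V (nonlocal \<epsilon> \<rho> t x) * \<rho> t x * deriv (\<lambda>y. \<phi> (t, y)) x))
        + (LINT x|lebesgue. \<rho>0 x * \<phi> (0, x)) = 0)"

end

theory Submission
  imports Defs
begin

text \<open>
  Write \<open>W\<close> for the averaged density, \<open>g(\<xi>) = \<xi> V'(\<xi>)\<close>, \<open>G' = g\<close> and \<open>U = G(W)\<close>. The quantity to be
  bounded is \<open>z = \<partial>\<^sub>x U\<close>, so the claim is the one-sided Lipschitz bound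
  \<open>U(t,x) - U(t,y) \<le> R (x - y) / (\<kappa> t)\<close> for \<open>y \<le> x\<close>.

  Averaging the equation shows \<open>\<partial>\<^sub>t W + V(W) \<partial>\<^sub>x W = -Z\<close>, where \<open>Z\<close> is the exponential average of \<open>z\<close>. For smooth
  solutions this gives, along characteristics,
  \<open>\<partial>\<^sub>t z = - g'(W) (\<partial>\<^sub>x W) Z - z\<^sup>2 / W - g(W) (Z - z) / \<epsilon>\<close>.
  At a positive maximum \<open>m\<close> of \<open>z\<close> one has \<open>Z \<le> m\<close>, and \<open>g \<le> 0\<close> makes the last term nonpositive. Under the
  second condition \<open>0 \<le> g' \<le> -(1 - \<kappa>) V'\<close>, so the first term is at most \<open>(1 - \<kappa>) m\<^sup>2 / W\<close>. Under the first
  condition \<open>g' \<le> 0\<close>: the first term helps if \<open>Z \<ge> 0\<close>, while for \<open>Z < 0\<close> it is absorbed by the last one, because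
  \<open>-\<partial>\<^sub>x W\<close> is at most the oscillation of the initial datum divided by \<open>\<epsilon>\<close>. In both cases
  \<open>m' \<le> - \<kappa> m\<^sup>2 / R\<close>, whose solutions lie below \<open>R / (\<kappa> t)\<close>.

  Since the density is only bounded, no derivative of \<open>z\<close> is available and the argument is carried out on difference
  quotients. Three facts replace the smooth calculus.

   \<^item> Mass is transported with an error of second order (\<open>mass_backward\<close>): the mass between two points at time
     \<open>t\<close> equals the mass between their images under the straight lines with velocities \<open>V(W)\<close>, followed backwards for
     a time \<open>h\<close>, up to \<open>O(h\<^sup>2)\<close>. This comes from testing the equation with functions moving along these lines; it
     needs no flow of characteristics.
   \<^item> A bounded function \<open>f\<close> with \<open>\<epsilon> f' = f - J'\<close> is controlled from above by the growth of \<open>J\<close>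
     (\<open>bounded_solution_le\<close>). Applied to \<open>W\<close> and to \<open>Z\<close> it gives their bounds; applied to the defect of the
     transport equation it gives \<open>W(t - h, x - h V(W)) = W + h Z + O(h\<^sup>2)\<close> (\<open>W_backward\<close>).
   \<^item> A quantity \<open>E \<ge> 0\<close> with \<open>E(t) \<le> E(s) + C (t - s) (E(t) + E(s)) + C (t - s)\<^sup>2\<close> that vanishes initially
     vanishes identically (\<open>discrete_Gronwall\<close>).

  With \<open>E\<close> the largest violation of \<open>\<integral> \<rho> \<le> S (x - y)\<close> or \<open>\<integral> \<rho> \<ge> I (x - y)\<close> this yields the maximum principle, and
  with \<open>E\<close> the largest violation of the one-sided Lipschitz bound it yields \<open>Oleinik_estimate\<close>.
\<close>

section \<open>A smooth step function\<close>

text \<open>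
  Phrased through derivative functions rather than iterates of \<open>deriv\<close>, so that closure under products and
  compositions follows by induction on the order.
\<close>

primrec Ck :: "nat \<Rightarrow> (real \<Rightarrow> real) \<Rightarrow> bool" where
  "Ck 0 f \<longleftrightarrow> continuous_on UNIV f"
| "Ck (Suc k) f \<longleftrightarrow> (\<exists>f'. (\<forall>x. (f has_real_derivative f' x) (at x)) \<and> Ck k f')"

definition smooth :: "(real \<Rightarrow> real) \<Rightarrow> bool" where
  "smooth f \<longleftrightarrow> (\<forall>k. Ck k f)"

lemma Ck_SucD: "Ck (Suc k) f \<Longrightarrow> Ck k f"
proof (induction k arbitrary: f)
  case 0
  then show ?case
    by (fastforce intro!: continuous_at_imp_continuous_on dest: DERIV_isCont)
next
  case (Suc k)
  then obtain f' where "\<forall>x. (f has_real_derivative f' x) (at x)" "Ck (Suc k) f'" by auto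
  then show ?case using Suc.IH[of f'] by auto
qed

lemma Ck_const: "Ck k (\<lambda>x. c)"
proof (induction k arbitrary: c)
  case (Suc k)
  have "\<forall>x. ((\<lambda>x. c) has_real_derivative 0) (at x)" by auto
  then show ?case using Suc[of 0] by (simp only: Ck.simps) (rule exI[of _ "\<lambda>x. 0"], simp)
qed simp

lemma Ck_add: "Ck k f \<Longrightarrow> Ck k g \<Longrightarrow> Ck k (\<lambda>x. f x + g x)"
proof (induction k arbitrary: f g)
  case 0
  then show ?case by (auto intro: continuous_intros)
next
  case (Suc k)
  then obtain f' g' where "\<forall>x. (f has_real_derivative f' x) (at x)" "Ck k f'"
    "\<forall>x. (g has_real_derivative g' x) (at x)" "Ck k g'" by auto
  then show ?case using Suc.IH[of f' g']
    by (auto intro!: exI[of _ "\<lambda>x. f' x + g' x"] derivative_intros)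
qed

lemma Ck_mult: "Ck k f \<Longrightarrow> Ck k g \<Longrightarrow> Ck k (\<lambda>x. f x * g x)"
proof (induction k arbitrary: f g)
  case 0
  then show ?case by (auto intro: continuous_intros)
next
  case (Suc k)
  then obtain f' g' where *: "\<forall>x. (f has_real_derivative f' x) (at x)" "Ck k f'"
    "\<forall>x. (g has_real_derivative g' x) (at x)" "Ck k g'" by auto
  have "Ck k f" "Ck k g" using Suc.prems Ck_SucD by blast+
  then have "Ck k (\<lambda>x. f' x * g x + g' x * f x)"
    using * Suc.IH by (intro Ck_add) auto
  then show ?case using *
    by (auto intro!: exI[of _ "\<lambda>x. f' x * g x + g' x * f x"] DERIV_mult)
qed

lemma Ck_affine: "Ck k f \<Longrightarrow> Ck k (\<lambda>x. f (a * x + b))"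
proof (induction k arbitrary: f)
  case 0
  then have "continuous_on UNIV f" by simp
  then have "continuous_on UNIV (\<lambda>x. f (a * x + b))"
    by (rule continuous_on_compose2) (auto intro!: continuous_intros)
  then show ?case by simp
next
  case (Suc k)
  then obtain f' where *: "\<forall>x. (f has_real_derivative f' x) (at x)" "Ck k f'" by auto
  have "((\<lambda>x. f (a * x + b)) has_real_derivative f' (a * x + b) * a) (at x)" for x
    using *(1) by (intro DERIV_chain2[of f "f' (a * x + b)" "\<lambda>x. a * x + b" x a])
      (auto intro!: derivative_eq_intros)
  moreover have "Ck k (\<lambda>x. f' (a * x + b) * a)"
    using Suc.IH *(2) by (intro Ck_mult Ck_const) auto
  ultimately show ?case
    unfolding Ck.simps by (intro exI[of _ "\<lambda>x. f' (a * x + b) * a"] conjI allI)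
qed

lemma Ck_inverse: "(\<And>x. f x \<noteq> 0) \<Longrightarrow> Ck k f \<Longrightarrow> Ck k (\<lambda>x. inverse (f x))"
proof (induction k arbitrary: f)
  case 0
  then show ?case by (auto intro!: continuous_intros)
next
  case (Suc k)
  then obtain f' where *: "\<forall>x. (f has_real_derivative f' x) (at x)" "Ck k f'" by auto
  have "((\<lambda>x. inverse (f x)) has_real_derivative (-1) * (inverse (f x) * f' x * inverse (f x))) (at x)" for x
    using DERIV_inverse'[of f "f' x" x] *(1) Suc.prems(1) by simp
  moreover have "Ck k (\<lambda>x. (-1) * (inverse (f x) * f' x * inverse (f x)))"
    using Suc.IH[of f] Suc.prems *(2) Ck_SucD by (intro Ck_mult Ck_const) auto
  ultimately show ?case
    unfolding Ck.simps by (intro exI[of _ "\<lambda>x. (-1) * (inverse (f x) * f' x * inverse (f x))"]) simp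
qed

lemma smooth_const: "smooth (\<lambda>x. c)"
  and smooth_add: "smooth f \<Longrightarrow> smooth g \<Longrightarrow> smooth (\<lambda>x. f x + g x)"
  and smooth_mult: "smooth f \<Longrightarrow> smooth g \<Longrightarrow> smooth (\<lambda>x. f x * g x)"
  and smooth_affine: "smooth f \<Longrightarrow> smooth (\<lambda>x. f (a * x + b))"
  and smooth_inverse: "(\<And>x. f x \<noteq> 0) \<Longrightarrow> smooth f \<Longrightarrow> smooth (\<lambda>x. inverse (f x))"
  by (auto simp: smooth_def intro: Ck_const Ck_add Ck_mult Ck_affine Ck_inverse)

lemma smooth_has_deriv: "smooth f \<Longrightarrow> (f has_real_derivative deriv f x) (at x)"
  unfolding smooth_def using Ck.simps(2) DERIV_deriv_iff_real_differentiable real_differentiable_def by metis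

lemma smooth_deriv: assumes "smooth f" shows "smooth (deriv f)"
  unfolding smooth_def
proof
  fix k
  have "Ck (Suc k) f" using assms by (simp add: smooth_def)
  then obtain f' where f': "\<forall>x. (f has_real_derivative f' x) (at x)" "Ck k f'" by auto
  then have "deriv f = f'" by (auto intro: DERIV_imp_deriv)
  then show "Ck k (deriv f)" using f' by simp
qed

lemma smooth_continuous_on: "smooth f \<Longrightarrow> continuous_on A f"
  unfolding smooth_def by (metis Ck.simps(1) continuous_on_subset subset_UNIV)

text \<open>
  Connects \<open>smooth\<close> with the iterated derivatives in the definition of test functions.
\<close>

lemma smooth_higher_differentiable:
  assumes "smooth f" shows "(deriv ^^ n) f field_differentiable (at x)"
proof -
  have "smooth ((deriv ^^ n) f)"
    by (induction n) (auto intro: smooth_deriv assms)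
  then show ?thesis
    using smooth_has_deriv field_differentiable_def by blast
qed

lemma smooth_test_fun:
  assumes "smooth \<phi>" "\<And>x. \<phi> x \<noteq> 0 \<Longrightarrow> a \<le> x \<and> x \<le> b"
  shows "test_fun \<phi>"
proof -
  have "closure {x. \<phi> x \<noteq> 0} \<subseteq> {a..b}"
    using assms(2) by (intro closure_minimal) auto
  then have "compact (closure {x. \<phi> x \<noteq> 0})"
    by (meson closed_closure compact_Icc compact_closure bounded_subset compact_imp_bounded
        closure_subset subset_trans)
  then show ?thesis unfolding test_fun_def using smooth_higher_differentiable[OF assms(1)] by blast
qed

lemma smooth_primitive:
  assumes "smooth f" "\<And>x. (F has_real_derivative f x) (at x)" shows "smooth F"
  unfolding smooth_def
proof
  fix k
  have "Ck (Suc k) F" using assms unfolding smooth_def by (simp only: Ck.simps) blast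
  then show "Ck k F" by (rule Ck_SucD)
qed

text \<open>
  Functions \<open>p(1/x) exp(-1/x)\<close>, extended by zero, are closed under differentiation, the derivative of \<open>p(u)\<close>
  turning into \<open>u\<^sup>2 (p - p')\<close>. They are continuous at the origin because the exponential beats every polynomial.
\<close>

lemma continuous_flat_poly: "continuous_on UNIV (\<lambda>x::real. if 0 < x then poly p (1 / x) * exp (- (1 / x)) else 0)"
proof -
  have lim: "((\<lambda>x::real. poly p (1 / x) * exp (- (1 / x))) \<longlongrightarrow> 0) (at_right 0)" for p
  proof -
    have "((\<lambda>u::real. poly p u / exp u) \<longlongrightarrow> 0) at_top"
    proof (induction p)
      case (pCons a p)
      have "((\<lambda>u::real. a * (u ^ 0 / exp u) + poly (p) u * u / exp u) \<longlongrightarrow> a * 0 + 0) at_top"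
      proof (intro tendsto_add tendsto_mult tendsto_const tendsto_power_div_exp_0)
        have "((\<lambda>u::real. \<Sum>i\<le>degree p. coeff p i * (u ^ Suc i / exp u)) \<longlongrightarrow> (\<Sum>i\<le>degree p. coeff p i * 0)) at_top"
          by (intro tendsto_sum tendsto_mult tendsto_const tendsto_power_div_exp_0)
        then show "((\<lambda>u. poly p u * u / exp u) \<longlongrightarrow> 0) at_top"
          by (simp add: poly_altdef sum_distrib_right sum_distrib_left sum_divide_distrib mult_ac)
      qed
      then show ?case by (simp add: add_divide_distrib mult.commute)
    qed simp
    from filterlim_compose[OF this filterlim_inverse_at_top_right] show ?thesis
      by (simp add: exp_minus field_simps)
  qed
  let ?F = "\<lambda>x. if 0 < x then poly p (1 / x) * exp (- (1 / x)) else 0"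
  have "isCont ?F x" for x :: real
  proof (cases x "0::real" rule: linorder_cases)
    case less
    then have "eventually (\<lambda>y. ?F y = 0) (nhds x)"
      by (intro eventually_nhds_in_open[THEN eventually_mono, of "{..<0}"]) auto
    then show ?thesis by (simp add: isCont_cong)
  next
    case greater
    then have "eventually (\<lambda>y. ?F y = poly p (1 / y) * exp (- (1 / y))) (nhds x)"
      by (intro eventually_nhds_in_open[THEN eventually_mono, of "{0<..}"]) auto
    moreover have "isCont (\<lambda>y. poly p (1 / y) * exp (- (1 / y))) x"
      using greater by (intro continuous_intros) auto
    ultimately show ?thesis by (subst isCont_cong)
  next
    case equal
    have "(?F \<longlongrightarrow> 0) (at_right 0)"
      using lim[of p] by (rule Lim_transform_eventually) (auto simp: eventually_at_filter)
    moreover have "(?F \<longlongrightarrow> 0) (at_left 0)"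
      by (rule Lim_transform_eventually[OF tendsto_const]) (auto simp: eventually_at_filter)
    ultimately show ?thesis using equal by (auto simp: isCont_def filterlim_split_at)
  qed
  then show ?thesis by (simp add: continuous_at_imp_continuous_on)
qed

lemma Ck_flat_poly: "Ck k (\<lambda>x. if 0 < x then poly p (1 / x) * exp (- (1 / x)) else 0)"
proof (induction k arbitrary: p)
  case 0
  show ?case using continuous_flat_poly by simp
next
  case (Suc k)
  let ?F = "\<lambda>p x. if 0 < x then poly p (1 / x) * exp (- (1 / x)) else 0"
  define q where "q = [:0, 0, 1:] * (p - pderiv p)"
  have "(?F p has_real_derivative ?F q x) (at x)" for x :: real
  proof (cases x "0::real" rule: linorder_cases)
    case less
    then have "eventually (\<lambda>y. ?F p y = 0) (nhds x)"
      by (intro eventually_nhds_in_open[THEN eventually_mono, of "{..<0}"]) auto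
    then have "(?F p has_real_derivative 0) (at x)"
      by (rule DERIV_cong_ev[THEN iffD2, OF refl _ refl]) auto
    then show ?thesis using less by simp
  next
    case greater
    then have "eventually (\<lambda>y. ?F p y = poly p (1 / y) * exp (- (1 / y))) (nhds x)"
      by (intro eventually_nhds_in_open[THEN eventually_mono, of "{0<..}"]) auto
    then have "(?F p has_real_derivative
       poly p (1 / x) * (exp (- (1 / x)) * (1 / x^2)) + (poly (pderiv p) (1 / x) * (- (1 / x^2))) * exp (- (1 / x))) (at x)"
    proof (rule DERIV_cong_ev[THEN iffD2, OF refl _ refl])
      have 1: "((\<lambda>y. 1 / y) has_real_derivative - (1 / x^2)) (at x)"
        using greater by (auto intro!: derivative_eq_intros simp: power2_eq_square)
      have 2: "((\<lambda>y. poly p (1 / y)) has_real_derivative poly (pderiv p) (1 / x) * (- (1 / x^2))) (at x)"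
        by (rule DERIV_chain2[OF poly_DERIV 1])
      have 3: "((\<lambda>y. exp (- (1 / y))) has_real_derivative exp (- (1 / x)) * (1 / x^2)) (at x)"
        using DERIV_chain2[OF DERIV_exp DERIV_minus[OF 1]] by simp
      show "((\<lambda>y. poly p (1 / y) * exp (- (1 / y))) has_real_derivative
        poly p (1 / x) * (exp (- (1 / x)) * (1 / x^2)) + (poly (pderiv p) (1 / x) * (- (1 / x^2))) * exp (- (1 / x))) (at x)"
        using DERIV_mult'[OF 2 3] by (simp add: add.commute mult_ac)
    qed
    moreover have "poly p (1 / x) * (exp (- (1 / x)) * (1 / x^2)) + (poly (pderiv p) (1 / x) * (- (1 / x^2))) * exp (- (1 / x))
        = poly q (1 / x) * exp (- (1 / x))"
      by (simp add: q_def power2_eq_square left_diff_distrib right_diff_distrib)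
    ultimately show ?thesis using greater by (simp del: poly_mult)
  next
    case equal
    have "continuous_on UNIV (?F ([:0,1:] * p))" by (rule continuous_flat_poly)
    then have "isCont (?F ([:0,1:] * p)) 0" by (simp add: continuous_on_eq_continuous_at)
    then have "(?F ([:0,1:] * p) \<longlongrightarrow> 0) (at 0)" by (simp add: isCont_def)
    then have "((\<lambda>h. (?F p (0 + h) - ?F p 0) / h) \<longlongrightarrow> 0) (at 0)"
      by (rule Lim_transform_eventually) (auto simp: eventually_at_filter field_simps)
    then show ?thesis using equal by (simp add: DERIV_def)
  qed
  with Suc[of q] show ?case
    unfolding Ck.simps by (intro exI[of _ "?F q"] conjI allI)
qed


text \<open>
  The classical function that is flat at the origin but not analytic there; quotients of it give a smooth step.
\<close>

definition flat :: "real \<Rightarrow> real" where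
  "flat x = (if 0 < x then exp (- (1 / x)) else 0)"

lemma smooth_flat: "smooth flat"
proof -
  have "flat = (\<lambda>x. if 0 < x then poly 1 (1 / x) * exp (- (1 / x)) else 0)"
    by (auto simp: flat_def)
  then show ?thesis using Ck_flat_poly[of _ 1] by (simp only: smooth_def) blast
qed

lemma flat_nonneg: "0 \<le> flat x" and flat_pos: "0 < x \<Longrightarrow> 0 < flat x" and flat_eq_0: "x \<le> 0 \<Longrightarrow> flat x = 0"
  by (auto simp: flat_def)

lemma mono_flat: assumes "x \<le> y" shows "flat x \<le> flat y"
proof (cases "0 < x")
  case True
  then have "1 / y \<le> 1 / x" using assms by (intro divide_left_mono) auto
  then show ?thesis using True assms by (simp add: flat_def)
qed (use flat_nonneg flat_eq_0 in auto)

definition step :: "real \<Rightarrow> real" where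
  "step x = flat x * inverse (flat x + flat (1 - x))"

lemma flat_sum_pos: "0 < flat x + flat (1 - x)"
  using flat_pos[of x] flat_pos[of "1 - x"] flat_nonneg[of x] flat_nonneg[of "1 - x"]
  by (cases "0 < x") linarith+

lemma smooth_step: "smooth step"
proof -
  have "smooth (\<lambda>x. flat ((-1) * x + 1))" by (rule smooth_affine[OF smooth_flat])
  then have "smooth (\<lambda>x. flat (1 - x))" by simp
  then have "smooth (\<lambda>x. flat x * inverse (flat x + flat (1 - x)))"
    using flat_sum_pos by (intro smooth_mult smooth_inverse smooth_add smooth_flat) (auto simp: less_imp_neq[symmetric])
  then show ?thesis by (simp add: step_def[abs_def])
qed

lemma step_nonneg: "0 \<le> step x" and step_le_1: "step x \<le> 1"
  using flat_sum_pos[of x] flat_nonneg[of x] flat_nonneg[of "1 - x"]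
  unfolding step_def divide_inverse[symmetric] by (auto simp: divide_le_eq_1)

lemma step_eq_0: "x \<le> 0 \<Longrightarrow> step x = 0" and step_eq_1: "1 \<le> x \<Longrightarrow> step x = 1"
  using flat_pos[of x] by (auto simp: step_def flat_eq_0)

lemma mono_step: assumes "x \<le> y" shows "step x \<le> step y"
proof -
  have "flat x * flat (1 - y) \<le> flat y * flat (1 - x)"
    using assms by (intro mult_mono mono_flat flat_nonneg) auto
  then have "flat x * (flat y + flat (1 - y)) \<le> flat y * (flat x + flat (1 - x))"
    by (simp add: ring_distribs mult.commute)
  then show ?thesis
    using flat_sum_pos[of x] flat_sum_pos[of y]
    unfolding step_def divide_inverse[symmetric] by (simp only: pos_divide_le_eq times_divide_eq_left pos_le_divide_eq)
qed

lemma deriv_step_nonneg: "0 \<le> deriv step x"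
proof (rule tendsto_lowerbound)
  show "((\<lambda>h. (step (x + h) - step x) / h) \<longlongrightarrow> deriv step x) (at 0)"
    using smooth_has_deriv[OF smooth_step, of x] by (simp add: DERIV_def)
  show "eventually (\<lambda>h. 0 \<le> (step (x + h) - step x) / h) (at 0)"
  proof (intro always_eventually allI)
    fix h :: real
    show "0 \<le> (step (x + h) - step x) / h"
      using mono_step[of x "x + h"] mono_step[of "x + h" x]
      by (cases "0 \<le> h") (auto intro: divide_nonneg_nonneg divide_nonpos_neg)
  qed
qed simp

lemma deriv_step_eq_0: assumes "x < 0 \<or> 1 < x" shows "deriv step x = 0"
proof -
  have "eventually (\<lambda>y. step y = step x) (nhds x)"
    using assms
  proof
    assume "x < 0"
    then show ?thesis
      by (intro eventually_nhds_in_open[THEN eventually_mono, of "{..<0}"]) (auto simp: step_eq_0)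
  next
    assume "1 < x"
    then show ?thesis
      by (intro eventually_nhds_in_open[THEN eventually_mono, of "{1<..}"]) (auto simp: step_eq_1)
  qed
  then have "(step has_real_derivative 0) (at x)"
    by (rule DERIV_cong_ev[THEN iffD2, OF refl _ refl]) simp
  then show ?thesis by (rule DERIV_imp_deriv)
qed

section \<open>Integration by error estimates of second order\<close>

text \<open>
  A quadratic error vanishes under subdivision. With \<open>K = 0\<close> this says that a function whose increments are of
  second order is constant; it replaces almost everywhere differentiation in the product and chain rules below.
\<close>

lemma Lipschitz_of_quadratic_error:
  fixes D :: "real \<Rightarrow> real"
  assumes "a \<le> b"
    and D: "\<And>u v. a \<le> u \<Longrightarrow> u \<le> v \<Longrightarrow> v \<le> b \<Longrightarrow> \<bar>D v - D u\<bar> \<le> K * (v - u) + C * (v - u)\<^sup>2"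
  shows "\<bar>D b - D a\<bar> \<le> K * (b - a)"
proof -
  have "\<bar>D b - D a\<bar> \<le> (K + e) * (b - a)" if "e > 0" for e
  proof -
    have "a \<le> a \<and> b \<le> b \<longrightarrow> \<bar>D b - D a\<bar> \<le> (K + e) * (b - a)"
    proof (rule Bolzano[where P = "\<lambda>u v. a \<le> u \<and> v \<le> b \<longrightarrow> \<bar>D v - D u\<bar> \<le> (K + e) * (v - u)", OF \<open>a \<le> b\<close>])
      fix u v w assume *: "a \<le> u \<and> v \<le> b \<longrightarrow> \<bar>D v - D u\<bar> \<le> (K + e) * (v - u)"
        "a \<le> v \<and> w \<le> b \<longrightarrow> \<bar>D w - D v\<bar> \<le> (K + e) * (w - v)" "u \<le> v" "v \<le> w"
      show "a \<le> u \<and> w \<le> b \<longrightarrow> \<bar>D w - D u\<bar> \<le> (K + e) * (w - u)"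
      proof
        assume "a \<le> u \<and> w \<le> b"
        with * have "\<bar>D v - D u\<bar> \<le> (K + e) * (v - u)" "\<bar>D w - D v\<bar> \<le> (K + e) * (w - v)" by auto
        then have "\<bar>D w - D u\<bar> \<le> (K + e) * (v - u) + (K + e) * (w - v)" by linarith
        also have "\<dots> = (K + e) * (w - u)" by (simp add: algebra_simps)
        finally show "\<bar>D w - D u\<bar> \<le> (K + e) * (w - u)" .
      qed
    next
      fix x assume "a \<le> x" "x \<le> b"
      show "\<exists>d>0. \<forall>u v. u \<le> x \<and> x \<le> v \<and> v - u < d \<longrightarrow> a \<le> u \<and> v \<le> b \<longrightarrow> \<bar>D v - D u\<bar> \<le> (K + e) * (v - u)"
      proof (intro exI[of _ "e / (\<bar>C\<bar> + 1)"] conjI allI impI)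
        show "0 < e / (\<bar>C\<bar> + 1)" using \<open>e > 0\<close> by (auto intro: divide_pos_pos)
        fix u v assume uv: "u \<le> x \<and> x \<le> v \<and> v - u < e / (\<bar>C\<bar> + 1)" "a \<le> u \<and> v \<le> b"
        then have "(v - u) * (\<bar>C\<bar> + 1) \<le> e" by (simp add: pos_less_divide_eq less_imp_le)
        moreover have "(v - u) * C \<le> (v - u) * (\<bar>C\<bar> + 1)" using uv by (intro mult_left_mono) auto
        ultimately have "(v - u) * ((v - u) * C) \<le> (v - u) * e" using uv by (intro mult_left_mono) auto
        then show "\<bar>D v - D u\<bar> \<le> (K + e) * (v - u)"
          using D[of u v] uv by (simp add: power2_eq_square algebra_simps)
      qed
    qed
    then show ?thesis by simp
  qed
  note * = this
  show ?thesis
  proof (rule field_le_epsilon)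
    fix e :: real assume "e > 0"
    have "\<bar>D b - D a\<bar> \<le> (K + e / (b - a + 1)) * (b - a)"
      using \<open>e > 0\<close> \<open>a \<le> b\<close> by (intro *) auto
    also have "\<dots> = K * (b - a) + e * ((b - a) / (b - a + 1))" by (simp add: algebra_simps)
    also have "e * ((b - a) / (b - a + 1)) \<le> e * 1"
      using \<open>e > 0\<close> \<open>a \<le> b\<close> by (intro mult_left_mono) auto
    finally show "\<bar>D b - D a\<bar> \<le> K * (b - a) + e" by simp
  qed
qed

lemma abs_integral_le:
  fixes f :: "real \<Rightarrow> real"
  assumes "f integrable_on {a..b}" "a \<le> b" "\<And>x. x \<in> {a..b} \<Longrightarrow> \<bar>f x\<bar> \<le> B"
  shows "\<bar>integral {a..b} f\<bar> \<le> B * (b - a)"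
proof -
  have "0 \<le> B" using assms(3)[of a] assms(2) by fastforce
  moreover have "(f has_integral integral {a..b} f) (cbox a b)" using assms(1) by auto
  ultimately have "norm (integral {a..b} f) \<le> B * measure lborel (cbox a b)"
    using assms by (intro has_integral_bound) auto
  then show ?thesis using assms by simp
qed

text \<open>
  Bounded everywhere and not only almost everywhere: densities are clipped to such representatives, which keeps null
  sets out of all later estimates.
\<close>

definition bmeas :: "real \<Rightarrow> (real \<Rightarrow> real) \<Rightarrow> bool" where
  "bmeas M f \<longleftrightarrow> f \<in> borel_measurable lebesgue \<and> (\<forall>x. \<bar>f x\<bar> \<le> M)"

lemma continuous_imp_lebesgue_measurable:
  fixes f :: "real \<Rightarrow> real"
  assumes "continuous_on UNIV f" shows "f \<in> borel_measurable lebesgue"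
  using assms by (simp add: borel_measurable_continuous_onI measurable_completion)

lemma bmeas_nonneg: "bmeas M f \<Longrightarrow> 0 \<le> M"
  unfolding bmeas_def by (meson abs_ge_zero order_trans)

lemma bmeas_absolutely_integrable:
  assumes "bmeas M f" shows "f absolutely_integrable_on {a..b}"
proof (rule measurable_bounded_by_integrable_imp_absolutely_integrable)
  show "f \<in> borel_measurable (lebesgue_on {a..b})"
    using assms by (auto simp: bmeas_def intro: measurable_restrict_space1)
  show "(\<lambda>x. M) integrable_on {a..b}" by (rule integrable_const_ivl)
qed (use assms in \<open>auto simp: bmeas_def\<close>)

lemma bmeas_integrable: "bmeas M f \<Longrightarrow> f integrable_on {a..b}"
  using bmeas_absolutely_integrable absolutely_integrable_on_def by blast

lemma bmeas_abs_integral_le: "bmeas M f \<Longrightarrow> a \<le> b \<Longrightarrow> \<bar>integral {a..b} f\<bar> \<le> M * (b - a)"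
  by (rule abs_integral_le) (auto intro: bmeas_integrable simp: bmeas_def)

text \<open>
  The product rule for a Lipschitz factor \<open>P\<close> that has no classical derivative: the difference between both sides has
  increments of second order.
\<close>

lemma integral_product_increment:
  fixes P p Q q :: "real \<Rightarrow> real"
  assumes "a \<le> b"
    and p: "bmeas M p"
    and P: "\<And>u v. a \<le> u \<Longrightarrow> u \<le> v \<Longrightarrow> v \<le> b \<Longrightarrow> P v - P u = integral {u..v} p"
    and Q: "\<And>x. (Q has_real_derivative q x) (at x)"
    and q: "continuous_on UNIV q"
  shows "(\<lambda>x. p x * Q x + P x * q x) integrable_on {a..b}"
    and "P b * Q b - P a * Q a = integral {a..b} (\<lambda>x. p x * Q x + P x * q x)"
proof -
  have cQ: "continuous_on S Q" for S
    using Q by (meson DERIV_continuous_on has_field_derivative_at_within)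
  have cq: "continuous_on S q" for S using q continuous_on_subset by blast
  have lip: "\<bar>P v - P u\<bar> \<le> M * (v - u)" if "a \<le> u" "u \<le> v" "v \<le> b" for u v
    using P[OF that] bmeas_abs_integral_le[OF p that(2)] by simp
  have "M \<ge> 0" using p bmeas_nonneg by blast
  have cP: "continuous_on {a..b} P"
  proof (rule lipschitz_on_continuous_on)
    show "M-lipschitz_on {a..b} P"
    proof (rule lipschitz_onI)
      fix x y assume "x \<in> {a..b}" "y \<in> {a..b}"
      then show "dist (P x) (P y) \<le> M * dist x y"
        using lip[of x y] lip[of y x] by (cases "x \<le> y") (auto simp: dist_real_def abs_minus_commute)
    qed (rule \<open>M \<ge> 0\<close>)
  qed
  obtain B where B: "\<And>x. x \<in> {a..b} \<Longrightarrow> \<bar>q x\<bar> \<le> B"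
  proof -
    have "compact (q ` {a..b})" by (intro compact_continuous_image cq) auto
    then show ?thesis using that compact_imp_bounded bounded_real by (metis image_eqI)
  qed
  have pQ: "(\<lambda>x. p x * Q x) absolutely_integrable_on {u..v}" for u v
    using bmeas_absolutely_integrable[OF p] cQ
    by (subst mult.commute, intro absolutely_integrable_bounded_measurable_product_real)
      (auto intro!: continuous_imp_measurable_on_sets_lebesgue compact_imp_bounded compact_continuous_image)
  have Pq: "(\<lambda>x. P x * q x) integrable_on {u..v}" if "a \<le> u" "v \<le> b" for u v
    using that by (intro integrable_continuous_interval continuous_intros cq continuous_on_subset[OF cP]) auto
  let ?f = "\<lambda>x. p x * Q x + P x * q x"
  have int: "?f integrable_on {u..v}" if "a \<le> u" "v \<le> b" for u v
    using pQ Pq[OF that] absolutely_integrable_on_def by (intro integrable_add) blast+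
  from int show "?f integrable_on {a..b}" by simp
  define D where "D = (\<lambda>x. P x * Q x - integral {a..x} ?f)"
  have "\<bar>D b - D a\<bar> \<le> 0 * (b - a)"
  proof (rule Lipschitz_of_quadratic_error[OF \<open>a \<le> b\<close>])
    fix u v assume uv: "a \<le> u" "u \<le> v" "v \<le> b"
    have B': "\<bar>q x\<bar> \<le> B" if "x \<in> {u..v}" for x using B uv that by auto
    have "B \<ge> 0" using B'[of u] uv by auto
    have QQ: "integral {u..v} q = Q v - Q u" if "u \<le> v" for u v :: real
      using fundamental_theorem_of_calculus[OF that, of Q q] Q
      by (auto simp: has_real_derivative_iff_has_vector_derivative has_vector_derivative_at_within integral_unique)
    have lipQ: "\<bar>Q v - Q x\<bar> \<le> B * (v - x)" if "x \<in> {u..v}" for x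
      using abs_integral_le[of q x v B] that B' QQ[of x v]
      by (auto intro: integrable_continuous_interval cq)
    have 1: "(\<lambda>s. p s * (Q v - Q s)) integrable_on {u..v}"
      using pQ[of u v] bmeas_integrable[OF p]
      by (auto simp: absolutely_integrable_on_def right_diff_distrib intro!: integrable_diff integrable_on_mult_left)
    have 2: "(\<lambda>s. (P u - P s) * q s) integrable_on {u..v}"
      using Pq[of u v] uv integrable_continuous_interval[OF cq]
      by (auto simp: left_diff_distrib intro!: integrable_diff integrable_on_mult_right)
    have "D v - D u = P v * Q v - P u * Q u - integral {u..v} ?f"
      using Henstock_Kurzweil_Integration.integral_combine[of a u v ?f] uv int[of a v] unfolding D_def by auto
    also have "P v * Q v - P u * Q u = (P v - P u) * Q v + P u * (Q v - Q u)" by (simp add: algebra_simps)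
    also have "\<dots> = integral {u..v} (\<lambda>s. p s * Q v) + integral {u..v} (\<lambda>s. P u * q s)"
      using P[OF uv] QQ[OF uv(2)] by simp
    also have "\<dots> = integral {u..v} (\<lambda>s. p s * Q v + P u * q s)"
      by (intro integral_add[symmetric] integrable_on_mult_left integrable_on_mult_right bmeas_integrable[OF p]
          integrable_continuous_interval cq)
    also have "\<dots> - integral {u..v} ?f = integral {u..v} (\<lambda>s. p s * Q v + P u * q s - ?f s)"
      using uv by (intro integral_diff[symmetric] int integrable_add integrable_on_mult_left integrable_on_mult_right bmeas_integrable[OF p]
          integrable_continuous_interval cq) auto
    also have "\<dots> = integral {u..v} (\<lambda>s. p s * (Q v - Q s) + (P u - P s) * q s)"
      by (simp add: algebra_simps)
    finally have "D v - D u = integral {u..v} (\<lambda>s. p s * (Q v - Q s) + (P u - P s) * q s)" .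
    moreover have "\<bar>integral {u..v} (\<lambda>s. p s * (Q v - Q s) + (P u - P s) * q s)\<bar> \<le> (M * (B * (v - u)) + (M * (v - u)) * B) * (v - u)"
    proof (rule abs_integral_le[OF integrable_add[OF 1 2] uv(2)])
      fix s assume s: "s \<in> {u..v}"
      have "\<bar>p s * (Q v - Q s)\<bar> \<le> M * (B * (v - u))"
        unfolding abs_mult
      proof (rule mult_mono)
        show "\<bar>p s\<bar> \<le> M" using p by (simp add: bmeas_def)
        show "\<bar>Q v - Q s\<bar> \<le> B * (v - u)"
          using lipQ[OF s] s \<open>B \<ge> 0\<close> by (smt (verit) atLeastAtMost_iff mult_left_mono)
      qed (use \<open>M \<ge> 0\<close> in auto)
      moreover have "\<bar>(P u - P s) * q s\<bar> \<le> (M * (v - u)) * B"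
        unfolding abs_mult
      proof (rule mult_mono)
        show "\<bar>P u - P s\<bar> \<le> M * (v - u)"
          using lip[of u s] s uv \<open>M \<ge> 0\<close> by (smt (verit) atLeastAtMost_iff mult_left_mono)
      qed (use \<open>M \<ge> 0\<close> uv B' s in auto)
      ultimately show "\<bar>p s * (Q v - Q s) + (P u - P s) * q s\<bar> \<le> M * (B * (v - u)) + (M * (v - u)) * B" by linarith
    qed
    ultimately show "\<bar>D v - D u\<bar> \<le> 0 * (v - u) + (2 * M * B) * (v - u)\<^sup>2"
      by (simp add: power2_eq_square algebra_simps)
  qed
  then show "P b * Q b - P a * Q a = integral {a..b} ?f" by (simp add: D_def)
qed

text \<open>
  The chain rule for a Lipschitz inner function: by the mean value theorem an increment of the outer function is
  \<open>g(\<theta>)\<close> times an increment of \<open>W\<close>, and \<open>g(\<theta>)\<close> may be replaced by \<open>g(W)\<close> at the cost of a second order error.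
\<close>

lemma integral_chain_increment:
  fixes W w G g :: "real \<Rightarrow> real"
  assumes "a \<le> b"
    and w: "bmeas M w"
    and W: "\<And>u v. a \<le> u \<Longrightarrow> u \<le> v \<Longrightarrow> v \<le> b \<Longrightarrow> W v - W u = integral {u..v} w"
    and rng: "\<And>x. a \<le> x \<Longrightarrow> x \<le> b \<Longrightarrow> W x \<in> {c..d}"
    and G: "\<And>x. x \<in> {c..d} \<Longrightarrow> (G has_real_derivative g x) (at x)"
    and g: "L-lipschitz_on {c..d} g"
  shows "(\<lambda>x. g (W x) * w x) integrable_on {a..b}"
    and "G (W b) - G (W a) = integral {a..b} (\<lambda>x. g (W x) * w x)"
proof -
  have lip: "\<bar>W v - W u\<bar> \<le> M * (v - u)" if "a \<le> u" "u \<le> v" "v \<le> b" for u v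
    using W[OF that] bmeas_abs_integral_le[OF w that(2)] by simp
  have "M \<ge> 0" using w bmeas_nonneg by blast
  have "L \<ge> 0" using g lipschitz_on_nonneg by blast
  have cW: "continuous_on {a..b} W"
  proof (rule lipschitz_on_continuous_on)
    show "M-lipschitz_on {a..b} W"
    proof (rule lipschitz_onI)
      fix x y assume "x \<in> {a..b}" "y \<in> {a..b}"
      then show "dist (W x) (W y) \<le> M * dist x y"
        using lip[of x y] lip[of y x] by (cases "x \<le> y") (auto simp: dist_real_def abs_minus_commute)
    qed (rule \<open>M \<ge> 0\<close>)
  qed
  have cgW: "continuous_on {a..b} (\<lambda>x. g (W x))"
    by (rule continuous_on_compose2[OF lipschitz_on_continuous_on[OF g] cW]) (use rng in auto)
  have int: "(\<lambda>x. g (W x) * w x) integrable_on {u..v}" if "a \<le> u" "v \<le> b" for u v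
  proof -
    have "(\<lambda>x. g (W x) * w x) absolutely_integrable_on {u..v}"
      using bmeas_absolutely_integrable[OF w] continuous_on_subset[OF cgW] that
      by (intro absolutely_integrable_bounded_measurable_product_real)
        (auto intro!: continuous_imp_measurable_on_sets_lebesgue compact_imp_bounded compact_continuous_image)
    then show ?thesis using absolutely_integrable_on_def by blast
  qed
  from int show "(\<lambda>x. g (W x) * w x) integrable_on {a..b}" by simp
  define D where "D = (\<lambda>x. G (W x) - integral {a..x} (\<lambda>x. g (W x) * w x))"
  have "\<bar>D b - D a\<bar> \<le> 0 * (b - a)"
  proof (rule Lipschitz_of_quadratic_error[OF \<open>a \<le> b\<close>])
    fix u v assume uv: "a \<le> u" "u \<le> v" "v \<le> b"
    have "\<exists>\<theta>\<in>{c..d}. \<bar>\<theta> - W u\<bar> \<le> \<bar>W v - W u\<bar> \<and> G (W v) - G (W u) = g \<theta> * (W v - W u)"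
    proof (cases "W u" "W v" rule: linorder_cases)
      case less
      have "\<exists>z. W u < z \<and> z < W v \<and> G (W v) - G (W u) = (W v - W u) * g z"
        using rng[of u] rng[of v] uv less by (intro MVT2 G) auto
      then obtain z where "W u < z" "z < W v" "G (W v) - G (W u) = (W v - W u) * g z" by blast
      then show ?thesis using rng[of u] rng[of v] uv by (intro bexI[of _ z]) auto
    next
      case greater
      have "\<exists>z. W v < z \<and> z < W u \<and> G (W u) - G (W v) = (W u - W v) * g z"
        using rng[of u] rng[of v] uv greater by (intro MVT2 G) auto
      then obtain z where "W v < z" "z < W u" "G (W u) - G (W v) = (W u - W v) * g z" by blast
      then show ?thesis using rng[of u] rng[of v] uv
        by (intro bexI[of _ z]) (auto simp: algebra_simps)
    qed (use rng[of u] uv in \<open>auto intro: bexI[of _ "W u"]\<close>)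
    then obtain \<theta> where \<theta>: "\<theta> \<in> {c..d}" "\<bar>\<theta> - W u\<bar> \<le> \<bar>W v - W u\<bar>" "G (W v) - G (W u) = g \<theta> * (W v - W u)"
      by blast
    have "D v - D u = g \<theta> * (W v - W u) - integral {u..v} (\<lambda>x. g (W x) * w x)"
      using Henstock_Kurzweil_Integration.integral_combine[of a u v "\<lambda>x. g (W x) * w x"] uv int[of a v] \<theta>(3)
      unfolding D_def by auto
    also have "g \<theta> * (W v - W u) = integral {u..v} (\<lambda>x. g \<theta> * w x)"
      using W[OF uv] by simp
    also have "\<dots> - integral {u..v} (\<lambda>x. g (W x) * w x) = integral {u..v} (\<lambda>x. g \<theta> * w x - g (W x) * w x)"
      using uv by (intro integral_diff[symmetric] int integrable_on_mult_right bmeas_integrable[OF w]) auto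
    finally have "D v - D u = integral {u..v} (\<lambda>x. g \<theta> * w x - g (W x) * w x)" .
    moreover have "\<bar>integral {u..v} (\<lambda>x. g \<theta> * w x - g (W x) * w x)\<bar> \<le> (L * (2 * M * (v - u)) * M) * (v - u)"
    proof (rule abs_integral_le[OF _ uv(2)])
      show "(\<lambda>x. g \<theta> * w x - g (W x) * w x) integrable_on {u..v}"
        using uv by (intro integrable_diff int integrable_on_mult_right bmeas_integrable[OF w]) auto
      fix s assume s: "s \<in> {u..v}"
      have "M * (s - u) \<le> M * (v - u)" using s \<open>M \<ge> 0\<close> by (intro mult_left_mono) auto
      then have "\<bar>\<theta> - W s\<bar> \<le> 2 * M * (v - u)" using \<theta>(2) lip[of u s] lip[of u v] s uv by auto
      moreover have "\<bar>g \<theta> - g (W s)\<bar> \<le> L * \<bar>\<theta> - W s\<bar>"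
        using lipschitz_onD[OF g \<theta>(1) rng[of s]] s uv by (auto simp: dist_real_def)
      ultimately have "\<bar>g \<theta> - g (W s)\<bar> \<le> L * (2 * M * (v - u))"
        using \<open>L \<ge> 0\<close> by (meson mult_left_mono order_trans)
      then have "\<bar>g \<theta> - g (W s)\<bar> * \<bar>w s\<bar> \<le> L * (2 * M * (v - u)) * M"
        using w by (intro mult_mono) (auto simp: bmeas_def)
      then show "\<bar>g \<theta> * w s - g (W s) * w s\<bar> \<le> L * (2 * M * (v - u)) * M"
        by (simp add: abs_mult[symmetric] left_diff_distrib)
    qed
    ultimately show "\<bar>D v - D u\<bar> \<le> 0 * (v - u) + (2 * L * M * M) * (v - u)\<^sup>2"
      by (simp add: power2_eq_square algebra_simps)
  qed
  then show "G (W b) - G (W a) = integral {a..b} (\<lambda>x. g (W x) * w x)" by (simp add: D_def)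
qed

section \<open>Test functions and weak derivatives on the line\<close>

lemma locally_integrable_imp_measurable:
  fixes f :: "real \<Rightarrow> real"
  assumes f: "\<And>a b. f absolutely_integrable_on {a..b}"
  shows "f \<in> borel_measurable lebesgue"
proof (rule borel_measurable_LIMSEQ_real)
  show "(\<lambda>x. indicator {-real n..real n} x * f x) \<in> borel_measurable lebesgue" for n
    using f[of "-real n" "real n"] by (auto simp: set_integrable_def)
  fix x :: real
  obtain m where m: "\<bar>x\<bar> \<le> real m" using real_arch_simple by blast
  have "eventually (\<lambda>n. indicator {-real n..real n} x * f x = f x) sequentially"
    using eventually_ge_at_top[of m] by eventually_elim (use m in \<open>auto simp: indicator_def\<close>)
  then show "(\<lambda>n. indicator {-real n..real n} x * f x) \<longlonglongrightarrow> f x" by (rule tendsto_eventually)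
qed

text \<open>
  On a compact set \<open>K\<close> of positive measure where \<open>f\<close> is negative the integral would be negative. But \<open>K\<close> is the
  decreasing limit of the unions of those intervals of the grid of width \<open>1/n\<close> that meet \<open>K\<close>, over which the integral
  is nonnegative, so dominated convergence gives a contradiction.
\<close>

lemma AE_nonneg_if_interval_integrals_nonneg:
  fixes f :: "real \<Rightarrow> real"
  assumes f: "\<And>a b. f absolutely_integrable_on {a..b}"
    and nonneg: "\<And>a b. a \<le> b \<Longrightarrow> 0 \<le> integral {a..b} f"
  shows "AE x in lebesgue. 0 \<le> f x"
proof -
  have compact_nonneg: "0 \<le> integral K f" if K: "compact K" for K
  proof -
    obtain k where "\<And>x. x \<in> K \<Longrightarrow> \<bar>x\<bar> \<le> k"
      using compact_imp_bounded[OF K] unfolding bounded_iff by auto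
    then have k: "K \<subseteq> {-k..k}" by (fastforce simp: abs_le_iff)
    \<comment> \<open>Indices of the grid cells that meet K, and these cells.\<close>
    define J where "J n = (\<lambda>x. \<lfloor>x * real (Suc n)\<rfloor>) ` K" for n
    define A where "A n j = {real_of_int j / real (Suc n) .. (real_of_int j + 1) / real (Suc n)}" for n j
    define E where "E n = (\<Union>j\<in>J n. A n j)" for n
    have memA: "x \<in> A n \<lfloor>x * real (Suc n)\<rfloor>" for x n
      using floor_correct[of "x * real (Suc n)"] by (auto simp: A_def field_simps)
    have KE: "K \<subseteq> E n" for n using memA by (auto simp: E_def J_def)
    have EK: "\<exists>y\<in>K. \<bar>x - y\<bar> \<le> 1 / real (Suc n)" if "x \<in> E n" for x n
    proof -
      from that obtain y where y: "y \<in> K" "x \<in> A n \<lfloor>y * real (Suc n)\<rfloor>" by (auto simp: E_def J_def)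
      have "\<bar>x - y\<bar> \<le> 1 / real (Suc n)"
        using y(2) memA[of y n] by (auto simp: A_def add_divide_distrib)
      then show ?thesis using y by blast
    qed
    have "finite (J n)" for n
    proof (rule finite_subset)
      show "J n \<subseteq> {\<lfloor>-k * real (Suc n)\<rfloor>..\<lfloor>k * real (Suc n)\<rfloor>}"
      proof
        fix j assume "j \<in> J n"
        then obtain x where x: "x \<in> K" "j = \<lfloor>x * real (Suc n)\<rfloor>" by (auto simp: J_def)
        then have "-k \<le> x" "x \<le> k" using k by auto
        then have "-k * real (Suc n) \<le> x * real (Suc n)" "x * real (Suc n) \<le> k * real (Suc n)"
          by (intro mult_right_mono; simp)+
        then show "j \<in> {\<lfloor>-k * real (Suc n)\<rfloor>..\<lfloor>k * real (Suc n)\<rfloor>}"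
          unfolding x(2) by (auto intro!: floor_mono simp del: of_nat_Suc)
      qed
    qed simp
    have Esub: "E n \<subseteq> {-k - 1..k + 1}" for n
    proof
      fix x assume "x \<in> E n"
      from EK[OF this] obtain y where "y \<in> K" "\<bar>x - y\<bar> \<le> 1 / real (Suc n)" by blast
      moreover have "1 / real (Suc n) \<le> 1" by simp
      ultimately have "\<bar>x - y\<bar> \<le> 1" by linarith
      moreover have "y \<in> {-k..k}" using \<open>y \<in> K\<close> k by blast
      ultimately show "x \<in> {-k - 1..k + 1}" by (auto simp: abs_le_iff)
    qed
    have int: "f integrable_on {a..b}" for a b using f absolutely_integrable_on_def by blast
    have hasE: "(f has_integral (\<Sum>j\<in>J n. integral (A n j) f)) (E n)" for n
      unfolding E_def
    proof (rule has_integral_UN)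
      show "finite (J n)" by fact
      show "(f has_integral integral (A n j) f) (A n j)" for j
        using int unfolding A_def by blast
      show "pairwise (\<lambda>i i'. negligible (A n i \<inter> A n i')) (J n)"
      proof (rule pairwiseI)
        fix i j assume "i \<in> J n" "j \<in> J n" "i \<noteq> j"
        have aux: "negligible (A n i \<inter> A n j)" if "i < j" for i j
        proof (rule negligible_subset)
          show "A n i \<inter> A n j \<subseteq> {real_of_int j / real (Suc n)}"
          proof
            fix x assume "x \<in> A n i \<inter> A n j"
            then have "real_of_int j / real (Suc n) \<le> x" "x \<le> (real_of_int i + 1) / real (Suc n)" by (auto simp: A_def)
            moreover have "(real_of_int i + 1) / real (Suc n) \<le> real_of_int j / real (Suc n)"
              using that by (intro divide_right_mono) linarith+
            ultimately show "x \<in> {real_of_int j / real (Suc n)}" by simp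
          qed
        qed simp
        show "negligible (A n i \<inter> A n j)"
          using aux[of i j] aux[of j i] \<open>i \<noteq> j\<close> by (cases "i < j") (auto simp: Int_commute)
      qed
    qed
    have Enn: "0 \<le> integral (E n) f" for n
    proof -
      have "integral (E n) f = (\<Sum>j\<in>J n. integral (A n j) f)" using hasE by (rule integral_unique)
      also have "\<dots> \<ge> 0" unfolding A_def
        by (intro sum_nonneg nonneg divide_right_mono) auto
      finally show ?thesis .
    qed
    define S where "S = {-k - 1..k + 1}"
    have "(\<lambda>n. integral S (\<lambda>x. if x \<in> E n then f x else 0)) \<longlonglongrightarrow> integral S (\<lambda>x. if x \<in> K then f x else 0)"
    proof (rule dominated_convergence(2))
      show "(\<lambda>x. if x \<in> E n then f x else 0) integrable_on S" for n
      proof -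
        have "E n \<inter> S = E n" using Esub[of n] by (auto simp: S_def)
        then show ?thesis using hasE[of n] unfolding integrable_restrict_Int by (auto simp: integrable_on_def)
      qed
      show "(\<lambda>x. \<bar>f x\<bar>) integrable_on S"
        using f[of "-k - 1" "k + 1"] unfolding S_def absolutely_integrable_on_def real_norm_def by blast
      show "norm (if x \<in> E n then f x else 0) \<le> \<bar>f x\<bar>" for n x by simp
      fix x assume "x \<in> S"
      show "(\<lambda>n. if x \<in> E n then f x else 0) \<longlonglongrightarrow> (if x \<in> K then f x else 0)"
      proof (cases "x \<in> K")
        case True then show ?thesis using KE by (auto simp: subset_iff)
      next
        case False
        have "open (- K)" using K compact_imp_closed by blast
        then obtain d where d: "d > 0" "\<And>y. \<bar>y - x\<bar> < d \<Longrightarrow> y \<notin> K"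
          using False unfolding open_dist by (auto simp: dist_real_def)
        have "eventually (\<lambda>n. 1 / real (Suc n) < d) sequentially"
          using d(1) LIMSEQ_inverse_real_of_nat by (simp add: order_tendstoD(2) inverse_eq_divide)
        then have "eventually (\<lambda>n. (if x \<in> E n then f x else 0) = 0) sequentially"
        proof eventually_elim
          case (elim n)
          have "x \<notin> E n"
          proof
            assume "x \<in> E n"
            from EK[OF this] d(2) elim show False by (force simp: abs_minus_commute)
          qed
          then show ?case by simp
        qed
        then show ?thesis using False by (simp add: tendsto_eventually)
      qed
    qed
    moreover have "integral S (\<lambda>x. if x \<in> E n then f x else 0) = integral (E n) f" for n
    proof -
      have "E n \<inter> S = E n" using Esub[of n] by (auto simp: S_def)
      then show ?thesis by (simp add: integral_restrict_Int)
    qed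
    moreover have "integral S (\<lambda>x. if x \<in> K then f x else 0) = integral K f"
    proof -
      have "K \<inter> S = K" using k by (auto simp: S_def)
      then show ?thesis by (simp add: integral_restrict_Int)
    qed
    ultimately have "(\<lambda>n. integral (E n) f) \<longlonglongrightarrow> integral K f" by simp
    then show ?thesis by (rule LIMSEQ_le_const) (use Enn in blast)
  qed
  have meas: "f \<in> borel_measurable lebesgue" by (rule locally_integrable_imp_measurable[OF f])
  have "AE x in lebesgue. x \<in> {-real n..real n} \<longrightarrow> 0 \<le> f x" for n
  proof -
    define N where "N = {x\<in>{-real n..real n}. f x < 0}"
    have N: "N \<in> sets lebesgue"
    proof -
      have "{x\<in>space lebesgue. f x < 0} \<in> sets lebesgue" using meas by measurable
      moreover have "N = {-real n..real n} \<inter> {x\<in>space lebesgue. f x < 0}" by (auto simp: N_def)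
      ultimately show ?thesis by (metis sets.Int atLeastAtMost_borel sets_completionI_sets sets_lborel)
    qed
    have "emeasure lebesgue N = 0"
    proof (rule ccontr)
      assume "emeasure lebesgue N \<noteq> 0"
      moreover have "emeasure lebesgue N < \<infinity>"
      proof -
        have "emeasure lebesgue N \<le> emeasure lebesgue {-real n..real n}"
          by (rule emeasure_mono) (auto simp: N_def)
        also have "\<dots> < \<infinity>" by simp
        finally show ?thesis .
      qed
      ultimately obtain e where e: "emeasure lebesgue N = ennreal e" "e > 0"
        by (cases "emeasure lebesgue N") (auto simp: less_eq_real_def)
      obtain K where K: "closed K" "K \<subseteq> N" "N - K \<in> lmeasurable" "emeasure lebesgue (N - K) < ennreal e"
        by (rule sets_lebesgue_inner_closed[OF N e(2)])
      have cK: "compact K"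
      proof -
        have "bounded K"
          by (rule bounded_subset[of "{-real n..real n}"]) (use K(2) in \<open>auto simp: N_def\<close>)
        then show ?thesis using K(1) compact_eq_bounded_closed by blast
      qed
      have "K \<in> sets lebesgue" using cK by (simp add: borel_compact)
      have absK: "f absolutely_integrable_on K"
        using K(2) \<open>K \<in> sets lebesgue\<close> by (intro set_integrable_subset[OF f[of "-real n" "real n"]]) (auto simp: N_def)
      have "(LINT x|lebesgue. indicator K x * (- f x)) = - integral K f"
        using set_lebesgue_integral_eq_integral(2)[OF absK] by (simp add: set_lebesgue_integral_def)
      moreover have nn: "AE x in lebesgue. 0 \<le> indicator K x * (- f x)"
        using K(2) by (intro AE_I2) (auto simp: indicator_def N_def)
      moreover have i: "integrable lebesgue (\<lambda>x. indicator K x * (- f x))"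
        using absK by (simp add: set_integrable_def)
      ultimately have "(LINT x|lebesgue. indicator K x * (- f x)) = 0"
        using compact_nonneg[OF cK] integral_nonneg_AE[OF nn] by linarith
      then have "AE x in lebesgue. indicator K x * (- f x) = 0"
        using integral_nonneg_eq_0_iff_AE[OF i nn] by blast
      then have "AE x in lebesgue. x \<notin> K"
        by eventually_elim (use K(2) in \<open>auto simp: indicator_def N_def split: if_splits\<close>)
      then have "emeasure lebesgue K = 0"
        using \<open>K \<in> sets lebesgue\<close> by (subst (asm) AE_iff_measurable[OF _ refl]) auto
      then have "emeasure lebesgue N \<le> emeasure lebesgue (N - K)"
        using emeasure_subadditive[of K lebesgue "N - K"] K(2,3) \<open>K \<in> sets lebesgue\<close> N by (simp add: Un_absorb1 sets.Diff)
      then show False using K(4) e by simp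
    qed
    then have "N \<in> null_sets lebesgue" using N by auto
    then have "AE x in lebesgue. x \<notin> N" by (rule AE_not_in)
    then show ?thesis by eventually_elim (auto simp: N_def)
  qed
  then have "AE x in lebesgue. \<forall>n. x \<in> {-real n..real n} \<longrightarrow> 0 \<le> f x"
    unfolding AE_all_countable by blast
  then show ?thesis
  proof eventually_elim
    case (elim x)
    obtain n where "\<bar>x\<bar> \<le> real n" using real_arch_simple by blast
    then show ?case using elim by (auto simp: abs_le_iff)
  qed
qed

lemma AE_zero_if_interval_integrals_zero:
  fixes f :: "real \<Rightarrow> real"
  assumes f: "\<And>a b. f absolutely_integrable_on {a..b}"
    and zero: "\<And>a b. a \<le> b \<Longrightarrow> integral {a..b} f = 0"
  shows "AE x in lebesgue. f x = 0"
proof -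
  have "AE x in lebesgue. 0 \<le> f x"
    by (rule AE_nonneg_if_interval_integrals_nonneg) (use f zero in auto)
  moreover have "AE x in lebesgue. 0 \<le> - f x"
    by (rule AE_nonneg_if_interval_integrals_nonneg)
      (use zero f in \<open>auto simp: set_integrable_def\<close>)
  ultimately show ?thesis by eventually_elim simp
qed


lemma L1_loc_absolutely_integrable: "L1_loc f \<Longrightarrow> f absolutely_integrable_on {a..b}"
  by (simp add: L1_loc_def)

lemma L1_locI:
  assumes "\<And>a b. f absolutely_integrable_on {a..b}" shows "L1_loc f"
  unfolding L1_loc_def
proof safe
  fix K :: "real set" assume "compact K"
  then have "bounded K" "K \<in> sets lebesgue"
    by (auto intro: compact_imp_bounded simp: borel_compact)
  then obtain a where "\<forall>x\<in>K. norm x \<le> a" unfolding bounded_iff by blast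
  then have "K \<subseteq> {-a..a}" by (fastforce simp: abs_le_iff)
  then show "f absolutely_integrable_on K"
    using assms \<open>K \<in> sets lebesgue\<close> set_integrable_subset by blast
qed

lemma L1_loc_bmeas: "bmeas M f \<Longrightarrow> L1_loc f"
  by (intro L1_locI bmeas_absolutely_integrable)

lemma L1_loc_continuous: "continuous_on UNIV f \<Longrightarrow> L1_loc f"
  by (rule L1_locI, rule absolutely_integrable_continuous_real, erule continuous_on_subset) simp

lemma integral_compact_support:
  fixes h :: "real \<Rightarrow> real"
  assumes "h absolutely_integrable_on {a..b}" "\<And>x. x \<notin> {a..b} \<Longrightarrow> h x = 0"
  shows "integrable lebesgue h" and "(LINT x|lebesgue. h x) = integral {a..b} h"
proof -
  have *: "(\<lambda>x. indicator {a..b} x *\<^sub>R h x) = h"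
    using assms(2) by (fastforce simp: indicator_def)
  show "integrable lebesgue h" using assms(1) by (simp only: set_integrable_def *)
  show "(LINT x|lebesgue. h x) = integral {a..b} h"
    using set_lebesgue_integral_eq_integral(2)[OF assms(1)] by (simp only: set_lebesgue_integral_def *)
qed

lemma absolutely_integrable_continuous_mult:
  fixes f \<phi> :: "real \<Rightarrow> real"
  assumes "f absolutely_integrable_on {a..b}" "continuous_on {a..b} \<phi>"
  shows "(\<lambda>x. f x * \<phi> x) absolutely_integrable_on {a..b}"
  using assms by (subst mult.commute, intro absolutely_integrable_bounded_measurable_product_real)
    (auto intro!: continuous_imp_measurable_on_sets_lebesgue compact_imp_bounded compact_continuous_image)

text \<open>
  Smooth functions supported in \<open>[a,b]\<close> that increase to the indicator of the open interval.
\<close>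

definition bump_on :: "real \<Rightarrow> real \<Rightarrow> nat \<Rightarrow> real \<Rightarrow> real" where
  "bump_on a b n x = step (real n * (x - a)) * step (real n * (b - x))"

lemma smooth_bump_on: "smooth (bump_on a b n)"
proof -
  have "smooth (\<lambda>x. step (real n * x + (- real n * a)) * step ((- real n) * x + real n * b))"
    by (intro smooth_mult smooth_affine smooth_step)
  then show ?thesis by (simp add: bump_on_def[abs_def] algebra_simps)
qed

lemma bump_on_support: "bump_on a b n x \<noteq> 0 \<Longrightarrow> a \<le> x \<and> x \<le> b"
  using step_eq_0[of "real n * (x - a)"] step_eq_0[of "real n * (b - x)"]
    mult_nonneg_nonpos[of "real n" "x - a"] mult_nonneg_nonpos[of "real n" "b - x"]
  by (cases "x \<le> a"; cases "b \<le> x") (auto simp: bump_on_def)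

lemma bump_on_bound: "0 \<le> bump_on a b n x" "bump_on a b n x \<le> 1"
  unfolding bump_on_def by (intro mult_nonneg_nonneg mult_le_one step_nonneg step_le_1)+

lemma bump_on_tendsto: "(\<lambda>n. bump_on a b n x) \<longlonglongrightarrow> indicator {a<..<b} x"
proof (cases "x \<in> {a<..<b}")
  case True
  define d where "d = min (x - a) (b - x)"
  have "d > 0" using True by (auto simp: d_def)
  obtain m where m: "1 / d \<le> real m" using real_arch_simple by blast
  have "eventually (\<lambda>n. bump_on a b n x = 1) sequentially"
    using eventually_ge_at_top[of m]
  proof eventually_elim
    case (elim n)
    have "1 \<le> real m * d" using m \<open>d > 0\<close> by (simp add: pos_divide_le_eq)
    also have "\<dots> \<le> real n * d" using elim \<open>d > 0\<close> by (intro mult_right_mono) auto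
    finally have nd: "1 \<le> real n * d" .
    also have "real n * d \<le> real n * (x - a)" by (intro mult_left_mono) (auto simp: d_def)
    finally have 1: "1 \<le> real n * (x - a)" .
    note nd
    also have "real n * d \<le> real n * (b - x)" by (intro mult_left_mono) (auto simp: d_def)
    finally show ?case using 1 by (simp add: bump_on_def step_eq_1)
  qed
  then show ?thesis using True by (auto intro: tendsto_eventually)
next
  case False
  then have "bump_on a b n x = 0" for n
    using step_eq_0[of "real n * (x - a)"] step_eq_0[of "real n * (b - x)"]
      mult_nonneg_nonpos[of "real n" "x - a"] mult_nonneg_nonpos[of "real n" "b - x"]
    by (cases "x \<le> a"; cases "b \<le> x") (auto simp: bump_on_def)
  then show ?thesis using False by simp
qed

text \<open>
  The fundamental lemma of the calculus of variations: the bumps turn the hypothesis into vanishing integrals over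
  intervals.
\<close>

lemma AE_zero_if_test_integrals_zero:
  assumes f: "L1_loc f"
    and zero: "\<And>\<phi> a b. smooth \<phi> \<Longrightarrow> (\<And>x. \<phi> x \<noteq> 0 \<Longrightarrow> a \<le> x \<and> x \<le> b) \<Longrightarrow> (LINT x|lebesgue. f x * \<phi> x) = 0"
  shows "AE x in lebesgue. f x = 0"
proof (rule AE_zero_if_interval_integrals_zero)
  show abs: "f absolutely_integrable_on {a..b}" for a b using f by (rule L1_loc_absolutely_integrable)
  fix a b :: real assume "a \<le> b"
  have "(\<lambda>n. integral {a..b} (\<lambda>x. f x * bump_on a b n x)) \<longlonglongrightarrow> integral {a..b} (\<lambda>x. f x * indicator {a<..<b} x)"
  proof (rule dominated_convergence(2))
    show "(\<lambda>x. f x * bump_on a b n x) integrable_on {a..b}" for n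
      using absolutely_integrable_continuous_mult[OF abs smooth_continuous_on[OF smooth_bump_on]]
      by (simp add: absolutely_integrable_on_def)
    show "(\<lambda>x. \<bar>f x\<bar>) integrable_on {a..b}"
      using abs[of a b] unfolding absolutely_integrable_on_def by simp
    show "norm (f x * bump_on a b n x) \<le> \<bar>f x\<bar>" for n x
      using bump_on_bound[of a b n x] by (simp add: abs_mult mult_left_le)
    show "(\<lambda>n. f x * bump_on a b n x) \<longlonglongrightarrow> f x * indicator {a<..<b} x" for x
      by (intro tendsto_mult tendsto_const bump_on_tendsto)
  qed
  moreover have "integral {a..b} (\<lambda>x. f x * bump_on a b n x) = 0" for n
  proof -
    have "integral {a..b} (\<lambda>x. f x * bump_on a b n x) = (LINT x|lebesgue. f x * bump_on a b n x)"
      using bump_on_support[of a b n]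
      by (intro integral_compact_support(2)[symmetric] absolutely_integrable_continuous_mult abs
          smooth_continuous_on smooth_bump_on) auto
    then show ?thesis using zero[OF smooth_bump_on bump_on_support] by simp
  qed
  moreover have "integral {a..b} (\<lambda>x. f x * indicator {a<..<b} x) = integral {a..b} f"
    by (rule integral_spike[of "{a, b}"]) (auto simp: indicator_def)
  ultimately show "integral {a..b} f = 0" by (simp add: LIMSEQ_const_iff)
qed

lemma test_fun_bounded_support:
  assumes "test_fun \<phi>"
  obtains A where "A > 0" "\<And>x. x \<notin> {-A<..<A} \<Longrightarrow> \<phi> x = 0" "\<And>x. x \<notin> {-A<..<A} \<Longrightarrow> deriv \<phi> x = 0"
    "\<And>x. (\<phi> has_real_derivative deriv \<phi> x) (at x)" "continuous_on UNIV (deriv \<phi>)"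
proof -
  have "compact (closure {x. \<phi> x \<noteq> 0})" using assms by (simp add: test_fun_def)
  then have "bounded (closure {x. \<phi> x \<noteq> 0})" by (rule compact_imp_bounded)
  then obtain B where B: "\<And>x. x \<in> closure {x. \<phi> x \<noteq> 0} \<Longrightarrow> \<bar>x\<bar> \<le> B"
    unfolding bounded_iff real_norm_def by blast
  have 0: "\<phi> x = 0" if "\<bar>B\<bar> < \<bar>x\<bar>" for x
    using B[of x] that closure_subset[of "{x. \<phi> x \<noteq> 0}"] by auto
  have d: "(deriv ^^ n) \<phi> field_differentiable (at x)" for n x using assms by (simp add: test_fun_def)
  have 1: "(\<phi> has_real_derivative deriv \<phi> x) (at x)" for x
    using d[of 0 x] by (simp add: field_differentiable_derivI)
  have "deriv \<phi> field_differentiable (at x)" for x using d[of 1 x] by simp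
  then have 2: "continuous_on UNIV (deriv \<phi>)"
    by (intro continuous_at_imp_continuous_on ballI field_differentiable_imp_continuous_at)
  have 3: "deriv \<phi> x = 0" if "\<bar>B\<bar> < \<bar>x\<bar>" for x
  proof -
    have "eventually (\<lambda>y. \<phi> y = 0) (nhds x)"
      by (rule eventually_mono[OF eventually_nhds_in_open[of "{y. \<bar>B\<bar> < \<bar>y\<bar>}"]])
        (use that 0 in \<open>auto intro!: open_Collect_less continuous_intros\<close>)
    then have "(\<phi> has_real_derivative 0) (at x)"
      by (rule DERIV_cong_ev[THEN iffD2, OF refl _ refl]) simp
    then show ?thesis by (rule DERIV_imp_deriv)
  qed
  have 4: "\<bar>B\<bar> < \<bar>x\<bar>" if "x \<notin> {-(\<bar>B\<bar> + 1)<..<\<bar>B\<bar> + 1}" for x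
    using that by (cases "0 \<le> x") auto
  show ?thesis
    by (rule that[of "\<bar>B\<bar> + 1"]) (use 0 1 2 3 4 in auto)
qed

lemma has_weak_deriv_unique:
  assumes "has_weak_deriv f g" "has_weak_deriv f h"
  shows "AE x in lebesgue. g x = h x"
proof -
  have L: "L1_loc g" "L1_loc h" using assms by (auto simp: has_weak_deriv_def)
  have "AE x in lebesgue. g x - h x = 0"
  proof (rule AE_zero_if_test_integrals_zero)
    show "L1_loc (\<lambda>x. g x - h x)" using L by (auto simp: L1_loc_def intro!: set_integral_diff(1))
    fix \<phi> and a b :: real assume \<phi>: "smooth \<phi>" "\<And>x. \<phi> x \<noteq> 0 \<Longrightarrow> a \<le> x \<and> x \<le> b"
    have "test_fun \<phi>" using \<phi> by (rule smooth_test_fun)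
    then have "(LINT x|lebesgue. g x * \<phi> x) = (LINT x|lebesgue. h x * \<phi> x)"
      using assms by (simp add: has_weak_deriv_def)
    moreover have "integrable lebesgue (\<lambda>x. u x * \<phi> x)" if "L1_loc u" for u
      using \<phi>(2) by (intro integral_compact_support(1)[where a = a and b = b] absolutely_integrable_continuous_mult
          L1_loc_absolutely_integrable that smooth_continuous_on \<phi>(1)) auto
    ultimately show "(LINT x|lebesgue. (g x - h x) * \<phi> x) = 0"
      using L by (simp add: left_diff_distrib)
  qed
  then show ?thesis by eventually_elim simp
qed

lemma has_weak_deriv_weak_deriv: "has_weak_deriv f g \<Longrightarrow> has_weak_deriv f (weak_deriv f)"
  unfolding weak_deriv_def by (rule someI[of "has_weak_deriv f" g])

lemma weak_deriv_AE: "has_weak_deriv f g \<Longrightarrow> AE x in lebesgue. weak_deriv f x = g x"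
  using has_weak_deriv_unique has_weak_deriv_weak_deriv by blast

text \<open>
  Primitives of locally bounded functions have the integrand as weak derivative.
\<close>

lemma integral_by_parts_test:
  assumes p: "\<And>A. \<exists>M q. bmeas M q \<and> (AE x in lebesgue. x \<in> {-A..A} \<longrightarrow> p x = q x)"
    and L: "L1_loc p"
    and P: "\<And>u v. u \<le> v \<Longrightarrow> P v - P u = integral {u..v} p"
    and \<phi>: "test_fun \<phi>"
  shows "(LINT x|lebesgue. P x * deriv \<phi> x) = - (LINT x|lebesgue. p x * \<phi> x)"
proof -
  obtain A where A: "A > 0" "\<And>x. x \<notin> {-A<..<A} \<Longrightarrow> \<phi> x = 0" "\<And>x. x \<notin> {-A<..<A} \<Longrightarrow> deriv \<phi> x = 0"
    "\<And>x. (\<phi> has_real_derivative deriv \<phi> x) (at x)" "continuous_on UNIV (deriv \<phi>)"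
    using test_fun_bounded_support[OF \<phi>] by blast
  obtain M q where q: "bmeas M q" "AE x in lebesgue. x \<in> {-A..A} \<longrightarrow> p x = q x" using p by blast
  have c\<phi>: "continuous_on S \<phi>" for S using A(4) by (meson DERIV_continuous_on has_field_derivative_at_within)
  obtain N where N: "negligible N" "\<And>x. x \<in> {-A..A} - N \<Longrightarrow> p x = q x"
  proof -
    obtain N where "\<And>x. x \<in> space lebesgue - N \<Longrightarrow> x \<in> {-A..A} \<longrightarrow> p x = q x" "N \<in> null_sets lebesgue"
      using AE_E3[OF q(2)] by blast
    then show ?thesis using that[of N] by (auto simp: negligible_iff_null_sets)
  qed
  have pq: "integral {u..v} p = integral {u..v} q" if "-A \<le> u" "v \<le> A" for u v
    by (rule integral_spike[OF N(1)]) (use N(2) that in auto)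
  have "P v - P u = integral {u..v} q" if "-A \<le> u" "u \<le> v" "v \<le> A" for u v
    using P pq that by simp
  note * = integral_product_increment[OF _ q(1) this A(4,5)]
  have int: "(\<lambda>x. q x * \<phi> x + P x * deriv \<phi> x) integrable_on {-A..A}"
    and eq: "P A * \<phi> A - P (- A) * \<phi> (- A) = integral {- A..A} (\<lambda>x. q x * \<phi> x + P x * deriv \<phi> x)"
    using *[of "-A" A] A(1) by auto
  have 1: "(\<lambda>x. p x * \<phi> x) absolutely_integrable_on {-A..A}"
    by (intro absolutely_integrable_continuous_mult L1_loc_absolutely_integrable L c\<phi>)
  have int_q: "(\<lambda>x. q x * \<phi> x) absolutely_integrable_on {-A..A}"
    by (intro absolutely_integrable_continuous_mult bmeas_absolutely_integrable[OF q(1)] c\<phi>)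
  have "continuous_on {-A..A} P"
  proof (rule lipschitz_on_continuous_on)
    show "M-lipschitz_on {-A..A} P"
    proof (rule lipschitz_onI)
      have lip: "\<bar>P v - P u\<bar> \<le> M * (v - u)" if "-A \<le> u" "u \<le> v" "v \<le> A" for u v
        using P[OF that(2)] pq[of u v] that bmeas_abs_integral_le[OF q(1) that(2)] by simp
      fix x y assume "x \<in> {-A..A}" "y \<in> {-A..A}"
      then show "dist (P x) (P y) \<le> M * dist x y"
        using lip[of x y] lip[of y x] by (cases "x \<le> y") (auto simp: dist_real_def abs_minus_commute)
    qed (rule bmeas_nonneg[OF q(1)])
  qed
  then have 2: "(\<lambda>x. P x * deriv \<phi> x) absolutely_integrable_on {-A..A}"
    by (intro absolutely_integrable_continuous_real continuous_intros continuous_on_subset[OF A(5)]) auto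
  have "(LINT x|lebesgue. P x * deriv \<phi> x) + (LINT x|lebesgue. p x * \<phi> x)
      = integral {-A..A} (\<lambda>x. P x * deriv \<phi> x) + integral {-A..A} (\<lambda>x. p x * \<phi> x)"
  proof -
    have "p x * \<phi> x = 0" "P x * deriv \<phi> x = 0" if "x \<notin> {-A..A}" for x
      using A(2)[of x] A(3)[of x] that by auto
    then show ?thesis
      using integral_compact_support(2)[OF 1] integral_compact_support(2)[OF 2] by simp
  qed
  also have "integral {-A..A} (\<lambda>x. p x * \<phi> x) = integral {-A..A} (\<lambda>x. q x * \<phi> x)"
    by (rule integral_spike[OF N(1)]) (use N(2) in auto)
  also have "integral {-A..A} (\<lambda>x. P x * deriv \<phi> x) + integral {-A..A} (\<lambda>x. q x * \<phi> x)
      = integral {- A..A} (\<lambda>x. q x * \<phi> x + P x * deriv \<phi> x)"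
    using int_q 2 unfolding absolutely_integrable_on_def by (simp add: Henstock_Kurzweil_Integration.integral_add)
  also have "\<dots> = 0" using eq A(1,2) by simp
  finally show ?thesis by linarith
qed

section \<open>Regularity of the velocity\<close>

text \<open>
  The integral from \<open>0\<close> to \<open>x\<close>, with the sign needed for negative \<open>x\<close>.
\<close>

definition primitive :: "(real \<Rightarrow> real) \<Rightarrow> real \<Rightarrow> real" where
  "primitive g x = (if 0 \<le> x then integral {0..x} g else - integral {x..0} g)"

lemma primitive_increment:
  assumes "\<And>a b. g integrable_on {a..b}" "u \<le> v"
  shows "primitive g v - primitive g u = integral {u..v} g"
proof -
  note c = Henstock_Kurzweil_Integration.integral_combine[of _ _ _ g, OF _ _ assms(1)]
  consider "0 \<le> u" | "u < 0" "0 \<le> v" | "v < 0" by linarith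
  then show ?thesis
  proof cases
    case 1 then show ?thesis using c[of 0 u v] assms(2) by (simp add: primitive_def)
  next
    case 2 then show ?thesis using c[of u 0 v] by (simp add: primitive_def)
  next
    case 3 then show ?thesis using c[of u v 0] assms(2) by (simp add: primitive_def)
  qed
qed

lemma continuous_primitive:
  assumes "\<And>a b. g integrable_on {a..b}" shows "continuous_on UNIV (primitive g)"
proof (rule continuous_at_imp_continuous_on, rule ballI)
  fix x :: real
  have "continuous_on {x - 1..x + 1} (\<lambda>y. primitive g (x - 1) + integral {x - 1..y} g)"
    by (intro continuous_intros indefinite_integral_continuous_1 assms)
  then have "continuous_on {x - 1..x + 1} (primitive g)"
  proof (rule continuous_on_eq)
    fix y assume "y \<in> {x - 1..x + 1}"
    then show "primitive g (x - 1) + integral {x - 1..y} g = primitive g y"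
      using primitive_increment[OF assms, of "x - 1" y] by simp
  qed
  then show "isCont (primitive g) x" by (rule continuous_on_interior) auto
qed

lemma DERIV_primitive:
  assumes "continuous_on UNIV g"
  shows "(primitive g has_real_derivative g x) (at x)"
proof -
  have int: "g integrable_on {a..b}" for a b
    using assms by (intro integrable_continuous_interval continuous_on_subset[OF assms]) auto
  have "((\<lambda>y. integral {x - 1..y} g) has_real_derivative g x) (at x within {x - 1..x + 1})"
    by (rule integral_has_real_derivative) (auto intro: continuous_on_subset[OF assms])
  then have "((\<lambda>y. integral {x - 1..y} g) has_real_derivative g x) (at x)"
    by (subst (asm) at_within_interior) auto
  then have d: "((\<lambda>y. integral {x - 1..y} g + primitive g (x - 1)) has_real_derivative g x) (at x)"
    by (auto intro!: derivative_eq_intros)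
  have ev: "eventually (\<lambda>y. integral {x - 1..y} g + primitive g (x - 1) = primitive g y) (nhds x)"
  proof (rule eventually_mono[OF eventually_nhds_in_open[of "{x - 1<..}"]])
    fix y assume "y \<in> {x - 1<..}"
    then show "integral {x - 1..y} g + primitive g (x - 1) = primitive g y"
      using primitive_increment[OF int, of "x - 1" y] by simp
  qed auto
  show ?thesis by (rule DERIV_cong_ev[THEN iffD1, OF refl ev refl d])
qed

lemma Linf_loc_locally_bounded:
  assumes "Linf_loc g"
  shows "\<exists>M q. bmeas M q \<and> (AE x in lebesgue. x \<in> {-A..A} \<longrightarrow> g x = q x)"
proof -
  obtain M where M: "AE x in lebesgue. x \<in> {-A..A} \<longrightarrow> \<bar>g x\<bar> \<le> M"
    using assms compact_Icc unfolding Linf_loc_def by blast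
  have [measurable]: "g \<in> borel_measurable lebesgue" using assms by (simp add: Linf_loc_def)
  have "bmeas \<bar>M\<bar> (\<lambda>x. max (- \<bar>M\<bar>) (min \<bar>M\<bar> (g x)))"
    unfolding bmeas_def by (auto simp: abs_le_iff)
  moreover have "AE x in lebesgue. x \<in> {-A..A} \<longrightarrow> g x = max (- \<bar>M\<bar>) (min \<bar>M\<bar> (g x))"
    using M by eventually_elim (auto simp: abs_le_iff)
  ultimately show ?thesis by blast
qed

lemma AE_imp_ex_in_interval:
  assumes "AE x in lebesgue. P x" "a < (b::real)"
  shows "\<exists>x. a < x \<and> x < b \<and> P x"
proof (rule ccontr)
  assume "\<not> ?thesis"
  then have "AE x in lebesgue. x \<notin> {a<..<b}"
    using assms(1) by (auto elim: eventually_mono)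
  then have "emeasure lebesgue {a<..<b} = 0"
    by (subst (asm) AE_iff_measurable[of "{a<..<b}"]) auto
  then show False using assms(2) by simp
qed

text \<open>
  A test function with vanishing integral is the derivative of a test function. Subtracting from \<open>\<phi>\<close> a multiple of
  a fixed bump \<open>\<beta>\<close> produces such a function, so \<open>\<integral> u \<phi>\<close> is proportional to \<open>\<integral> \<phi>\<close>.
\<close>

lemma AE_const_if_weak_deriv_zero:
  assumes u: "L1_loc u"
    and zero: "\<And>\<phi> a b. smooth \<phi> \<Longrightarrow> (\<And>x. \<phi> x \<noteq> 0 \<Longrightarrow> a \<le> x \<and> x \<le> b) \<Longrightarrow> (LINT x|lebesgue. u x * deriv \<phi> x) = 0"
  shows "\<exists>c. AE x in lebesgue. u x = c"
proof -
  define \<beta> where "\<beta> = bump_on (-1) 1 2"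
  have \<beta>: "smooth \<beta>" "\<And>x. \<beta> x \<noteq> 0 \<Longrightarrow> -1 \<le> x \<and> x \<le> 1"
    unfolding \<beta>_def by (rule smooth_bump_on, rule bump_on_support)
  have int\<beta>: "\<beta> integrable_on {a..b}" for a b
    by (intro integrable_continuous_interval smooth_continuous_on \<beta>(1))
  have "0 < integral {-1..1} \<beta>"
  proof -
    have "\<beta> 0 = 1" by (simp add: \<beta>_def bump_on_def step_eq_1)
    have "0 \<le> integral {-1..1} \<beta>" by (intro integral_nonneg int\<beta>) (auto simp: \<beta>_def bump_on_bound)
    moreover have "integral {-1..1} \<beta> \<noteq> 0"
      using integral_eq_0_iff[of "-1" 1 \<beta>] \<open>\<beta> 0 = 1\<close> smooth_continuous_on[OF \<beta>(1)]
      by (auto simp: \<beta>_def bump_on_bound)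
    ultimately show ?thesis by linarith
  qed
  define I where "I = integral {-1..1} \<beta>"
  have "I > 0" using \<open>0 < integral {-1..1} \<beta>\<close> by (simp add: I_def)
  define c where "c = (LINT x|lebesgue. u x * \<beta> x) / I"
  have int_u: "integrable lebesgue (\<lambda>x. u x * \<phi> x)" if "smooth \<phi>" "\<And>x. \<phi> x \<noteq> 0 \<Longrightarrow> a \<le> x \<and> x \<le> b" for \<phi> and a b :: real
    using that(2) by (intro integral_compact_support(1)[where a = a and b = b] absolutely_integrable_continuous_mult
          L1_loc_absolutely_integrable u smooth_continuous_on that(1)) auto
  have "AE x in lebesgue. u x - c = 0"
  proof (rule AE_zero_if_test_integrals_zero)
    show "L1_loc (\<lambda>x. u x - c)"
      using u L1_loc_continuous[of "\<lambda>x. c"] by (auto simp: L1_loc_def intro!: set_integral_diff(1))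
    fix \<phi> and a b :: real assume \<phi>: "smooth \<phi>" "\<And>x. \<phi> x \<noteq> 0 \<Longrightarrow> a \<le> x \<and> x \<le> b"
    define A where "A = \<bar>a\<bar> + \<bar>b\<bar> + 1"
    have A: "\<phi> x = 0" "\<beta> x = 0" if "x \<notin> {-A..A}" for x
    proof -
      have "\<bar>a\<bar> + \<bar>b\<bar> + 1 < \<bar>x\<bar>" using that by (cases "0 \<le> x") (auto simp: A_def)
      then have "\<not> (a \<le> x \<and> x \<le> b)" "\<not> (-1 \<le> x \<and> x \<le> 1)" by linarith+
      then show "\<phi> x = 0" "\<beta> x = 0" using \<phi>(2)[of x] \<beta>(2)[of x] by blast+
    qed
    define J where "J = integral {-A..A} \<phi>"
    define h where "h = (\<lambda>x. \<phi> x + (- (J / I)) * \<beta> x)"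
    have h: "smooth h" unfolding h_def by (intro smooth_add smooth_mult smooth_const \<phi>(1) \<beta>(1))
    have int: "\<phi> integrable_on {a..b}" "h integrable_on {a..b}" for a b
      by (intro integrable_continuous_interval smooth_continuous_on \<phi>(1) h)+
    have I: "I = integral {-A..A} \<beta>"
    proof -
      have "integral {-A..A} \<beta> = integral {-A..A} (\<lambda>x. if x \<in> {-1..1} then \<beta> x else 0)"
        by (rule Henstock_Kurzweil_Integration.integral_cong) (use \<beta>(2) in auto)
      also have "\<dots> = integral {-1..1} \<beta>"
        by (subst integral_restrict_Int) (auto simp: A_def intro!: arg_cong[where f = "\<lambda>S. integral S \<beta>"])
      finally show ?thesis by (simp add: I_def)
    qed
    have h0: "integral {-A..A} h = 0"
    proof -
      have "integral {-A..A} h = integral {-A..A} \<phi> + integral {-A..A} (\<lambda>x. (- (J / I)) * \<beta> x)"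
        unfolding h_def
        by (rule Henstock_Kurzweil_Integration.integral_add[OF int(1) integrable_on_mult_right[OF int\<beta>]])
      also have "integral {-A..A} (\<lambda>x. (- (J / I)) * \<beta> x) = (- (J / I)) * I"
        unfolding I by (rule Henstock_Kurzweil_Integration.integral_mult_right)
      finally show ?thesis using \<open>I > 0\<close> by (simp add: J_def)
    qed
    have hA: "h x = 0" if "x \<notin> {-A..A}" for x using A[OF that] by (simp add: h_def)
    define H where "H = (\<lambda>x. primitive h x - primitive h (-A))"
    have H: "(H has_real_derivative h x) (at x)" for x
      unfolding H_def by (auto intro!: derivative_eq_intros DERIV_primitive smooth_continuous_on h)
    have inc: "primitive h v - primitive h u = integral {u..v} h" if "u \<le> v" for u v
      by (rule primitive_increment[OF int(2) that])
    have z: "integral {u..v} h = 0" if "v \<le> -A \<or> A \<le> u" for u v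
    proof -
      have "integral {u..v} h = integral {u..v} (\<lambda>x. 0)"
        by (rule integral_spike[of "{-A, A}"]) (use hA that in auto)
      then show ?thesis by simp
    qed
    have supp: "H x = 0" if "x < -A \<or> A < x" for x
    proof -
      have "A \<ge> 0" by (simp add: A_def)
      show ?thesis
      proof (cases "x < -A")
        case True then show ?thesis using inc[of x "-A"] z[of "-A" x] by (simp add: H_def)
      next
        case False
        then have "A < x" using that by auto
        then show ?thesis using inc[of "-A" A] inc[of A x] z[of x A] h0 \<open>A \<ge> 0\<close> by (simp add: H_def)
      qed
    qed
    have "deriv H = h" using H by (auto intro: DERIV_imp_deriv)
    have "(LINT x|lebesgue. u x * deriv H x) = 0"
      by (rule zero[of H "-A" A]) (use smooth_primitive[OF h H] supp in \<open>auto simp: not_le[symmetric]\<close>)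
    then have "(LINT x|lebesgue. u x * \<phi> x + (- (J / I)) * (u x * \<beta> x)) = 0"
      by (simp add: \<open>deriv H = h\<close> h_def algebra_simps)
    then have "(LINT x|lebesgue. u x * \<phi> x) + (- (J / I)) * (LINT x|lebesgue. u x * \<beta> x) = 0"
      using int_u[OF \<phi>] int_u[OF \<beta>] by (subst (asm) Bochner_Integration.integral_add) auto
    then have "(LINT x|lebesgue. u x * \<phi> x) = c * J" by (simp add: c_def)
    also have "J = (LINT x|lebesgue. \<phi> x)"
      unfolding J_def
      by (intro integral_compact_support(2)[symmetric] absolutely_integrable_continuous_real smooth_continuous_on \<phi>(1))
        (use A in auto)
    finally have "(LINT x|lebesgue. u x * \<phi> x) = (LINT x|lebesgue. c * \<phi> x)" by simp
    moreover have "integrable lebesgue \<phi>"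
      by (rule integral_compact_support(1)[where a = "-A" and b = A])
        (use A in \<open>auto intro!: absolutely_integrable_continuous_real smooth_continuous_on \<phi>(1)\<close>)
    ultimately show "(LINT x|lebesgue. (u x - c) * \<phi> x) = 0"
      using int_u[OF \<phi>] by (simp add: left_diff_distrib)
  qed
  then have "AE x in lebesgue. u x = c" by eventually_elim simp
  then show ?thesis by blast
qed

lemma has_weak_deriv_imp_primitive:
  assumes fg: "has_weak_deriv f g" and g: "Linf_loc g"
  shows "\<exists>c. AE x in lebesgue. f x = c + primitive g x"
proof -
  have Lg: "L1_loc g" and Lf: "L1_loc f" using fg by (auto simp: has_weak_deriv_def)
  have gi: "g integrable_on {a..b}" for a b
    using L1_loc_absolutely_integrable[OF Lg] absolutely_integrable_on_def by blast
  have inc: "primitive g v - primitive g u = integral {u..v} g" if "u \<le> v" for u v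
    by (rule primitive_increment[OF gi that])
  have "continuous_on UNIV (primitive g)" by (rule continuous_primitive[OF gi])
  then have LP: "L1_loc (primitive g)" by (rule L1_loc_continuous)
  have "\<exists>c. AE x in lebesgue. f x - primitive g x = c"
  proof (rule AE_const_if_weak_deriv_zero)
    show "L1_loc (\<lambda>x. f x - primitive g x)" using Lf LP by (auto simp: L1_loc_def intro!: set_integral_diff(1))
    fix \<phi> and a b :: real assume \<phi>: "smooth \<phi>" "\<And>x. \<phi> x \<noteq> 0 \<Longrightarrow> a \<le> x \<and> x \<le> b"
    have t: "test_fun \<phi>" using \<phi> by (rule smooth_test_fun)
    obtain A where A: "\<And>x. x \<notin> {-A<..<A} \<Longrightarrow> deriv \<phi> x = 0"
      using test_fun_bounded_support[OF t] by metis
    have i: "integrable lebesgue (\<lambda>x. u x * deriv \<phi> x)" if "L1_loc u" for u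
      using A by (intro integral_compact_support(1)[where a = "-A" and b = A] absolutely_integrable_continuous_mult
          L1_loc_absolutely_integrable that smooth_continuous_on smooth_deriv \<phi>(1)) auto
    have "(LINT x|lebesgue. f x * deriv \<phi> x) = (LINT x|lebesgue. primitive g x * deriv \<phi> x)"
      using integral_by_parts_test[OF Linf_loc_locally_bounded[OF g] Lg inc t] fg t
      by (simp add: has_weak_deriv_def)
    then show "(LINT x|lebesgue. (f x - primitive g x) * deriv \<phi> x) = 0"
      using i[OF Lf] i[OF LP] by (simp add: left_diff_distrib)
  qed
  then show ?thesis by (auto simp: algebra_simps)
qed

text \<open>
  Almost everywhere \<open>V\<close> equals a continuously differentiable function. Being monotone, it equals that function at every
  point: between the values at nearby points of agreement there is no room for a jump. Hence \<open>deriv V\<close> is the classical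
  derivative, and the weak second derivative recovers its increments.
\<close>

lemma W2inf_loc_antimono_C1:
  assumes W: "W2inf_loc V" and anti: "antimono V"
  obtains V2 where "Linf_loc V2" "\<And>x. (V has_real_derivative deriv V x) (at x)"
    "\<And>u v. u \<le> v \<Longrightarrow> deriv V v - deriv V u = integral {u..v} V2"
    "AE x in lebesgue. weak_deriv (deriv V) x = V2 x"
    "\<And>x. deriv V x \<le> 0"
proof -
  obtain V1 V2 where V12: "Linf_loc V1" "Linf_loc V2" "has_weak_deriv V V1" "has_weak_deriv V1 V2"
    using W unfolding W2inf_loc_def by blast
  obtain c1 where c1: "AE x in lebesgue. V1 x = c1 + primitive V2 x"
    using has_weak_deriv_imp_primitive V12 by blast
  obtain c0 where c0: "AE x in lebesgue. V x = c0 + primitive V1 x"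
    using has_weak_deriv_imp_primitive V12 by blast
  define v1 where "v1 = (\<lambda>x. c1 + primitive V2 x)"
  have L2: "L1_loc V2" using V12 by (simp add: has_weak_deriv_def)
  have V2i: "V2 integrable_on {a..b}" for a b
    using L1_loc_absolutely_integrable[OF L2] absolutely_integrable_on_def by blast
  have v1_inc: "v1 v - v1 u = integral {u..v} V2" if "u \<le> v" for u v
    using primitive_increment[OF V2i that] by (simp add: v1_def)
  have cv1: "continuous_on UNIV v1"
    unfolding v1_def by (intro continuous_intros continuous_primitive V2i)
  define Vc where "Vc = (\<lambda>x. c0 + primitive v1 x)"
  have dVc: "(Vc has_real_derivative v1 x) (at x)" for x
    unfolding Vc_def by (auto intro!: derivative_eq_intros DERIV_primitive cv1)
  have "primitive V1 x = primitive v1 x" for x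
  proof -
    obtain N where N: "\<And>x. x \<in> space lebesgue - N \<Longrightarrow> V1 x = v1 x" "N \<in> null_sets lebesgue"
      using AE_E3[OF c1] unfolding v1_def by blast
    then have "negligible N" by (simp add: negligible_iff_null_sets)
    have "integral {a..b} V1 = integral {a..b} v1" for a b
      by (rule integral_spike[OF \<open>negligible N\<close>]) (use N in auto)
    then show ?thesis by (simp add: primitive_def)
  qed
  then have ae: "AE x in lebesgue. V x = Vc x" using c0 by (simp add: Vc_def)
  have cVc: "isCont Vc x" for x using dVc DERIV_isCont by blast
  have "V = Vc"
  proof
    fix x
    have 1: "Vc x \<le> V x + e" if "e > 0" for e
    proof -
      obtain d where d: "d > 0" "\<And>y. \<bar>y - x\<bar> < d \<Longrightarrow> \<bar>Vc y - Vc x\<bar> < e"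
        using cVc[of x] \<open>e > 0\<close> unfolding continuous_at_eps_delta by (auto simp: dist_real_def)
      obtain y where "x < y" "y < x + d" "V y = Vc y" using AE_imp_ex_in_interval[OF ae, of x "x + d"] d(1) by auto
      moreover have "V y \<le> V x" using anti \<open>x < y\<close> by (simp add: antimonoD)
      ultimately show ?thesis using d(2)[of y] by auto
    qed
    have 2: "V x \<le> Vc x + e" if "e > 0" for e
    proof -
      obtain d where d: "d > 0" "\<And>y. \<bar>y - x\<bar> < d \<Longrightarrow> \<bar>Vc y - Vc x\<bar> < e"
        using cVc[of x] \<open>e > 0\<close> unfolding continuous_at_eps_delta by (auto simp: dist_real_def)
      obtain y where "x - d < y" "y < x" "V y = Vc y" using AE_imp_ex_in_interval[OF ae, of "x - d" x] d(1) by auto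
      moreover have "V x \<le> V y" using anti \<open>y < x\<close> by (simp add: antimonoD)
      ultimately show ?thesis using d(2)[of y] by auto
    qed
    show "V x = Vc x"
      using field_le_epsilon[OF 1] field_le_epsilon[OF 2] by (rule antisym[rotated])
  qed
  then have dV: "deriv V = v1" using dVc by (auto intro: DERIV_imp_deriv)
  have "has_weak_deriv v1 V2"
    unfolding has_weak_deriv_def
    using L1_loc_continuous[OF cv1] L2 integral_by_parts_test[OF Linf_loc_locally_bounded[OF V12(2)] L2 v1_inc] by blast
  then have ae2: "AE x in lebesgue. weak_deriv (deriv V) x = V2 x"
    using weak_deriv_AE dV by simp
  have "v1 x \<le> 0" for x
  proof (rule ccontr)
    assume "\<not> v1 x \<le> 0"
    then obtain d where d: "d > 0" "\<And>h. 0 < h \<Longrightarrow> h < d \<Longrightarrow> Vc x < Vc (x + h)"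
      using DERIV_pos_inc_right[OF dVc[of x]] by auto
    have "Vc (x + d / 2) \<le> Vc x" using anti \<open>V = Vc\<close> d(1) by (auto intro: antimonoD)
    then show False using d(2)[of "d / 2"] d(1) by simp
  qed
  then show ?thesis
    using that[OF V12(2)] dVc v1_inc ae2 \<open>V = Vc\<close> dV by simp
qed

section \<open>The one-sided exponential average\<close>

text \<open>
  The nonlocal operator applied to a single spatial profile. It is applied to \<open>\<rho>\<close> and also to \<open>U\<close>.
\<close>

definition expavg :: "real \<Rightarrow> (real \<Rightarrow> real) \<Rightarrow> real \<Rightarrow> real" where
  "expavg \<epsilon> r x = 1 / \<epsilon> * (LINT y:{x..}|lebesgue. exp ((x - y) / \<epsilon>) * r y)"

lemma nonlocal_eq_expavg: "nonlocal \<epsilon> \<rho> t = expavg \<epsilon> (\<rho> t)"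
  by (simp add: fun_eq_iff nonlocal_def expavg_def)

lemma exp_weight_measurable: "(\<lambda>y::real. exp ((x - y) / \<epsilon>)) \<in> borel_measurable lebesgue"
  by (rule continuous_imp_lebesgue_measurable) (cases "\<epsilon> = 0", auto intro!: continuous_intros)

lemma expavg_cong_AE:
  assumes "f \<in> borel_measurable lebesgue" "g \<in> borel_measurable lebesgue" "AE x in lebesgue. f x = g x"
  shows "expavg \<epsilon> f = expavg \<epsilon> g"
proof
  fix x :: real
  have m: "(\<lambda>y. indicator {x..} y * (exp ((x - y) / \<epsilon>) * h y)) \<in> borel_measurable lebesgue"
    if "h \<in> borel_measurable lebesgue" for h
    by (intro borel_measurable_times borel_measurable_indicator sets_completionI_sets exp_weight_measurable that) simp
  have "(LINT y:{x..}|lebesgue. exp ((x - y) / \<epsilon>) * f y) = (LINT y:{x..}|lebesgue. exp ((x - y) / \<epsilon>) * g y)"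
    unfolding set_lebesgue_integral_def real_scaleR_def
    by (rule integral_cong_AE[OF m[OF assms(1)] m[OF assms(2)]]) (use assms(3) in eventually_elim, simp)
  then show "expavg \<epsilon> f x = expavg \<epsilon> g x" by (simp add: expavg_def)
qed

lemma has_integral_exp_weight:
  assumes "\<epsilon> > 0"
  shows "((\<lambda>y::real. exp ((x - y) / \<epsilon>)) has_integral \<epsilon> * exp ((x - z) / \<epsilon>)) {z..}"
proof -
  have "((\<lambda>y. exp (x / \<epsilon>) * exp (-(1 / \<epsilon>) * y)) has_integral exp (x / \<epsilon>) * (exp (-(1 / \<epsilon>) * z) / (1 / \<epsilon>))) {z..}"
    by (rule has_integral_mult_right, rule has_integral_exp_minus_to_infinity) (use assms in simp)
  moreover have h: "exp (x / \<epsilon>) * exp (-(1 / \<epsilon>) * y) = exp ((x - y) / \<epsilon>)" for y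
    by (simp add: exp_add[symmetric] diff_divide_distrib)
  moreover have "exp (x / \<epsilon>) * (exp (-(1 / \<epsilon>) * z) / (1 / \<epsilon>)) = \<epsilon> * exp ((x - z) / \<epsilon>)"
    unfolding h[symmetric] by simp
  ultimately show ?thesis by (simp only:)
qed

lemma exp_weight_mult_integrable:
  assumes "\<epsilon> > 0" and r: "bmeas M r"
  shows "(\<lambda>y. exp ((x - y) / \<epsilon>) * r y) absolutely_integrable_on {z..}"
proof (rule measurable_bounded_by_integrable_imp_absolutely_integrable)
  show "(\<lambda>y. exp ((x - y) / \<epsilon>) * r y) \<in> borel_measurable (lebesgue_on {z..})"
    using r exp_weight_measurable by (auto simp: bmeas_def intro!: measurable_restrict_space1 borel_measurable_times)
  show "(\<lambda>y. exp ((x - y) / \<epsilon>) * M) integrable_on {z..}"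
    using has_integral_exp_weight[OF assms(1)] by (intro integrable_on_mult_left) blast
  fix y show "norm (exp ((x - y) / \<epsilon>) * r y) \<le> exp ((x - y) / \<epsilon>) * M"
    using r by (auto simp: bmeas_def abs_mult intro!: mult_left_mono)
qed auto

lemma exp_weight_tail:
  assumes "\<epsilon> > 0" and r: "bmeas M r"
  shows "\<bar>integral {z..} (\<lambda>y. exp ((x - y) / \<epsilon>) * r y)\<bar> \<le> \<epsilon> * exp ((x - z) / \<epsilon>) * M"
proof -
  have h: "((\<lambda>y. exp ((x - y) / \<epsilon>) * M) has_integral \<epsilon> * exp ((x - z) / \<epsilon>) * M) {z..}"
    by (rule has_integral_mult_left[OF has_integral_exp_weight[OF assms(1)]])
  have "norm (integral {z..} (\<lambda>y. exp ((x - y) / \<epsilon>) * r y)) \<le> integral {z..} (\<lambda>y. exp ((x - y) / \<epsilon>) * M)"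
  proof (rule integral_norm_bound_integral)
    show "(\<lambda>y. exp ((x - y) / \<epsilon>) * r y) integrable_on {z..}"
      using exp_weight_mult_integrable[OF assms] absolutely_integrable_on_def by blast
    show "(\<lambda>y. exp ((x - y) / \<epsilon>) * M) integrable_on {z..}" using h by blast
    show "norm (exp ((x - y) / \<epsilon>) * r y) \<le> exp ((x - y) / \<epsilon>) * M" for y
      using r by (auto simp: bmeas_def abs_mult intro!: mult_left_mono)
  qed
  then show ?thesis unfolding integral_unique[OF h] by simp
qed

lemma exp_weight_split:
  assumes "\<epsilon> > 0" "bmeas M r" "u \<le> v"
  shows "integral {u..} (\<lambda>y. exp ((x - y) / \<epsilon>) * r y)
    = integral {u..v} (\<lambda>y. exp ((x - y) / \<epsilon>) * r y) + integral {v..} (\<lambda>y. exp ((x - y) / \<epsilon>) * r y)"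
proof -
  let ?f = "\<lambda>y. exp ((x - y) / \<epsilon>) * r y"
  have *: "?f absolutely_integrable_on {z..}" for z by (rule exp_weight_mult_integrable[OF assms(1,2)])
  have 1: "?f integrable_on {v..}" using * absolutely_integrable_on_def by blast
  have "?f absolutely_integrable_on {u..v}" by (rule set_integrable_subset[OF *[of u]]) auto
  then have 2: "?f integrable_on {u..v}" using absolutely_integrable_on_def by blast
  have "{u..} = {u..v} \<union> {v..}" using assms(3) by auto
  moreover have "{u..v} \<inter> {v..} = {v}" using assms(3) by auto
  ultimately show ?thesis using integral_Un[OF 2 1] by simp
qed

lemma expavg_eq_integral:
  assumes "\<epsilon> > 0" "bmeas M r"
  shows "expavg \<epsilon> r x = 1 / \<epsilon> * integral {x..} (\<lambda>y. exp ((x - y) / \<epsilon>) * r y)"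
  using set_lebesgue_integral_eq_integral(2)[OF exp_weight_mult_integrable[OF assms]] by (simp add: expavg_def)

lemma expavg_abs_le:
  assumes "\<epsilon> > 0" "bmeas M r" shows "\<bar>expavg \<epsilon> r x\<bar> \<le> M"
proof -
  have "\<bar>expavg \<epsilon> r x\<bar> = 1 / \<epsilon> * \<bar>integral {x..} (\<lambda>y. exp ((x - y) / \<epsilon>) * r y)\<bar>"
    using assms(1) by (simp add: expavg_eq_integral[OF assms] abs_mult)
  also have "\<dots> \<le> 1 / \<epsilon> * (\<epsilon> * exp ((x - x) / \<epsilon>) * M)"
    using assms(1) by (intro mult_left_mono exp_weight_tail[OF assms]) auto
  finally show ?thesis using assms(1) by simp
qed

text \<open>
  The exponential weight makes far away values irrelevant, so local convergence in \<open>L\<^sup>1\<close> of bounded densities implies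
  locally uniform convergence of their averages.
\<close>

lemma expavg_diff_le:
  assumes "\<epsilon> > 0" and r: "bmeas M r" and s: "bmeas M s" and "N \<ge> 0"
  shows "\<bar>expavg \<epsilon> r x - expavg \<epsilon> s x\<bar> \<le> 1 / \<epsilon> * integral {x..x + N} (\<lambda>y. \<bar>r y - s y\<bar>) + 2 * M * exp (- N / \<epsilon>)"
proof -
  let ?e = "\<lambda>y. exp ((x - y) / \<epsilon>)"
  have d: "bmeas (2 * M) (\<lambda>y. r y - s y)"
    unfolding bmeas_def
  proof (intro conjI allI)
    show "(\<lambda>y. r y - s y) \<in> borel_measurable lebesgue"
      using r s by (auto simp: bmeas_def intro: borel_measurable_diff)
    fix y have "\<bar>r y\<bar> \<le> M" "\<bar>s y\<bar> \<le> M" using r s by (auto simp: bmeas_def)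
    then show "\<bar>r y - s y\<bar> \<le> 2 * M" by linarith
  qed
  have i: "(\<lambda>y. ?e y * u y) integrable_on {x..}" if "bmeas K u" for K u
    using exp_weight_mult_integrable[OF assms(1) that] absolutely_integrable_on_def by blast
  have ad: "(\<lambda>y. r y - s y) absolutely_integrable_on {x..x + N}" by (rule bmeas_absolutely_integrable[OF d])
  have "expavg \<epsilon> r x - expavg \<epsilon> s x = 1 / \<epsilon> * (integral {x..} (\<lambda>y. ?e y * r y) - integral {x..} (\<lambda>y. ?e y * s y))"
    by (simp add: expavg_eq_integral[OF assms(1) r] expavg_eq_integral[OF assms(1) s] right_diff_distrib)
  also have "integral {x..} (\<lambda>y. ?e y * r y) - integral {x..} (\<lambda>y. ?e y * s y) = integral {x..} (\<lambda>y. ?e y * (r y - s y))"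
    by (subst integral_diff[symmetric, OF i[OF r] i[OF s]]) (simp add: right_diff_distrib)
  also have "\<dots> = integral {x..x + N} (\<lambda>y. ?e y * (r y - s y)) + integral {x + N..} (\<lambda>y. ?e y * (r y - s y))"
    by (rule exp_weight_split[OF assms(1) d]) (use assms in simp)
  finally have eq: "expavg \<epsilon> r x - expavg \<epsilon> s x = 1 / \<epsilon> * (integral {x..x + N} (\<lambda>y. ?e y * (r y - s y)) + integral {x + N..} (\<lambda>y. ?e y * (r y - s y)))" .
  have "\<bar>integral {x..x + N} (\<lambda>y. ?e y * (r y - s y))\<bar> \<le> integral {x..x + N} (\<lambda>y. \<bar>r y - s y\<bar>)"
  proof (rule integral_norm_bound_integral[where 'a = real, unfolded real_norm_def])
    have "(\<lambda>y. ?e y * (r y - s y)) absolutely_integrable_on {x..x + N}"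
      by (rule set_integrable_subset[OF exp_weight_mult_integrable[OF assms(1) d, of x x]]) auto
    then show "(\<lambda>y. ?e y * (r y - s y)) integrable_on {x..x + N}" using absolutely_integrable_on_def by blast
    show "(\<lambda>y. \<bar>r y - s y\<bar>) integrable_on {x..x + N}" using ad unfolding absolutely_integrable_on_def by simp
    fix y assume "y \<in> {x..x + N}"
    then have "?e y \<le> 1" using assms(1) by (simp add: divide_le_0_iff)
    then show "\<bar>?e y * (r y - s y)\<bar> \<le> \<bar>r y - s y\<bar>" by (simp add: abs_mult mult_left_le_one_le)
  qed
  moreover have "\<bar>integral {x + N..} (\<lambda>y. ?e y * (r y - s y))\<bar> \<le> \<epsilon> * exp (- N / \<epsilon>) * (2 * M)"
    using exp_weight_tail[OF assms(1) d, of "x + N" x] by simp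
  ultimately have "\<bar>integral {x..x + N} (\<lambda>y. ?e y * (r y - s y)) + integral {x + N..} (\<lambda>y. ?e y * (r y - s y))\<bar>
      \<le> integral {x..x + N} (\<lambda>y. \<bar>r y - s y\<bar>) + \<epsilon> * exp (- N / \<epsilon>) * (2 * M)" by linarith
  then have "\<bar>expavg \<epsilon> r x - expavg \<epsilon> s x\<bar> \<le> 1 / \<epsilon> * (integral {x..x + N} (\<lambda>y. \<bar>r y - s y\<bar>) + \<epsilon> * exp (- N / \<epsilon>) * (2 * M))"
    unfolding eq abs_mult using assms(1) by (simp add: divide_right_mono)
  then show ?thesis using assms(1) by (simp add: distrib_left mult_ac)
qed

text \<open>
  The integrated form of \<open>\<epsilon> w' = w - r\<close>. All that is used later about averages is this relation together with their
  boundedness.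
\<close>

lemma expavg_increment:
  assumes e: "\<epsilon> > 0" and r: "bmeas M r" and "a \<le> b"
  shows "expavg \<epsilon> r integrable_on {a..b}"
    and "expavg \<epsilon> r b - expavg \<epsilon> r a = 1 / \<epsilon> * (integral {a..b} (expavg \<epsilon> r) - integral {a..b} r)"
proof -
  define F where "F z = integral {z..} (\<lambda>y. exp ((0 - y) / \<epsilon>) * r y)" for z
  have avg: "expavg \<epsilon> r x = F x * (exp (x / \<epsilon>) / \<epsilon>)" for x
  proof -
    have "exp ((x - y) / \<epsilon>) * r y = exp (x / \<epsilon>) * (exp ((0 - y) / \<epsilon>) * r y)" for y
      by (simp add: exp_add[symmetric] diff_divide_distrib mult.assoc[symmetric])
    then have "integral {x..} (\<lambda>y. exp ((x - y) / \<epsilon>) * r y) = exp (x / \<epsilon>) * F x"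
      unfolding F_def by (simp only: Henstock_Kurzweil_Integration.integral_mult_right)
    then show ?thesis by (simp add: expavg_eq_integral[OF e r])
  qed
  define p where "p = (\<lambda>y. - (if y \<in> {a..b} then exp ((0 - y) / \<epsilon>) * r y else 0))"
  have p: "bmeas (exp (- a / \<epsilon>) * M) p"
    unfolding bmeas_def
  proof (intro conjI allI)
    have "(\<lambda>y. exp ((0 - y) / \<epsilon>) * r y) \<in> borel_measurable lebesgue"
      using r exp_weight_measurable[of 0 \<epsilon>] by (auto simp: bmeas_def intro: borel_measurable_times)
    then show "p \<in> borel_measurable lebesgue"
      unfolding p_def by (intro borel_measurable_uminus measurable_If_set) auto
    fix y
    have "exp ((0 - y) / \<epsilon>) * \<bar>r y\<bar> \<le> exp (- a / \<epsilon>) * M" if "a \<le> y"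
      using that e r by (intro mult_mono) (auto simp: bmeas_def divide_right_mono)
    then show "\<bar>p y\<bar> \<le> exp (- a / \<epsilon>) * M"
      using bmeas_nonneg[OF r] by (auto simp: p_def abs_mult)
  qed
  have F: "F v - F u = integral {u..v} p" if "a \<le> u" "u \<le> v" "v \<le> b" for u v
  proof -
    have "integral {u..v} p = integral {u..v} (\<lambda>y. - (exp ((0 - y) / \<epsilon>) * r y))"
      by (rule Henstock_Kurzweil_Integration.integral_cong) (use that in \<open>auto simp: p_def\<close>)
    then show ?thesis
      using exp_weight_split[OF e r that(2), of 0] by (simp add: F_def)
  qed
  have Q: "((\<lambda>x. exp (x / \<epsilon>) / \<epsilon>) has_real_derivative exp (x / \<epsilon>) / \<epsilon>\<^sup>2) (at x)" for x
    using e by (auto intro!: derivative_eq_intros simp: power2_eq_square)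
  have q: "continuous_on UNIV (\<lambda>x. exp (x / \<epsilon>) / \<epsilon>\<^sup>2)" using e by (intro continuous_intros) auto
  note inc = integral_product_increment[OF \<open>a \<le> b\<close> p F Q q]
  have eq: "p x * (exp (x / \<epsilon>) / \<epsilon>) + F x * (exp (x / \<epsilon>) / \<epsilon>\<^sup>2) = 1 / \<epsilon> * expavg \<epsilon> r x - 1 / \<epsilon> * r x" if "x \<in> {a..b}" for x
  proof -
    have "exp ((0 - x) / \<epsilon>) * r x * (exp (x / \<epsilon>) / \<epsilon>) = (exp ((0 - x) / \<epsilon>) * exp (x / \<epsilon>)) * r x / \<epsilon>" by simp
    also have "exp ((0 - x) / \<epsilon>) * exp (x / \<epsilon>) = 1" by (simp add: exp_add[symmetric])
    finally show ?thesis using that by (simp add: p_def avg power2_eq_square)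
  qed
  have "(\<lambda>x. 1 / \<epsilon> * expavg \<epsilon> r x - 1 / \<epsilon> * r x) integrable_on {a..b}"
    by (rule integrable_eq[OF inc(1) eq])
  then have "(\<lambda>x. \<epsilon> * (1 / \<epsilon> * expavg \<epsilon> r x - 1 / \<epsilon> * r x) + r x) integrable_on {a..b}"
    by (intro integrable_add integrable_on_mult_right bmeas_integrable[OF r])
  then show int: "expavg \<epsilon> r integrable_on {a..b}" using e by (simp add: right_diff_distrib)
  have "expavg \<epsilon> r b - expavg \<epsilon> r a = integral {a..b} (\<lambda>x. p x * (exp (x / \<epsilon>) / \<epsilon>) + F x * (exp (x / \<epsilon>) / \<epsilon>\<^sup>2))"
    using inc(2) by (simp only: avg)
  also have "\<dots> = integral {a..b} (\<lambda>x. 1 / \<epsilon> * expavg \<epsilon> r x - 1 / \<epsilon> * r x)"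
    by (rule Henstock_Kurzweil_Integration.integral_cong[OF eq])
  also have "\<dots> = 1 / \<epsilon> * integral {a..b} (expavg \<epsilon> r) - 1 / \<epsilon> * integral {a..b} r"
    using int bmeas_integrable[OF r, of a b]
    by (subst integral_diff) (auto intro!: integrable_on_divide)
  finally show "expavg \<epsilon> r b - expavg \<epsilon> r a = 1 / \<epsilon> * (integral {a..b} (expavg \<epsilon> r) - integral {a..b} r)"
    by (simp add: right_diff_distrib)
qed

lemma expavg_Lipschitz:
  assumes e: "\<epsilon> > 0" and r: "bmeas M r"
  shows "\<bar>expavg \<epsilon> r x - expavg \<epsilon> r y\<bar> \<le> 2 * M / \<epsilon> * \<bar>x - y\<bar>"
proof -
  have aux: "\<bar>expavg \<epsilon> r v - expavg \<epsilon> r u\<bar> \<le> 2 * M / \<epsilon> * (v - u)" if "u \<le> v" for u v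
  proof -
    have "\<bar>integral {u..v} (expavg \<epsilon> r)\<bar> \<le> M * (v - u)"
      by (rule abs_integral_le[OF expavg_increment(1)[OF e r that] that]) (rule expavg_abs_le[OF e r])
    moreover have "\<bar>integral {u..v} r\<bar> \<le> M * (v - u)" by (rule bmeas_abs_integral_le[OF r that])
    ultimately have "\<bar>integral {u..v} (expavg \<epsilon> r) - integral {u..v} r\<bar> \<le> 2 * M * (v - u)" by linarith
    then have "1 / \<epsilon> * \<bar>integral {u..v} (expavg \<epsilon> r) - integral {u..v} r\<bar> \<le> 1 / \<epsilon> * (2 * M * (v - u))"
      using e by (intro mult_left_mono) auto
    then show ?thesis using e by (simp add: expavg_increment(2)[OF e r that] abs_mult)
  qed
  show ?thesis
  proof (cases "y \<le> x")
    case True then show ?thesis using aux[OF True] by simp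
  next
    case False
    then have "\<bar>expavg \<epsilon> r y - expavg \<epsilon> r x\<bar> \<le> 2 * M / \<epsilon> * (y - x)" by (intro aux) simp
    then show ?thesis using False by (simp add: abs_minus_commute)
  qed
qed

lemma expavg_continuous:
  assumes "\<epsilon> > 0" and r: "bmeas M r" shows "continuous_on S (expavg \<epsilon> r)"
proof (rule lipschitz_on_continuous_on)
  show "(2 * M / \<epsilon>)-lipschitz_on S (expavg \<epsilon> r)"
    using expavg_Lipschitz[OF assms] bmeas_nonneg[OF r] assms(1)
    by (intro lipschitz_onI) (auto simp: dist_real_def)
qed

lemma bmeas_expavg:
  assumes "\<epsilon> > 0" "bmeas M r" shows "bmeas M (expavg \<epsilon> r)"
  using expavg_abs_le[OF assms] continuous_imp_lebesgue_measurable[OF expavg_continuous[OF assms]]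
  by (simp add: bmeas_def)

text \<open>
  The equation \<open>\<epsilon> f' = f - J'\<close> is unstable to the right: if \<open>f(x)\<close> exceeded \<open>a + b/\<epsilon>\<close>, the quantity \<open>D\<close> below would
  satisfy \<open>D' \<ge> D/\<epsilon>\<close> with \<open>D > 0\<close> and grow exponentially, which contradicts the boundedness of \<open>f\<close>. Only an affine
  bound on the growth of \<open>J\<close> enters, so additive errors in \<open>J\<close> cost no more than additive errors in \<open>f\<close>.
\<close>

lemma bounded_solution_le:
  fixes f J :: "real \<Rightarrow> real"
  assumes e: "\<epsilon> > 0"
    and cont: "continuous_on UNIV f" and bound: "\<And>x. f x \<le> B"
    and f: "\<And>y. x \<le> y \<Longrightarrow> f y - f x = 1 / \<epsilon> * (integral {x..y} f - (J y - J x))"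
    and J: "\<And>y. x \<le> y \<Longrightarrow> J y - J x \<le> a * (y - x) + b"
  shows "f x \<le> a + b / \<epsilon>"
proof (rule ccontr)
  define d where "d = \<epsilon> * (f x - a) - b"
  assume "\<not> f x \<le> a + b / \<epsilon>"
  then have "\<epsilon> * (a + b / \<epsilon>) < \<epsilon> * f x" using e by (intro mult_strict_left_mono) auto
  then have d: "d > 0" using e by (simp add: d_def algebra_simps)
  define D where "D = (\<lambda>y. d + primitive f y - primitive f x - a * (y - x))"
  have ci: "f integrable_on {u..v}" for u v
    by (intro integrable_continuous_interval continuous_on_subset[OF cont]) auto
  have D_le: "D y \<le> \<epsilon> * (f y - a)" if "x \<le> y" for y
  proof -
    have "\<epsilon> * (f y - f x) = integral {x..y} f - (J y - J x)" using f[OF that] e by simp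
    then show ?thesis
      using J[OF that] primitive_increment[OF ci that] by (simp add: D_def d_def algebra_simps)
  qed
  have dD: "(D has_real_derivative f y - a) (at y)" for y
    unfolding D_def by (auto intro!: derivative_eq_intros DERIV_primitive cont)
  define E where "E = (\<lambda>y. exp (- y / \<epsilon>) * D y)"
  have dE: "(E has_real_derivative exp (- y / \<epsilon>) * ((f y - a) - D y / \<epsilon>)) (at y)" for y
    unfolding E_def using e by (auto intro!: derivative_eq_intros dD simp: algebra_simps)
  \<comment> \<open>Far enough to the right for the linear lower bound of the exponential to exceed B.\<close>
  define y where "y = x + \<epsilon>\<^sup>2 * (\<bar>B - a\<bar> + 1) / d"
  have "x \<le> y" using d by (simp add: y_def)
  have "E x \<le> E y"
  proof (rule DERIV_nonneg_imp_nondecreasing[OF \<open>x \<le> y\<close>])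
    fix z assume "x \<le> z"
    have "D z / \<epsilon> \<le> f z - a" using D_le[OF \<open>x \<le> z\<close>] e by (simp add: pos_divide_le_eq mult.commute)
    then show "\<exists>k. (E has_real_derivative k) (at z) \<and> 0 \<le> k" using dE[of z] by (intro exI conjI) auto
  qed
  then have "exp (y / \<epsilon>) * (exp (- x / \<epsilon>) * D x) \<le> exp (y / \<epsilon>) * (exp (- y / \<epsilon>) * D y)"
    by (intro mult_left_mono) (auto simp: E_def)
  then have "exp ((y - x) / \<epsilon>) * d \<le> D y"
    by (simp add: mult.assoc[symmetric] exp_add[symmetric] diff_divide_distrib D_def)
  moreover have "(1 + (y - x) / \<epsilon>) * d \<le> exp ((y - x) / \<epsilon>) * d"
    using d by (intro mult_right_mono exp_ge_add_one_self) auto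
  moreover have "(1 + (y - x) / \<epsilon>) * d = d + \<epsilon> * (\<bar>B - a\<bar> + 1)"
    using d e by (simp add: y_def power2_eq_square field_simps)
  moreover have "D y \<le> \<epsilon> * (B - a)"
    using D_le[OF \<open>x \<le> y\<close>] bound[of y] e mult_left_mono[of "f y - a" "B - a" \<epsilon>] by linarith
  moreover have "\<epsilon> * (B - a) \<le> \<epsilon> * (\<bar>B - a\<bar> + 1)" using e by (intro mult_left_mono) auto
  ultimately show False using d by linarith
qed

section \<open>The weak formulation in integrated form\<close>

lemma mult_divide_twice: "c > 0 \<Longrightarrow> c * (e / (2 * c)) = e / (2::real)"
  by simp

lemma C_on_SucD: "C_on (Suc k) S f \<Longrightarrow> C_on k S f"
proof (induction k arbitrary: f)
  case 0
  then obtain ft fx where "\<forall>p\<in>S. (f has_derivative (\<lambda>(s, y). ft p * s + fx p * y)) (at p within S)" by auto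
  then have "\<And>p. p \<in> S \<Longrightarrow> continuous (at p within S) f" using has_derivative_continuous by blast
  then show ?case by (simp add: continuous_on_eq_continuous_within)
next
  case (Suc k)
  then obtain ft fx where "C_on (Suc k) S ft" "C_on (Suc k) S fx"
    "\<forall>p\<in>S. (f has_derivative (\<lambda>(s, y). ft p * s + fx p * y)) (at p within S)"
    unfolding C_on.simps(2)[of "Suc k"] by blast
  then show ?case using Suc.IH[of ft] Suc.IH[of fx] unfolding C_on.simps(2)[of k S f] by blast
qed

lemma C_on_SucE:
  assumes "C_on (Suc k) S f"
  obtains ft fx where "C_on k S ft" "C_on k S fx"
    "\<And>p. p \<in> S \<Longrightarrow> (f has_derivative (\<lambda>(s, y). ft p * s + fx p * y)) (at p within S)"
  using assms unfolding C_on.simps(2) by blast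

lemma C_on_SucI:
  assumes "C_on k S ft" "C_on k S fx"
    "\<And>p. p \<in> S \<Longrightarrow> (f has_derivative (\<lambda>(s, y). ft p * s + fx p * y)) (at p within S)"
  shows "C_on (Suc k) S f"
  using assms unfolding C_on.simps(2) by blast

lemma C_on_add: "C_on k S f \<Longrightarrow> C_on k S g \<Longrightarrow> C_on k S (\<lambda>p. f p + g p)"
proof (induction k arbitrary: f g)
  case 0
  then show ?case by (auto intro: continuous_intros)
next
  case (Suc k)
  obtain ft fx where f: "C_on k S ft" "C_on k S fx"
    "\<And>p. p \<in> S \<Longrightarrow> (f has_derivative (\<lambda>(s, y). ft p * s + fx p * y)) (at p within S)"
    using C_on_SucE[OF Suc.prems(1)] by metis
  obtain gt gx where g: "C_on k S gt" "C_on k S gx"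
    "\<And>p. p \<in> S \<Longrightarrow> (g has_derivative (\<lambda>(s, y). gt p * s + gx p * y)) (at p within S)"
    using C_on_SucE[OF Suc.prems(2)] by metis
  note * = f(1,2) g(1,2) f(3) g(3)
  have "((\<lambda>p. f p + g p) has_derivative (\<lambda>(s, y). (ft p + gt p) * s + (fx p + gx p) * y)) (at p within S)" if "p \<in> S" for p
    using has_derivative_add[OF *(5)[OF that] *(6)[OF that]]
    by (rule has_derivative_eq_rhs) (auto simp: algebra_simps)
  then show ?case by (rule C_on_SucI[OF Suc.IH[OF *(1,3)] Suc.IH[OF *(2,4)]])
qed

lemma C_on_mult: "C_on k S f \<Longrightarrow> C_on k S g \<Longrightarrow> C_on k S (\<lambda>p. f p * g p)"
proof (induction k arbitrary: f g)
  case 0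
  then show ?case by (auto intro: continuous_intros)
next
  case (Suc k)
  obtain ft fx where f: "C_on k S ft" "C_on k S fx"
    "\<And>p. p \<in> S \<Longrightarrow> (f has_derivative (\<lambda>(s, y). ft p * s + fx p * y)) (at p within S)"
    using C_on_SucE[OF Suc.prems(1)] by metis
  obtain gt gx where g: "C_on k S gt" "C_on k S gx"
    "\<And>p. p \<in> S \<Longrightarrow> (g has_derivative (\<lambda>(s, y). gt p * s + gx p * y)) (at p within S)"
    using C_on_SucE[OF Suc.prems(2)] by metis
  note * = f(1,2) g(1,2) f(3) g(3)
  have fg: "C_on k S f" "C_on k S g" using Suc.prems C_on_SucD by blast+
  have "((\<lambda>p. f p * g p) has_derivative
     (\<lambda>(s, y). (f p * gt p + ft p * g p) * s + (f p * gx p + fx p * g p) * y)) (at p within S)" if "p \<in> S" for p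
    using has_derivative_mult[OF *(5)[OF that] *(6)[OF that]]
    by (rule has_derivative_eq_rhs) (auto simp: algebra_simps)
  then show ?case
    by (intro C_on_SucI[of k S "\<lambda>p. f p * gt p + ft p * g p" "\<lambda>p. f p * gx p + fx p * g p"] C_on_add Suc.IH * fg)
qed

text \<open>
  All spacetime test functions below are products of smooth functions of one variable composed with affine maps.
\<close>

lemma C_on_affine: "Ck k f \<Longrightarrow> C_on k S (\<lambda>p. f (\<alpha> * fst p + \<beta> * snd p + \<gamma>))"
proof (induction k arbitrary: f)
  case 0
  then have "continuous_on UNIV f" by simp
  then have "continuous_on S (\<lambda>p. f (\<alpha> * fst p + \<beta> * snd p + \<gamma>))"
    by (rule continuous_on_compose2) (auto intro!: continuous_intros)
  then show ?case by simp
next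
  case (Suc k)
  then obtain f' where f': "\<And>x. (f has_real_derivative f' x) (at x)" "Ck k f'" unfolding Ck.simps(2) by blast
  have "((\<lambda>p. f (\<alpha> * fst p + \<beta> * snd p + \<gamma>)) has_derivative
    (\<lambda>(s, y). (\<alpha> * f' (\<alpha> * fst p + \<beta> * snd p + \<gamma>)) * s + (\<beta> * f' (\<alpha> * fst p + \<beta> * snd p + \<gamma>)) * y)) (at p within S)" for p :: "real \<times> real"
  proof -
    have 1: "((\<lambda>p. \<alpha> * fst p + \<beta> * snd p + \<gamma>) has_derivative (\<lambda>h. \<alpha> * fst h + \<beta> * snd h)) (at p within S)"
      by (auto intro!: derivative_eq_intros)
    have 2: "(f has_derivative (\<lambda>h. f' (\<alpha> * fst p + \<beta> * snd p + \<gamma>) * h)) (at (\<alpha> * fst p + \<beta> * snd p + \<gamma>))"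
      using f'(1) by (simp add: has_field_derivative_def)
    show ?thesis
      using has_derivative_compose[OF 1 2] by (rule has_derivative_eq_rhs) (auto simp: algebra_simps)
  qed
  moreover have c: "C_on k S (\<lambda>p. c * f' (\<alpha> * fst p + \<beta> * snd p + \<gamma>))" for c
    by (rule Suc.IH[OF Ck_mult[OF Ck_const f'(2)]])
  ultimately show ?case by (intro C_on_SucI[OF c[of \<alpha>] c[of \<beta>]])
qed

text \<open>
  A weak solution whose profiles are bounded by \<open>M\<close> at every time and every point. This pointwise bound is reached by
  clipping a general weak solution.
\<close>

locale nonlocal_flow =
  fixes V :: "real \<Rightarrow> real" and \<epsilon> T M :: real and r0 :: "real \<Rightarrow> real" and r :: "real \<Rightarrow> real \<Rightarrow> real"
  assumes eps: "\<epsilon> > 0" and T: "T > 0" and V_cont: "continuous_on UNIV V"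
    and r: "t \<in> {0..T} \<Longrightarrow> bmeas M (r t)" and r0: "bmeas M r0"
    and r_cont: "t0 \<in> {0..T} \<Longrightarrow> ((\<lambda>t. integral {-A..A} (\<lambda>x. \<bar>r t x - r t0 x\<bar>)) \<longlongrightarrow> 0) (at t0 within {0..T})"
    and weak: "spacetime_test_fun T \<phi> \<Longrightarrow>
        (LINT t:{0<..<T}|lebesgue. (LINT x|lebesgue.
             r t x * deriv (\<lambda>s. \<phi> (s, x)) t
           + V (expavg \<epsilon> (r t) x) * r t x * deriv (\<lambda>y. \<phi> (t, y)) x))
        + (LINT x|lebesgue. r0 x * \<phi> (0, x)) = 0"
begin

abbreviation W :: "real \<Rightarrow> real \<Rightarrow> real" where "W t \<equiv> expavg \<epsilon> (r t)"

lemma M_nonneg: "0 \<le> M" using r0 by (rule bmeas_nonneg)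

lemma bmeas_diff_r: "t \<in> {0..T} \<Longrightarrow> s \<in> {0..T} \<Longrightarrow> bmeas (2 * M) (\<lambda>x. \<bar>r t x - r s x\<bar>)"
  unfolding bmeas_def
proof (intro conjI allI)
  assume "t \<in> {0..T}" "s \<in> {0..T}"
  then have b: "bmeas M (r t)" "bmeas M (r s)" using r by auto
  then show "(\<lambda>x. \<bar>r t x - r s x\<bar>) \<in> borel_measurable lebesgue"
    by (auto simp: bmeas_def intro!: borel_measurable_abs borel_measurable_diff)
  fix x have "\<bar>r t x\<bar> \<le> M" "\<bar>r s x\<bar> \<le> M" using b by (auto simp: bmeas_def)
  then show "\<bar>\<bar>r t x - r s x\<bar>\<bar> \<le> 2 * M" by linarith
qed

text \<open>
  Continuity in time with values in \<open>L\<^sup>1\<^sub>l\<^sub>o\<^sub>c\<close> passes to the averages, locally uniformly in space.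
\<close>

lemma W_time_continuous:
  assumes t0: "t0 \<in> {0..T}" and "e > 0" and "A \<ge> 0"
  shows "eventually (\<lambda>t. \<forall>x\<in>{-A..A}. \<bar>W t x - W t0 x\<bar> < e) (at t0 within {0..T})"
proof -
  obtain N where N: "N \<ge> 0" "2 * M * exp (- N / \<epsilon>) < e / 2"
  proof -
    have "((\<lambda>N. 2 * M * exp (- N / \<epsilon>)) \<longlongrightarrow> 2 * M * 0) at_top"
    proof (intro tendsto_mult tendsto_const)
      have "filterlim (\<lambda>N. N / \<epsilon>) at_top at_top"
        using eps filterlim_tendsto_pos_mult_at_top[OF tendsto_const _ filterlim_ident, of "1 / \<epsilon>"] by simp
      then show "((\<lambda>N. exp (- N / \<epsilon>)) \<longlongrightarrow> 0) at_top"
        by (intro filterlim_compose[OF exp_at_bot]) (simp add: filterlim_uminus_at_bot)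
    qed
    then have "eventually (\<lambda>N. 2 * M * exp (- N / \<epsilon>) < e / 2) at_top"
      using \<open>e > 0\<close> by (intro order_tendstoD(2)) auto
    then show ?thesis
      using that eventually_conj[OF _ eventually_ge_at_top[of 0]] eventually_happens[OF eventually_conj[OF _ eventually_ge_at_top[of 0]]] by force
  qed
  have "eventually (\<lambda>t. integral {-(A + N)..A + N} (\<lambda>x. \<bar>r t x - r t0 x\<bar>) < \<epsilon> * (e / 2)) (at t0 within {0..T})"
    by (rule order_tendstoD(2)[OF r_cont[OF t0]]) (use \<open>e > 0\<close> eps in simp)
  moreover have "eventually (\<lambda>t. t \<in> {0..T}) (at t0 within {0..T})" by (simp add: eventually_at_filter)
  ultimately show ?thesis
  proof eventually_elim
    case (elim t)
    show ?case
    proof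
      fix x assume x: "x \<in> {-A..A}"
      have i: "(\<lambda>x. \<bar>r t x - r t0 x\<bar>) integrable_on {a..b}" for a b
        using bmeas_integrable[OF bmeas_diff_r[OF elim(2) t0]] .
      have "\<bar>W t x - W t0 x\<bar> \<le> 1 / \<epsilon> * integral {x..x + N} (\<lambda>y. \<bar>r t y - r t0 y\<bar>) + 2 * M * exp (- N / \<epsilon>)"
        by (rule expavg_diff_le[OF eps r[OF elim(2)] r[OF t0] N(1)])
      also have "integral {x..x + N} (\<lambda>y. \<bar>r t y - r t0 y\<bar>) \<le> integral {-(A + N)..A + N} (\<lambda>x. \<bar>r t x - r t0 x\<bar>)"
        by (rule integral_subset_le) (use x N i in auto)
      also have "1 / \<epsilon> * integral {-(A + N)..A + N} (\<lambda>x. \<bar>r t x - r t0 x\<bar>) < e / 2"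
        using elim(1) eps by (simp add: pos_divide_less_eq mult.commute)
      finally show "\<bar>W t x - W t0 x\<bar> < e" using N(2) eps by (simp add: divide_right_mono)
    qed
  qed
qed

lemma W_jointly_continuous: "continuous_on ({0..T} \<times> UNIV) (\<lambda>p. W (fst p) (snd p))"
  unfolding continuous_on_eq_continuous_within continuous_within tendsto_iff
proof (intro ballI allI impI)
  fix p :: "real \<times> real" and e :: real assume p: "p \<in> {0..T} \<times> UNIV" and e: "0 < e"
  obtain t0 x0 where p_eq: "p = (t0, x0)" by (cases p)
  have t0: "t0 \<in> {0..T}" using p p_eq by auto
  obtain d where d: "d > 0" "\<And>t. t \<in> {0..T} \<Longrightarrow> \<bar>t - t0\<bar> < d \<Longrightarrow> \<forall>x\<in>{-(\<bar>x0\<bar> + 1)..\<bar>x0\<bar> + 1}. \<bar>W t x - W t0 x\<bar> < e / 2"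
  proof -
    have "eventually (\<lambda>t. \<forall>x\<in>{-(\<bar>x0\<bar> + 1)..\<bar>x0\<bar> + 1}. \<bar>W t x - W t0 x\<bar> < e / 2) (at t0 within {0..T})"
      by (rule W_time_continuous[OF t0]) (use e in auto)
    then obtain d where d: "d > 0" "\<And>t. t \<in> {0..T} \<Longrightarrow> t \<noteq> t0 \<Longrightarrow> \<bar>t - t0\<bar> < d \<Longrightarrow> \<forall>x\<in>{-(\<bar>x0\<bar> + 1)..\<bar>x0\<bar> + 1}. \<bar>W t x - W t0 x\<bar> < e / 2"
      unfolding eventually_at dist_real_def by blast
    have "\<forall>x\<in>{-(\<bar>x0\<bar> + 1)..\<bar>x0\<bar> + 1}. \<bar>W t x - W t0 x\<bar> < e / 2" if "t \<in> {0..T}" "\<bar>t - t0\<bar> < d" for t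
      using d(2)[OF that(1) _ that(2)] e by (cases "t = t0") auto
    then show ?thesis using that[OF d(1)] by blast
  qed
  have "2 * M / \<epsilon> + 1 > 0" using M_nonneg eps by (simp add: add_nonneg_pos)
  define d' where "d' = Min {d, 1, e / (2 * (2 * M / \<epsilon> + 1))}"
  have d': "d' > 0" "d' \<le> d" "d' \<le> 1" "d' \<le> e / (2 * (2 * M / \<epsilon> + 1))"
    using d(1) e \<open>2 * M / \<epsilon> + 1 > 0\<close> by (auto simp: d'_def)
  show "\<forall>\<^sub>F q in at p within {0..T} \<times> UNIV. dist (W (fst q) (snd q)) (W (fst p) (snd p)) < e"
    unfolding eventually_at
  proof (intro exI[of _ d'] conjI ballI impI)
    show "0 < d'" by (rule d')
    fix q :: "real \<times> real" assume q: "q \<in> {0..T} \<times> UNIV" "q \<noteq> p \<and> dist q p < d'"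
    obtain t x where q_eq: "q = (t, x)" by (cases q)
    have t: "t \<in> {0..T}" using q q_eq by auto
    have "\<bar>t - t0\<bar> < d'" using q dist_fst_le[of q p] by (simp add: q_eq p_eq dist_real_def)
    moreover have xx: "\<bar>x - x0\<bar> < d'" using q dist_snd_le[of q p] by (simp add: q_eq p_eq dist_real_def)
    moreover have "x \<in> {-(\<bar>x0\<bar> + 1)..\<bar>x0\<bar> + 1}" using xx d'(3) by (cases "0 \<le> x0") (auto simp: abs_less_iff)
    ultimately have "\<bar>W t x - W t0 x\<bar> < e / 2" using d(2)[OF t] d'(2) by (meson less_le_trans)
    moreover have "\<bar>W t0 x - W t0 x0\<bar> \<le> 2 * M / \<epsilon> * \<bar>x - x0\<bar>" by (rule expavg_Lipschitz[OF eps r[OF t0]])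
    moreover have "2 * M / \<epsilon> * \<bar>x - x0\<bar> \<le> (2 * M / \<epsilon> + 1) * (e / (2 * (2 * M / \<epsilon> + 1)))"
      using xx d'(4) M_nonneg eps by (intro mult_mono) auto
    moreover have "(2 * M / \<epsilon> + 1) * (e / (2 * (2 * M / \<epsilon> + 1))) = e / 2" by (rule mult_divide_twice[OF \<open>2 * M / \<epsilon> + 1 > 0\<close>])
    ultimately have "\<bar>W t x - W t0 x0\<bar> < e" by linarith
    then show "dist (W (fst q) (snd q)) (W (fst p) (snd p)) < e" by (simp add: q_eq p_eq dist_real_def)
  qed
qed

lemma V_W_continuous: "continuous_on ({0..T} \<times> UNIV) (\<lambda>p. V (W (fst p) (snd p)))"
  by (rule continuous_on_compose2[OF V_cont W_jointly_continuous]) auto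

lemma moment_continuous:
  assumes q: "continuous_on ({0..T} \<times> UNIV) (\<lambda>p. q (fst p) (snd p))" and "A \<ge> 0"
  shows "continuous_on {0..T} (\<lambda>s. integral {-A..A} (\<lambda>y. r s y * q s y))"
  unfolding continuous_on_eq_continuous_within continuous_within tendsto_iff
proof (intro ballI allI impI)
  fix s0 e :: real assume s0: "s0 \<in> {0..T}" and e: "0 < e"
  let ?K = "{0..T} \<times> {-A..A}"
  have cK: "compact ?K" by (intro compact_Times) auto
  have qK: "continuous_on ?K (\<lambda>p. q (fst p) (snd p))" by (rule continuous_on_subset[OF q]) auto
  have qs: "continuous_on {-A..A} (q s)" if "s \<in> {0..T}" for s
  proof -
    have "continuous_on {-A..A} (\<lambda>y. q (fst (s, y)) (snd (s, y)))"
      by (rule continuous_on_compose2[OF qK, of _ "\<lambda>y. (s, y)"]) (use that in \<open>auto intro!: continuous_intros\<close>)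
    then show ?thesis by simp
  qed
  obtain B where B: "\<And>p. p \<in> ?K \<Longrightarrow> \<bar>q (fst p) (snd p)\<bar> \<le> B"
  proof -
    have "bounded ((\<lambda>p. q (fst p) (snd p)) ` ?K)" by (intro compact_imp_bounded compact_continuous_image qK cK)
    then obtain B where "\<forall>y\<in>(\<lambda>p. q (fst p) (snd p)) ` ?K. norm y \<le> B" unfolding bounded_iff by blast
    then show ?thesis using that[of B] by fastforce
  qed
  have B0: "B \<ge> 0" using B[of "(s0, 0)"] s0 assms(2) by fastforce
  define e1 where "e1 = e / (2 * (M * (2 * A) + 1))"
  have "M * (2 * A) + 1 > 0" using M_nonneg assms(2) by (simp add: add_nonneg_pos)
  then have e1: "e1 > 0" using e by (simp add: e1_def)
  obtain d where d: "d > 0" "\<And>p p'. p \<in> ?K \<Longrightarrow> p' \<in> ?K \<Longrightarrow> dist p' p < d \<Longrightarrow> dist (q (fst p') (snd p')) (q (fst p) (snd p)) < e1"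
  proof -
    have "\<exists>d>0. \<forall>p\<in>?K. \<forall>p'\<in>?K. dist p' p < d \<longrightarrow> dist (q (fst p') (snd p')) (q (fst p) (snd p)) < e1"
      using compact_uniformly_continuous[OF qK cK] e1 unfolding uniformly_continuous_on_def by presburger
    then show ?thesis using that by blast
  qed
  have "eventually (\<lambda>t. integral {-A..A} (\<lambda>x. \<bar>r t x - r s0 x\<bar>) < e / (2 * (B + 1))) (at s0 within {0..T})"
    by (rule order_tendstoD(2)[OF r_cont[OF s0]]) (use e B0 in simp)
  moreover have "eventually (\<lambda>t. t \<in> {0..T}) (at s0 within {0..T})" by (simp add: eventually_at_filter)
  moreover have "eventually (\<lambda>t. dist t s0 < d) (at s0 within {0..T})"
    unfolding eventually_at using d(1) by blast
  ultimately show "\<forall>\<^sub>F s in at s0 within {0..T}. dist (integral {-A..A} (\<lambda>y. r s y * q s y)) (integral {-A..A} (\<lambda>y. r s0 y * q s0 y)) < e"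
  proof eventually_elim
    case (elim s)
    have i: "(\<lambda>y. r s' y * q s'' y) integrable_on {-A..A}" if "s' \<in> {0..T}" "s'' \<in> {0..T}" for s' s''
      using absolutely_integrable_continuous_mult[OF bmeas_absolutely_integrable[OF r[OF that(1)]] qs[OF that(2)]]
        absolutely_integrable_on_def by blast
    have di: "(\<lambda>x. \<bar>r s x - r s0 x\<bar>) integrable_on {-A..A}" by (rule bmeas_integrable[OF bmeas_diff_r[OF elim(2) s0]])
    have "\<bar>integral {-A..A} (\<lambda>y. r s y * q s y - r s0 y * q s0 y)\<bar> \<le> integral {-A..A} (\<lambda>y. M * e1 + \<bar>r s y - r s0 y\<bar> * B)"
    proof (rule integral_norm_bound_integral[where 'a = real, unfolded real_norm_def])
      show "(\<lambda>y. r s y * q s y - r s0 y * q s0 y) integrable_on {-A..A}" using i elim(2) s0 by (intro integrable_diff) auto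
      show "(\<lambda>y. M * e1 + \<bar>r s y - r s0 y\<bar> * B) integrable_on {-A..A}"
        by (intro integrable_add integrable_const_ivl integrable_on_mult_left di)
      fix y assume y: "y \<in> {-A..A}"
      have "r s y * q s y - r s0 y * q s0 y = r s y * (q s y - q s0 y) + (r s y - r s0 y) * q s0 y"
        by (simp add: algebra_simps)
      moreover have "\<bar>r s y * (q s y - q s0 y)\<bar> \<le> M * e1"
        unfolding abs_mult
      proof (rule mult_mono)
        show "\<bar>r s y\<bar> \<le> M" using r[OF elim(2)] by (simp add: bmeas_def)
        show "\<bar>q s y - q s0 y\<bar> \<le> e1"
          using d(2)[of "(s0, y)" "(s, y)"] y s0 elim(2,3) by (simp add: dist_Pair_Pair dist_real_def)
      qed (use M_nonneg in auto)
      moreover have "\<bar>(r s y - r s0 y) * q s0 y\<bar> \<le> \<bar>r s y - r s0 y\<bar> * B"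
        unfolding abs_mult using B[of "(s0, y)"] s0 y by (intro mult_left_mono) auto
      ultimately show "\<bar>r s y * q s y - r s0 y * q s0 y\<bar> \<le> M * e1 + \<bar>r s y - r s0 y\<bar> * B" by linarith
    qed
    also have "integral {-A..A} (\<lambda>y. M * e1 + \<bar>r s y - r s0 y\<bar> * B) = M * e1 * (2 * A) + integral {-A..A} (\<lambda>y. \<bar>r s y - r s0 y\<bar>) * B"
      using assms(2) by (subst Henstock_Kurzweil_Integration.integral_add) (auto intro!: integrable_on_mult_left di)
    also have "\<dots> < e"
    proof -
      have "M * e1 * (2 * A) \<le> (M * (2 * A) + 1) * e1" using e1 by (simp add: algebra_simps)
      also have "\<dots> = e / 2" unfolding e1_def by (rule mult_divide_twice[OF \<open>M * (2 * A) + 1 > 0\<close>])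
      finally have 1: "M * e1 * (2 * A) \<le> e / 2" .
      have "0 \<le> integral {-A..A} (\<lambda>x. \<bar>r s x - r s0 x\<bar>)" by (rule integral_nonneg[OF di]) simp
      then have "integral {-A..A} (\<lambda>y. \<bar>r s y - r s0 y\<bar>) * B \<le> integral {-A..A} (\<lambda>y. \<bar>r s y - r s0 y\<bar>) * (B + 1)"
        by (intro mult_left_mono) auto
      also have "\<dots> < e / (2 * (B + 1)) * (B + 1)" using elim(1) B0 by (intro mult_strict_right_mono) auto
      also have "\<dots> = (B + 1) * (e / (2 * (B + 1)))" by (simp only: mult.commute)
      also have "\<dots> = e / 2" by (rule mult_divide_twice) (use B0 in simp)
      finally show ?thesis using 1 by linarith
    qed
    finally show ?case
      using i[OF elim(2) elim(2)] i[OF s0 s0] by (simp add: dist_real_def Henstock_Kurzweil_Integration.integral_diff)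
  qed
qed

text \<open>
  The test function is \<open>\<zeta>(s) \<psi>(s,y)\<close>. Separating the cutoff \<open>\<zeta>\<close> in time leaves a one-dimensional weak equation for
  the moment \<open>\<integral> \<rho> \<psi> dy\<close>.
\<close>

lemma weak_formulation_product:
  fixes \<psi> \<psi>t \<psi>x :: "real \<Rightarrow> real \<Rightarrow> real" and \<zeta> :: "real \<Rightarrow> real"
  assumes C: "\<And>k S. C_on k S (\<lambda>p. \<psi> (fst p) (snd p))"
    and dt: "\<And>s y. ((\<lambda>s. \<psi> s y) has_real_derivative \<psi>t s y) (at s)"
    and dx: "\<And>s y. ((\<lambda>y. \<psi> s y) has_real_derivative \<psi>x s y) (at y)"
    and ct: "continuous_on UNIV (\<lambda>p. \<psi>t (fst p) (snd p))"
    and cx: "continuous_on UNIV (\<lambda>p. \<psi>x (fst p) (snd p))"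
    and supp: "\<And>s y. s \<in> {0..T} \<Longrightarrow> y \<notin> {-A..A} \<Longrightarrow> \<psi> s y = 0 \<and> \<psi>t s y = 0 \<and> \<psi>x s y = 0"
    and A: "A \<ge> 0"
    and \<zeta>: "smooth \<zeta>" "\<And>s. T' \<le> s \<Longrightarrow> \<zeta> s = 0" "T' < T"
  shows "integral {0..T} (\<lambda>s. deriv \<zeta> s * integral {-A..A} (\<lambda>y. r s y * \<psi> s y)
      + \<zeta> s * integral {-A..A} (\<lambda>y. r s y * (\<psi>t s y + V (W s y) * \<psi>x s y)))
    + \<zeta> 0 * integral {-A..A} (\<lambda>y. r0 y * \<psi> 0 y) = 0"
proof -
  define q where "q s y = \<psi>t s y + V (W s y) * \<psi>x s y" for s y
  define a where "a s = integral {-A..A} (\<lambda>y. r s y * \<psi> s y)" for s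
  define b where "b s = integral {-A..A} (\<lambda>y. r s y * q s y)" for s
  define a0 where "a0 = integral {-A..A} (\<lambda>y. r0 y * \<psi> 0 y)"
  have c\<psi>: "continuous_on S (\<lambda>p. \<psi> (fst p) (snd p))" for S using C[of 0 S] by simp
  have cq: "continuous_on ({0..T} \<times> UNIV) (\<lambda>p. q (fst p) (snd p))"
    unfolding q_def by (intro continuous_intros V_W_continuous continuous_on_subset[OF ct] continuous_on_subset[OF cx]) auto
  have ca: "continuous_on {0..T} a" unfolding a_def by (rule moment_continuous[OF c\<psi> A])
  have cb: "continuous_on {0..T} b" unfolding b_def by (rule moment_continuous[OF cq A])
  define \<phi> where "\<phi> = (\<lambda>p. \<zeta> (fst p) * \<psi> (fst p) (snd p))"
  have "spacetime_test_fun T \<phi>"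
    unfolding spacetime_test_fun_def
  proof (intro conjI allI exI[of _ "{0..max 0 T'} \<times> {-A..A}"] ballI)
    fix k
    have "C_on k S (\<lambda>p. \<zeta> (1 * fst p + 0 * snd p + 0))" for S
      using \<zeta>(1) by (intro C_on_affine) (simp add: smooth_def)
    then show "C_on k ({0..<T} \<times> UNIV) \<phi>" unfolding \<phi>_def by (intro C_on_mult C) simp
    show "compact ({0..max 0 T'} \<times> {-A..A})" by (intro compact_Times) auto
    show "{0..max 0 T'} \<times> {-A..A} \<subseteq> {0..<T} \<times> UNIV" using \<zeta>(3) T by auto
    fix p assume p: "p \<in> {0..<T} \<times> UNIV - {0..max 0 T'} \<times> {-A..A}"
    then have "T' \<le> fst p \<or> (fst p \<in> {0..T} \<and> snd p \<notin> {-A..A})" by (cases p) auto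
    then show "\<phi> p = 0" using \<zeta>(2) supp by (auto simp: \<phi>_def)
  qed
  from weak[OF this]
  have w: "(LINT t:{0<..<T}|lebesgue. (LINT x|lebesgue. r t x * deriv (\<lambda>s. \<phi> (s, x)) t + V (W t x) * r t x * deriv (\<lambda>y. \<phi> (t, y)) x))
      + (LINT x|lebesgue. r0 x * \<phi> (0, x)) = 0" .
  have sl: "continuous_on {-A..A} (f s)" if "continuous_on ({0..T} \<times> UNIV) (\<lambda>p. f (fst p) (snd p))" "s \<in> {0..T}" for f :: "real \<Rightarrow> real \<Rightarrow> real" and s
  proof -
    have "continuous_on {-A..A} (\<lambda>y. f (fst (s, y)) (snd (s, y)))"
      by (rule continuous_on_compose2[OF that(1), of _ "\<lambda>y. (s, y)"]) (use that(2) in \<open>auto intro!: continuous_intros\<close>)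
    then show ?thesis by simp
  qed
  have inner: "(LINT x|lebesgue. r t x * deriv (\<lambda>s. \<phi> (s, x)) t + V (W t x) * r t x * deriv (\<lambda>y. \<phi> (t, y)) x)
      = deriv \<zeta> t * a t + \<zeta> t * b t" if t: "t \<in> {0<..<T}" for t
  proof -
    have tT: "t \<in> {0..T}" using t by auto
    have d1: "deriv (\<lambda>s. \<phi> (s, x)) t = deriv \<zeta> t * \<psi> t x + \<psi>t t x * \<zeta> t" for x
      unfolding \<phi>_def fst_conv snd_conv by (rule DERIV_imp_deriv, rule DERIV_mult[OF smooth_has_deriv[OF \<zeta>(1)] dt])
    have d2: "deriv (\<lambda>y. \<phi> (t, y)) x = \<zeta> t * \<psi>x t x" for x
      unfolding \<phi>_def fst_conv snd_conv by (rule DERIV_imp_deriv, rule DERIV_cmult[OF dx])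
    have eq: "r t x * deriv (\<lambda>s. \<phi> (s, x)) t + V (W t x) * r t x * deriv (\<lambda>y. \<phi> (t, y)) x
        = deriv \<zeta> t * (r t x * \<psi> t x) + \<zeta> t * (r t x * q t x)" for x
      unfolding d1 d2 q_def by (simp add: algebra_simps)
    have i1: "(\<lambda>x. r t x * \<psi> t x) absolutely_integrable_on {-A..A}"
      by (intro absolutely_integrable_continuous_mult bmeas_absolutely_integrable[OF r[OF tT]] sl c\<psi> tT)
    have i2: "(\<lambda>x. r t x * q t x) absolutely_integrable_on {-A..A}"
      by (intro absolutely_integrable_continuous_mult bmeas_absolutely_integrable[OF r[OF tT]] sl cq tT)
    have i3: "integrable lebesgue (\<lambda>x. r t x * \<psi> t x)" "(LINT x|lebesgue. r t x * \<psi> t x) = a t"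
      using integral_compact_support[OF i1] supp[OF tT] by (auto simp: a_def)
    have i4: "integrable lebesgue (\<lambda>x. r t x * q t x)" "(LINT x|lebesgue. r t x * q t x) = b t"
      using integral_compact_support[OF i2] supp[OF tT] by (auto simp: b_def q_def)
    show ?thesis unfolding eq using i3 i4 by simp
  qed
  define f where "f = (\<lambda>s. deriv \<zeta> s * a s + \<zeta> s * b s)"
  have cf: "continuous_on {0..T} f"
    unfolding f_def by (intro continuous_intros ca cb smooth_continuous_on smooth_deriv \<zeta>(1))
  have fi: "f absolutely_integrable_on {0..T}" by (rule absolutely_integrable_continuous_real[OF cf])
  have fi': "f absolutely_integrable_on {0<..<T}" by (rule set_integrable_subset[OF fi]) auto
  have "(LINT t:{0<..<T}|lebesgue. (LINT x|lebesgue. r t x * deriv (\<lambda>s. \<phi> (s, x)) t + V (W t x) * r t x * deriv (\<lambda>y. \<phi> (t, y)) x))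
     = (LINT t:{0<..<T}|lebesgue. f t)"
    by (rule set_lebesgue_integral_cong) (use inner in \<open>auto simp: f_def\<close>)
  also have "\<dots> = integral {0<..<T} f" by (rule set_lebesgue_integral_eq_integral(2)[OF fi'])
  also have "\<dots> = integral {0..T} f" by (rule integral_spike_set) (auto intro: negligible_subset[of "{0, T}"])
  finally have "integral {0..T} f + (LINT x|lebesgue. r0 x * \<phi> (0, x)) = 0" using w by simp
  moreover have "(LINT x|lebesgue. r0 x * \<phi> (0, x)) = \<zeta> 0 * a0"
  proof -
    have T0: "0 \<in> {0..T}" using T by simp
    have "(\<lambda>x. r0 x * \<psi> 0 x) absolutely_integrable_on {-A..A}"
      by (intro absolutely_integrable_continuous_mult bmeas_absolutely_integrable[OF r0] sl c\<psi> T0)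
    from integral_compact_support[OF this] supp[OF T0]
    have "(LINT x|lebesgue. r0 x * \<psi> 0 x) = a0" by (auto simp: a0_def)
    moreover have "(LINT x|lebesgue. r0 x * \<phi> (0, x)) = (LINT x|lebesgue. \<zeta> 0 * (r0 x * \<psi> 0 x))"
      by (simp add: \<phi>_def mult_ac)
    ultimately show ?thesis by simp
  qed
  ultimately show ?thesis by (simp add: f_def a_def b_def q_def a0_def)
qed

text \<open>
  The moments \<open>a\<close> and \<open>b\<close> are continuous in time, so the weak equation \<open>a' = b\<close>, \<open>a(0) = a\<^sub>0\<close> can be integrated.
  The difference \<open>g\<close> between the two sides is orthogonal to the derivatives of all cutoffs; a cutoff that falls from one
  to zero on a short interval behind \<open>t\<close> shows that \<open>g(t) = 0\<close>.
\<close>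

lemma weak_formulation_integrated:
  fixes \<psi> \<psi>t \<psi>x :: "real \<Rightarrow> real \<Rightarrow> real"
  assumes C: "\<And>k S. C_on k S (\<lambda>p. \<psi> (fst p) (snd p))"
    and dt: "\<And>s y. ((\<lambda>s. \<psi> s y) has_real_derivative \<psi>t s y) (at s)"
    and dx: "\<And>s y. ((\<lambda>y. \<psi> s y) has_real_derivative \<psi>x s y) (at y)"
    and ct: "continuous_on UNIV (\<lambda>p. \<psi>t (fst p) (snd p))"
    and cx: "continuous_on UNIV (\<lambda>p. \<psi>x (fst p) (snd p))"
    and supp: "\<And>s y. s \<in> {0..T} \<Longrightarrow> y \<notin> {-A..A} \<Longrightarrow> \<psi> s y = 0 \<and> \<psi>t s y = 0 \<and> \<psi>x s y = 0"
    and A: "A \<ge> 0"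
    and t: "0 \<le> t" "t < T"
  defines "b \<equiv> \<lambda>s. integral {-A..A} (\<lambda>y. r s y * (\<psi>t s y + V (W s y) * \<psi>x s y))"
  shows "b integrable_on {0..t}"
    and "integral {-A..A} (\<lambda>y. r t y * \<psi> t y) = integral {-A..A} (\<lambda>y. r0 y * \<psi> 0 y) + integral {0..t} b"
proof -
  define a where "a s = integral {-A..A} (\<lambda>y. r s y * \<psi> s y)" for s
  define a0 where "a0 = integral {-A..A} (\<lambda>y. r0 y * \<psi> 0 y)"
  have c\<psi>: "continuous_on S (\<lambda>p. \<psi> (fst p) (snd p))" for S using C[of 0 S] by simp
  have cq: "continuous_on ({0..T} \<times> UNIV) (\<lambda>p. \<psi>t (fst p) (snd p) + V (W (fst p) (snd p)) * \<psi>x (fst p) (snd p))"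
    by (intro continuous_intros V_W_continuous continuous_on_subset[OF ct] continuous_on_subset[OF cx]) auto
  have ca: "continuous_on {0..T} a" unfolding a_def by (rule moment_continuous[OF c\<psi> A])
  have cb: "continuous_on {0..T} b" unfolding b_def
    using moment_continuous[of "\<lambda>s y. \<psi>t s y + V (W s y) * \<psi>x s y", OF cq A] .
  have bi: "b integrable_on {0..s}" if "s \<le> T" for s
    by (rule integrable_continuous_interval, rule continuous_on_subset[OF cb]) (use that in auto)
  then show "b integrable_on {0..t}" using t by simp
  define A0 where "A0 s = integral {0..s} b" for s
  have dA0: "(A0 has_vector_derivative b s) (at s within {0..T})" if "s \<in> {0..T}" for s
    unfolding A0_def by (rule integral_has_vector_derivative[OF cb that])
  have cA0: "continuous_on {0..T} A0"
    unfolding A0_def by (rule indefinite_integral_continuous_1[OF bi]) simp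
  define g where "g = (\<lambda>s. a s - A0 s - a0)"
  have cg: "continuous_on {0..T} g" unfolding g_def by (intro continuous_intros ca cA0)
  have ortho: "integral {0..T} (\<lambda>s. deriv \<zeta> s * g s) = 0"
    if \<zeta>: "smooth \<zeta>" "\<And>s. T' \<le> s \<Longrightarrow> \<zeta> s = 0" "T' < T" for \<zeta> T'
  proof -
    note c = smooth_continuous_on[OF \<zeta>(1)] smooth_continuous_on[OF smooth_deriv[OF \<zeta>(1)]]
    have 1: "integral {0..T} (\<lambda>s. deriv \<zeta> s * a s + \<zeta> s * b s) + \<zeta> 0 * a0 = 0"
      unfolding a_def a0_def b_def by (rule weak_formulation_product[OF C dt dx ct cx supp A \<zeta>])
    have "((\<lambda>s. deriv \<zeta> s * A0 s + \<zeta> s * b s) has_integral \<zeta> T * A0 T - \<zeta> 0 * A0 0) {0..T}"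
    proof (rule fundamental_theorem_of_calculus)
      fix s assume s: "s \<in> {0..T}"
      have "(\<zeta> has_vector_derivative deriv \<zeta> s) (at s within {0..T})"
        using smooth_has_deriv[OF \<zeta>(1), of s]
        by (simp add: has_real_derivative_iff_has_vector_derivative has_vector_derivative_at_within)
      from has_vector_derivative_mult[OF this dA0[OF s]]
      show "((\<lambda>s. \<zeta> s * A0 s) has_vector_derivative deriv \<zeta> s * A0 s + \<zeta> s * b s) (at s within {0..T})"
        by (simp add: add.commute)
    qed (use T in simp)
    then have 2: "integral {0..T} (\<lambda>s. deriv \<zeta> s * A0 s + \<zeta> s * b s) = 0"
      using \<zeta>(2)[of T] \<zeta>(3) by (simp add: integral_unique A0_def)
    have h: "((\<lambda>s. deriv \<zeta> s) has_integral \<zeta> T - \<zeta> 0) {0..T}"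
      by (rule fundamental_theorem_of_calculus)
        (use T smooth_has_deriv[OF \<zeta>(1)] in \<open>auto simp: has_real_derivative_iff_has_vector_derivative[symmetric] intro: has_field_derivative_at_within\<close>)
    have "\<zeta> T = 0" using \<zeta>(2)[of T] \<zeta>(3) by simp
    then have 3: "integral {0..T} (\<lambda>s. deriv \<zeta> s * a0) = - (\<zeta> 0 * a0)"
      unfolding integral_unique[OF has_integral_mult_left[OF h]] by simp
    have i1: "(\<lambda>s. deriv \<zeta> s * a s + \<zeta> s * b s) integrable_on {0..T}"
      by (intro integrable_continuous_interval continuous_intros c ca cb)
    have i2: "(\<lambda>s. deriv \<zeta> s * A0 s + \<zeta> s * b s) integrable_on {0..T}"
      by (intro integrable_continuous_interval continuous_intros c cA0 cb)
    have i3: "(\<lambda>s. deriv \<zeta> s * a0) integrable_on {0..T}"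
      by (intro integrable_continuous_interval continuous_intros c)
    have "integral {0..T} (\<lambda>s. deriv \<zeta> s * g s)
      = integral {0..T} (\<lambda>s. (deriv \<zeta> s * a s + \<zeta> s * b s) - (deriv \<zeta> s * A0 s + \<zeta> s * b s) - deriv \<zeta> s * a0)"
      by (simp add: g_def algebra_simps)
    also have "\<dots> = integral {0..T} (\<lambda>s. deriv \<zeta> s * a s + \<zeta> s * b s)
      - integral {0..T} (\<lambda>s. deriv \<zeta> s * A0 s + \<zeta> s * b s) - integral {0..T} (\<lambda>s. deriv \<zeta> s * a0)"
      by (simp only: Henstock_Kurzweil_Integration.integral_diff[OF integrable_diff[OF i1 i2] i3]
          Henstock_Kurzweil_Integration.integral_diff[OF i1 i2])
    finally show ?thesis using 1 2 3 by linarith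

  qed
  have "g t = 0"
  proof (rule ccontr)
    assume "g t \<noteq> 0"
    define \<gamma> where "\<gamma> = \<bar>g t\<bar>"
    have \<gamma>: "\<gamma> > 0" using \<open>g t \<noteq> 0\<close> by (simp add: \<gamma>_def)
    obtain d where d: "d > 0" "\<And>s. s \<in> {0..T} \<Longrightarrow> \<bar>s - t\<bar> < d \<Longrightarrow> \<bar>g s - g t\<bar> < \<gamma> / 2"
    proof -
      have "t \<in> {0..T}" using t by auto
      then have "\<exists>d>0. \<forall>s\<in>{0..T}. dist s t < d \<longrightarrow> dist (g s) (g t) < \<gamma> / 2"
        using cg \<gamma> unfolding continuous_on_iff by (meson half_gt_zero)
      then show ?thesis using that unfolding dist_real_def by blast
    qed
    define \<eta> where "\<eta> = min (d / 2) ((T - t) / 2)"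
    have \<eta>: "\<eta> > 0" "\<eta> < d" "t + \<eta> < T" using d(1) t by (auto simp: \<eta>_def min_def field_simps)
    define \<zeta> where "\<zeta> = (\<lambda>s. step ((- (1 / \<eta>)) * s + (t + \<eta>) / \<eta>))"
    have arg: "(- (1 / \<eta>)) * s + (t + \<eta>) / \<eta> = (t + \<eta> - s) / \<eta>" for s using \<eta> by (simp add: field_simps)
    have \<zeta>: "smooth \<zeta>" unfolding \<zeta>_def by (rule smooth_affine[OF smooth_step])
    have \<zeta>0: "\<zeta> s = 0" if "t + \<eta> \<le> s" for s
      unfolding \<zeta>_def arg using that \<eta>(1) by (intro step_eq_0) (simp add: divide_nonpos_pos)
    have \<zeta>1: "\<zeta> 0 = 1" unfolding \<zeta>_def arg using \<eta>(1) t by (intro step_eq_1) simp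
    have d\<zeta>: "deriv \<zeta> s = - (1 / \<eta>) * deriv step ((t + \<eta> - s) / \<eta>)" for s
    proof -
      have 1: "((\<lambda>s. (- (1 / \<eta>)) * s + (t + \<eta>) / \<eta>) has_real_derivative - (1 / \<eta>)) (at s)"
        by (rule derivative_eq_intros refl)+ simp
      have "deriv \<zeta> s = deriv step ((- (1 / \<eta>)) * s + (t + \<eta>) / \<eta>) * (- (1 / \<eta>))"
        unfolding \<zeta>_def by (rule DERIV_imp_deriv[OF DERIV_chain2[OF smooth_has_deriv[OF smooth_step] 1]])
      then show ?thesis unfolding arg by (simp only: mult.commute)
    qed
    have neg: "deriv \<zeta> s \<le> 0" for s
      unfolding d\<zeta> using \<eta>(1) deriv_step_nonneg[of "(t + \<eta> - s) / \<eta>"] by (simp add: mult_nonpos_nonneg)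
    have out: "deriv \<zeta> s = 0" if "s < t \<or> t + \<eta> < s" for s
    proof -
      have "(t + \<eta> - s) / \<eta> < 0 \<or> 1 < (t + \<eta> - s) / \<eta>"
        using that \<eta>(1) by (auto simp: divide_neg_pos)
      then show ?thesis unfolding d\<zeta> using deriv_step_eq_0 by simp
    qed
    note c = smooth_continuous_on[OF smooth_deriv[OF \<zeta>]]
    have hi: "((\<lambda>s. deriv \<zeta> s) has_integral \<zeta> T - \<zeta> 0) {0..T}"
      by (rule fundamental_theorem_of_calculus)
        (use T smooth_has_deriv[OF \<zeta>] in \<open>auto simp: has_real_derivative_iff_has_vector_derivative[symmetric] intro: has_field_derivative_at_within\<close>)
    then have hi1: "integral {0..T} (deriv \<zeta>) = - 1" using \<zeta>0[of T] \<zeta>1 \<eta>(3) by (simp add: integral_unique)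
    have "integral {0..T} (\<lambda>s. deriv \<zeta> s * (g s - g t)) = integral {0..T} (\<lambda>s. deriv \<zeta> s * g s) - integral {0..T} (\<lambda>s. deriv \<zeta> s * g t)"
      unfolding right_diff_distrib
      by (rule Henstock_Kurzweil_Integration.integral_diff) (intro integrable_continuous_interval continuous_intros c cg)+
    also have "\<dots> = g t" using ortho[OF \<zeta> \<zeta>0 \<eta>(3)] hi1 by simp
    finally have "\<gamma> = \<bar>integral {0..T} (\<lambda>s. deriv \<zeta> s * (g s - g t))\<bar>" by (simp add: \<gamma>_def)
    also have "\<dots> \<le> integral {0..T} (\<lambda>s. deriv \<zeta> s * (- (\<gamma> / 2)))"
    proof (rule integral_norm_bound_integral[where 'a = real, unfolded real_norm_def])
      show "(\<lambda>s. deriv \<zeta> s * (g s - g t)) integrable_on {0..T}" by (intro integrable_continuous_interval continuous_intros c cg)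
      show "(\<lambda>s. deriv \<zeta> s * (- (\<gamma> / 2))) integrable_on {0..T}" by (intro integrable_continuous_interval continuous_intros c)
      fix s assume s: "s \<in> {0..T}"
      show "\<bar>deriv \<zeta> s * (g s - g t)\<bar> \<le> deriv \<zeta> s * (- (\<gamma> / 2))"
      proof (cases "s < t \<or> t + \<eta> < s")
        case True then show ?thesis using out by simp
      next
        case False
        then have "\<bar>g s - g t\<bar> \<le> \<gamma> / 2" using d(2)[OF s] \<eta>(2) by fastforce
        then have "(- deriv \<zeta> s) * \<bar>g s - g t\<bar> \<le> (- deriv \<zeta> s) * (\<gamma> / 2)" using neg[of s] by (intro mult_left_mono) auto
        then show ?thesis using neg[of s] by (simp add: abs_mult)
      qed
    qed
    also have "\<dots> = \<gamma> / 2" using hi1 by simp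
    finally show False using \<gamma> by simp
  qed
  then show "integral {-A..A} (\<lambda>y. r t y * \<psi> t y) = integral {-A..A} (\<lambda>y. r0 y * \<psi> 0 y) + integral {0..t} b"
    by (simp add: g_def a_def a0_def A0_def)
qed

end

section \<open>Conservation of mass along straight lines\<close>

text \<open>
  The product of two steps of width \<open>\<eta>\<close> differs from the indicator of \<open>[y,x]\<close> only in two edge layers of width \<open>\<eta>\<close>.
\<close>

lemma step_edge_approximation:
  assumes h: "bmeas M h" and yx: "y \<le> x" and A: "-A \<le> y - 1" "x + 1 \<le> A" and \<eta>: "0 < \<eta>" "\<eta> \<le> 1"
  shows "\<bar>integral {-A..A} (\<lambda>q. h q * (step ((q - y) / \<eta>) * step ((x - q) / \<eta>))) - integral {y..x} h\<bar> \<le> 2 * M * \<eta>"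
proof -
  let ?\<psi> = "\<lambda>q. step ((q - y) / \<eta>) * step ((x - q) / \<eta>)"
  let ?i = "\<lambda>c q. if q \<in> {c..c + \<eta>} then (1::real) else 0"
  have M: "M \<ge> 0" using h by (rule bmeas_nonneg)
  have c\<psi>: "continuous_on {-A..A} ?\<psi>"
    using \<eta> by (intro continuous_on_mult continuous_on_compose2[OF smooth_continuous_on[OF smooth_step, of UNIV]] continuous_intros) auto
  have i1: "(\<lambda>q. h q * ?\<psi> q) integrable_on {-A..A}"
    using absolutely_integrable_continuous_mult[OF bmeas_absolutely_integrable[OF h] c\<psi>] absolutely_integrable_on_def by blast
  have sub: "{-A..A} \<inter> {y..x} = {y..x}" "{y..x} \<inter> {-A..A} = {y..x}" using A yx by auto
  have i2: "(\<lambda>q. if q \<in> {y..x} then h q else 0) integrable_on {-A..A}"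
    unfolding integrable_restrict_Int sub by (rule bmeas_integrable[OF h])
  have e2: "integral {-A..A} (\<lambda>q. if q \<in> {y..x} then h q else 0) = integral {y..x} h"
    unfolding integral_restrict_Int sub ..
  have i3: "(?i c has_integral \<eta>) {-A..A}" if "-A \<le> c" "c + \<eta> \<le> A" for c
  proof -
    have 1: "{c..c + \<eta>} \<inter> {-A..A} = {c..c + \<eta>}" using that by auto
    have "((\<lambda>q. 1::real) has_integral \<eta>) {c..c + \<eta>}" using has_integral_const_real[of "1::real" c "c + \<eta>"] \<eta> by simp
    then show ?thesis by (simp only: has_integral_restrict_Int 1)
  qed
  have hb: "((\<lambda>q. M * (?i y q + ?i (x - \<eta>) q)) has_integral M * (\<eta> + \<eta>)) {-A..A}"
    using A yx \<eta> by (intro has_integral_mult_right has_integral_add i3) auto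
  have "\<bar>integral {-A..A} (\<lambda>q. h q * ?\<psi> q - (if q \<in> {y..x} then h q else 0))\<bar> \<le> integral {-A..A} (\<lambda>q. M * (?i y q + ?i (x - \<eta>) q))"
  proof (rule integral_norm_bound_integral[where 'a = real, unfolded real_norm_def])
    show "(\<lambda>q. h q * ?\<psi> q - (if q \<in> {y..x} then h q else 0)) integrable_on {-A..A}" by (intro integrable_diff i1 i2)
    show "(\<lambda>q. M * (?i y q + ?i (x - \<eta>) q)) integrable_on {-A..A}" using hb by blast
    fix q
    have hq: "\<bar>h q\<bar> \<le> M" using h by (simp add: bmeas_def)
    have p01: "0 \<le> ?\<psi> q" "?\<psi> q \<le> 1" by (intro mult_nonneg_nonneg mult_le_one step_nonneg step_le_1)+
    consider "q < y \<or> x < q" | "y \<le> q" "q \<le> x" "q \<le> y + \<eta> \<or> x - \<eta> \<le> q" | "y + \<eta> < q" "q < x - \<eta>" by linarith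
    then show "\<bar>h q * ?\<psi> q - (if q \<in> {y..x} then h q else 0)\<bar> \<le> M * (?i y q + ?i (x - \<eta>) q)"
    proof cases
      case 1
      then have "?\<psi> q = 0" using \<eta> step_eq_0[of "(q - y) / \<eta>"] step_eq_0[of "(x - q) / \<eta>"] by (auto simp: divide_nonpos_pos)
      then show ?thesis using 1 M by auto
    next
      case 2
      have "h q * ?\<psi> q - h q = - (h q * (1 - ?\<psi> q))" by (simp add: algebra_simps)
      then have "\<bar>h q * ?\<psi> q - h q\<bar> = \<bar>h q\<bar> * (1 - ?\<psi> q)" using p01 by (simp add: abs_mult)
      also have "\<dots> \<le> M * 1" using hq p01 M by (intro mult_mono) auto
      also have "\<dots> \<le> M * (?i y q + ?i (x - \<eta>) q)" using 2 M by (intro mult_left_mono) auto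
      finally show ?thesis using 2 by simp
    next
      case 3
      then have "1 \<le> (q - y) / \<eta>" "1 \<le> (x - q) / \<eta>" using \<eta> by (simp_all add: pos_le_divide_eq)
      then show ?thesis using M 3 \<eta> by (simp add: step_eq_1)
    qed
  qed
  also have "\<dots> = 2 * M * \<eta>" using integral_unique[OF hb] by simp
  also have "integral {-A..A} (\<lambda>q. h q * ?\<psi> q - (if q \<in> {y..x} then h q else 0))
    = integral {-A..A} (\<lambda>q. h q * ?\<psi> q) - integral {y..x} h"
    unfolding Henstock_Kurzweil_Integration.integral_diff[OF i1 i2] e2 ..
  finally show ?thesis .
qed

text \<open>
  The derivative of a step is an approximate identity whose mass is at most one, uniformly in its width.
\<close>

lemma integral_step_kernel:
  assumes "0 < \<eta>" "0 \<le> A"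
  shows "(\<lambda>q. deriv step ((q - c) / \<eta>) / \<eta>) integrable_on {-A..A}"
    and "integral {-A..A} (\<lambda>q. deriv step ((q - c) / \<eta>) / \<eta>) \<le> 1"
    and "(\<lambda>q. deriv step ((c - q) / \<eta>) / \<eta>) integrable_on {-A..A}"
    and "integral {-A..A} (\<lambda>q. deriv step ((c - q) / \<eta>) / \<eta>) \<le> 1"
proof -
  have 1: "((\<lambda>q. deriv step ((q - c) / \<eta>) / \<eta>) has_integral step ((A - c) / \<eta>) - step ((-A - c) / \<eta>)) {-A..A}"
  proof (rule fundamental_theorem_of_calculus)
    fix q
    have "((\<lambda>q. (q - c) / \<eta>) has_real_derivative 1 / \<eta>) (at q)" using assms(1) by (auto intro!: derivative_eq_intros)
    from DERIV_chain2[OF smooth_has_deriv[OF smooth_step] this]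
    show "((\<lambda>q. step ((q - c) / \<eta>)) has_vector_derivative deriv step ((q - c) / \<eta>) / \<eta>) (at q within {-A..A})"
      by (simp add: has_real_derivative_iff_has_vector_derivative has_vector_derivative_at_within)
  qed (use assms in simp)
  then show "(\<lambda>q. deriv step ((q - c) / \<eta>) / \<eta>) integrable_on {-A..A}" by blast
  show "integral {-A..A} (\<lambda>q. deriv step ((q - c) / \<eta>) / \<eta>) \<le> 1"
    unfolding integral_unique[OF 1] using step_nonneg[of "(-A - c) / \<eta>"] step_le_1[of "(A - c) / \<eta>"] by linarith
  have 2: "((\<lambda>q. deriv step ((c - q) / \<eta>) / \<eta>) has_integral (- step ((c - A) / \<eta>)) - (- step ((c - (-A)) / \<eta>))) {-A..A}"
  proof (rule fundamental_theorem_of_calculus)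
    fix q
    have "((\<lambda>q. (c - q) / \<eta>) has_real_derivative - (1 / \<eta>)) (at q)" using assms(1) by (auto intro!: derivative_eq_intros)
    from DERIV_minus[OF DERIV_chain2[OF smooth_has_deriv[OF smooth_step] this]]
    show "((\<lambda>q. - step ((c - q) / \<eta>)) has_vector_derivative deriv step ((c - q) / \<eta>) / \<eta>) (at q within {-A..A})"
      by (simp add: has_real_derivative_iff_has_vector_derivative has_vector_derivative_at_within)
  qed (use assms in simp)
  then show "(\<lambda>q. deriv step ((c - q) / \<eta>) / \<eta>) integrable_on {-A..A}" by blast
  show "integral {-A..A} (\<lambda>q. deriv step ((c - q) / \<eta>) / \<eta>) \<le> 1"
    unfolding integral_unique[OF 2] using step_nonneg[of "(c - A) / \<eta>"] step_le_1[of "(c - (-A)) / \<eta>"] by linarith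
qed

lemma le_if_le_add_small:
  fixes a b c :: real
  assumes "\<And>\<eta>. 0 < \<eta> \<Longrightarrow> \<eta> \<le> 1 \<Longrightarrow> a \<le> b + c * \<eta>"
  shows "a \<le> b"
proof (rule tendsto_lowerbound)
  show "((\<lambda>\<eta>. b + c * \<eta>) \<longlongrightarrow> b) (at_right 0)" by (auto intro!: tendsto_eq_intros)
  show "eventually (\<lambda>\<eta>. a \<le> b + c * \<eta>) (at_right 0)"
    unfolding eventually_at_right_field using assms by (intro exI[of _ 1]) auto
qed simp

context nonlocal_flow begin

text \<open>
  Testing with a smoothed indicator of an interval whose end points move with speeds \<open>v1\<close> and \<open>v2\<close>: the mass inside
  changes only through the edge layers, where the flux relative to the moving end point is \<open>\<rho> (V(W) - v)\<close>. The second
  statement is the same identity at time \<open>0\<close>.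
\<close>

lemma mass_change_aux:
  fixes y0 v1 x0 v2 t1 t2 K \<beta> :: real
  defines "y \<equiv> \<lambda>s. y0 + v1 * (s - t1)" and "x \<equiv> \<lambda>s. x0 + v2 * (s - t1)"
  assumes t: "0 \<le> t1" "t1 \<le> t2" "t2 < T"
    and K: "\<And>s q q'. s \<in> {0..T} \<Longrightarrow> \<bar>V (W s q) - V (W s q')\<bar> \<le> K * \<bar>q - q'\<bar>" "K \<ge> 0"
    and b1: "\<And>s. t1 \<le> s \<Longrightarrow> s \<le> t2 \<Longrightarrow> \<bar>V (W s (y s)) - v1\<bar> \<le> \<beta>"
    and b2: "\<And>s. t1 \<le> s \<Longrightarrow> s \<le> t2 \<Longrightarrow> \<bar>V (W s (x s)) - v2\<bar> \<le> \<beta>"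
    and \<eta>: "0 < \<eta>" "\<eta> \<le> 1"
    and A: "A = \<bar>y0\<bar> + \<bar>v1\<bar> * T + \<bar>x0\<bar> + \<bar>v2\<bar> * T + 1"
  defines "a \<equiv> \<lambda>h s. integral {-A..A} (\<lambda>q. h q * (step ((q - y s) / \<eta>) * step ((x s - q) / \<eta>)))"
  shows "\<bar>a (r t2) t2 - a (r t1) t1\<bar> \<le> 2 * M * (\<beta> + K * \<eta>) * (t2 - t1)"
    and "a (r 0) 0 = a r0 0"
proof -
  define \<psi> where "\<psi> = (\<lambda>s q. step ((q - y s) / \<eta>) * step ((x s - q) / \<eta>))"
  define \<psi>t where "\<psi>t = (\<lambda>s q. (deriv step ((q - y s) / \<eta>) * (- v1 / \<eta>)) * step ((x s - q) / \<eta>)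
     + (deriv step ((x s - q) / \<eta>) * (v2 / \<eta>)) * step ((q - y s) / \<eta>))"
  define \<psi>x where "\<psi>x = (\<lambda>s q. (deriv step ((q - y s) / \<eta>) * (1 / \<eta>)) * step ((x s - q) / \<eta>)
     + (deriv step ((x s - q) / \<eta>) * (- 1 / \<eta>)) * step ((q - y s) / \<eta>))"
  have A0: "A \<ge> 0" using A T by simp
  have arg1: "(q - y s) / \<eta> = (- v1 / \<eta>) * s + (1 / \<eta>) * q + (v1 * t1 - y0) / \<eta>" for s q
    using \<eta> by (simp add: y_def field_simps)
  have arg2: "(x s - q) / \<eta> = (v2 / \<eta>) * s + (- 1 / \<eta>) * q + (x0 - v2 * t1) / \<eta>" for s q
    using \<eta> by (simp add: x_def field_simps)
  have C: "C_on k S (\<lambda>p. \<psi> (fst p) (snd p))" for k S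
    unfolding \<psi>_def arg1 arg2 by (intro C_on_mult C_on_affine) (use smooth_step in \<open>auto simp: smooth_def\<close>)
  have dt1: "((\<lambda>s. (q - y s) / \<eta>) has_real_derivative - v1 / \<eta>) (at s)" for s q
    using \<eta> unfolding y_def by (auto intro!: derivative_eq_intros)
  have dt2: "((\<lambda>s. (x s - q) / \<eta>) has_real_derivative v2 / \<eta>) (at s)" for s q
    using \<eta> unfolding x_def by (auto intro!: derivative_eq_intros)
  have dx1: "((\<lambda>q. (q - y s) / \<eta>) has_real_derivative 1 / \<eta>) (at q)" for s q
    using \<eta> by (auto intro!: derivative_eq_intros)
  have dx2: "((\<lambda>q. (x s - q) / \<eta>) has_real_derivative - 1 / \<eta>) (at q)" for s q
    using \<eta> by (auto intro!: derivative_eq_intros)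
  note ch = DERIV_chain2[OF smooth_has_deriv[OF smooth_step]]
  have dt: "((\<lambda>s. \<psi> s q) has_real_derivative \<psi>t s q) (at s)" for s q
    unfolding \<psi>_def \<psi>t_def by (rule DERIV_mult[OF ch[OF dt1] ch[OF dt2]])
  have dx: "((\<lambda>q. \<psi> s q) has_real_derivative \<psi>x s q) (at q)" for s q
    unfolding \<psi>_def \<psi>x_def by (rule DERIV_mult[OF ch[OF dx1] ch[OF dx2]])
  have cy: "continuous_on UNIV (\<lambda>p :: real \<times> real. (snd p - y (fst p)) / \<eta>)"
    and cx: "continuous_on UNIV (\<lambda>p :: real \<times> real. (x (fst p) - snd p) / \<eta>)"
    using \<eta> unfolding y_def x_def by (intro continuous_intros; simp)+
  note cs = continuous_on_compose2[OF smooth_continuous_on[OF smooth_step, of UNIV] _ subset_UNIV]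
    continuous_on_compose2[OF smooth_continuous_on[OF smooth_deriv[OF smooth_step], of UNIV] _ subset_UNIV]
  have ct: "continuous_on UNIV (\<lambda>p. \<psi>t (fst p) (snd p))" and cx': "continuous_on UNIV (\<lambda>p. \<psi>x (fst p) (snd p))"
    unfolding \<psi>t_def \<psi>x_def by (intro continuous_on_add continuous_on_mult continuous_on_const cs cy cx)+
  have s0: "step u = 0 \<and> deriv step u = 0" if "u < 0" for u using that step_eq_0 deriv_step_eq_0 by auto
  have supp: "\<psi> s q = 0 \<and> \<psi>t s q = 0 \<and> \<psi>x s q = 0" if s: "s \<in> {0..T}" and q: "q \<notin> {-A..A}" for s q
  proof -
    have "\<bar>s - t1\<bar> \<le> T" using s t by auto
    then have "\<bar>v1\<bar> * \<bar>s - t1\<bar> \<le> \<bar>v1\<bar> * T" "\<bar>v2\<bar> * \<bar>s - t1\<bar> \<le> \<bar>v2\<bar> * T" by (auto intro: mult_left_mono)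
    then have "\<bar>v1 * (s - t1)\<bar> \<le> \<bar>v1\<bar> * T" "\<bar>v2 * (s - t1)\<bar> \<le> \<bar>v2\<bar> * T" by (simp_all add: abs_mult)
    moreover have "0 \<le> \<bar>v1\<bar> * T" "0 \<le> \<bar>v2\<bar> * T" using T by auto
    ultimately have "-A < y s" "x s < A" unfolding A y_def x_def by linarith+
    then have "q - y s < 0 \<or> x s - q < 0" using q by auto
    then have "(q - y s) / \<eta> < 0 \<or> (x s - q) / \<eta> < 0" using \<eta> by (auto simp: divide_neg_pos)
    then show ?thesis using s0 unfolding \<psi>_def \<psi>t_def \<psi>x_def by auto
  qed
  define b where "b = (\<lambda>s. integral {-A..A} (\<lambda>q. r s q * (\<psi>t s q + V (W s q) * \<psi>x s q)))"
  have at: "a (r t) t = a r0 0 + integral {0..t} b" if "0 \<le> t" "t < T" for t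
  proof -
    have "integral {-A..A} (\<lambda>q. r t q * \<psi> t q) = integral {-A..A} (\<lambda>q. r0 q * \<psi> 0 q) + integral {0..t} b"
      unfolding b_def by (rule weak_formulation_integrated(2)[OF C dt dx ct cx' supp A0 that])
    then show ?thesis by (simp only: a_def \<psi>_def)
  qed
  show "a (r 0) 0 = a r0 0" using at[of 0] T by simp
  have bi: "b integrable_on {0..t2}" 
    unfolding b_def by (rule weak_formulation_integrated(1)[OF C dt dx ct cx' supp A0]) (use t in auto)
  have bi': "b integrable_on {t1..t2}" by (rule integrable_on_subinterval[OF bi]) (use t in auto)
  have "a (r t2) t2 - a (r t1) t1 = integral {t1..t2} b"
    using at[of t1] at[of t2] t Henstock_Kurzweil_Integration.integral_combine[OF t(1,2) bi] by linarith
  moreover have "\<bar>integral {t1..t2} b\<bar> \<le> 2 * M * (\<beta> + K * \<eta>) * (t2 - t1)"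
  proof (rule abs_integral_le[OF bi' t(2)])
    fix s assume s: "s \<in> {t1..t2}"
    have sT: "s \<in> {0..T}" using s t by auto
    define k1 where "k1 = (\<lambda>q. deriv step ((q - y s) / \<eta>) / \<eta>)"
    define k2 where "k2 = (\<lambda>q. deriv step ((x s - q) / \<eta>) / \<eta>)"
    have k: "k1 integrable_on {-A..A}" "integral {-A..A} k1 \<le> 1" "k2 integrable_on {-A..A}" "integral {-A..A} k2 \<le> 1"
      unfolding k1_def k2_def by (rule integral_step_kernel[OF \<eta>(1) A0])+
    have knn: "0 \<le> k1 q" "0 \<le> k2 q" for q unfolding k1_def k2_def using \<eta> deriv_step_nonneg by auto
    have "0 \<le> \<beta>" using b1[of s] s by fastforce
    then have B0: "0 \<le> \<beta> + K * \<eta>" using K(2) \<eta> by simp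
    \<comment> \<open>The derivative of the step lives on the edge layer, where the relative velocity is small.\<close>
    have edge1: "\<bar>V (W s q) - v1\<bar> * k1 q \<le> (\<beta> + K * \<eta>) * k1 q" for q
    proof (cases "0 \<le> (q - y s) / \<eta> \<and> (q - y s) / \<eta> \<le> 1")
      case True
      then have "\<bar>q - y s\<bar> \<le> \<eta>" using \<eta> by (auto simp: zero_le_divide_iff pos_divide_le_eq)
      then have "K * \<bar>q - y s\<bar> \<le> K * \<eta>" using K(2) by (intro mult_left_mono)
      then have "\<bar>V (W s q) - v1\<bar> \<le> \<beta> + K * \<eta>" using K(1)[OF sT, of q "y s"] b1[of s] s by fastforce
      then show ?thesis using knn by (intro mult_right_mono)
    next
      case False
      then have "k1 q = 0" unfolding k1_def using deriv_step_eq_0 by (auto simp: not_le)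
      then show ?thesis by simp
    qed
    have edge2: "\<bar>V (W s q) - v2\<bar> * k2 q \<le> (\<beta> + K * \<eta>) * k2 q" for q
    proof (cases "0 \<le> (x s - q) / \<eta> \<and> (x s - q) / \<eta> \<le> 1")
      case True
      then have "\<bar>q - x s\<bar> \<le> \<eta>" using \<eta> by (auto simp: zero_le_divide_iff pos_divide_le_eq)
      then have "K * \<bar>q - x s\<bar> \<le> K * \<eta>" using K(2) by (intro mult_left_mono)
      then have "\<bar>V (W s q) - v2\<bar> \<le> \<beta> + K * \<eta>" using K(1)[OF sT, of q "x s"] b2[of s] s by fastforce
      then show ?thesis using knn by (intro mult_right_mono)
    next
      case False
      then have "k2 q = 0" unfolding k2_def using deriv_step_eq_0 by (auto simp: not_le)
      then show ?thesis by simp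
    qed
    have eq: "\<psi>t s q + V (W s q) * \<psi>x s q = (V (W s q) - v1) * k1 q * step ((x s - q) / \<eta>) - (V (W s q) - v2) * k2 q * step ((q - y s) / \<eta>)" for q
    proof -
      have "(s1 * (- v1 / \<eta>)) * p2 + (s2 * (v2 / \<eta>)) * p1 + u * ((s1 * (1 / \<eta>)) * p2 + (s2 * (- 1 / \<eta>)) * p1)
        = (u - v1) * (s1 / \<eta>) * p2 - (u - v2) * (s2 / \<eta>) * p1" for s1 s2 p1 p2 u :: real
        using \<eta>(1) by (simp add: field_simps)
      then show ?thesis unfolding \<psi>t_def \<psi>x_def k1_def k2_def by blast
    qed
    have "\<bar>b s\<bar> \<le> integral {-A..A} (\<lambda>q. M * (\<beta> + K * \<eta>) * k1 q + M * (\<beta> + K * \<eta>) * k2 q)"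
      unfolding b_def
    proof (rule integral_norm_bound_integral[where 'a = real, unfolded real_norm_def])
      have sl: "continuous_on {-A..A} (f s)" if "continuous_on ({0..T} \<times> UNIV) (\<lambda>p. f (fst p) (snd p))" for f :: "real \<Rightarrow> real \<Rightarrow> real"
      proof -
        have "continuous_on {-A..A} (\<lambda>y. f (fst (s, y)) (snd (s, y)))"
          by (rule continuous_on_compose2[OF that, of _ "\<lambda>y. (s, y)"]) (use sT in \<open>auto intro!: continuous_intros\<close>)
        then show ?thesis by simp
      qed
      have "continuous_on {-A..A} (\<lambda>q. \<psi>t s q + V (W s q) * \<psi>x s q)"
        by (intro continuous_on_add continuous_on_mult sl[of \<psi>t] sl[of \<psi>x] sl[of "\<lambda>s q. V (W s q)"] V_W_continuous
            continuous_on_subset[OF ct] continuous_on_subset[OF cx'] subset_UNIV)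
      from absolutely_integrable_continuous_mult[OF bmeas_absolutely_integrable[OF r[OF sT]] this]
      show "(\<lambda>q. r s q * (\<psi>t s q + V (W s q) * \<psi>x s q)) integrable_on {-A..A}"
        using absolutely_integrable_on_def by blast
      show "(\<lambda>q. M * (\<beta> + K * \<eta>) * k1 q + M * (\<beta> + K * \<eta>) * k2 q) integrable_on {-A..A}"
        by (intro integrable_add integrable_on_mult_right k)
      fix q
      have rq: "\<bar>r s q\<bar> \<le> M" using r[OF sT] by (simp add: bmeas_def)
      have "\<bar>(V (W s q) - v1) * k1 q * step ((x s - q) / \<eta>)\<bar> = \<bar>V (W s q) - v1\<bar> * k1 q * step ((x s - q) / \<eta>)"
        using knn step_nonneg by (simp add: abs_mult)
      also have "\<dots> \<le> (\<beta> + K * \<eta>) * k1 q * 1"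
        by (rule mult_mono[OF edge1[of q] step_le_1])
          (use knn B0 step_nonneg in \<open>auto intro!: mult_nonneg_nonneg\<close>)
      finally have 1: "\<bar>(V (W s q) - v1) * k1 q * step ((x s - q) / \<eta>)\<bar> \<le> (\<beta> + K * \<eta>) * k1 q" by simp
      have "\<bar>(V (W s q) - v2) * k2 q * step ((q - y s) / \<eta>)\<bar> = \<bar>V (W s q) - v2\<bar> * k2 q * step ((q - y s) / \<eta>)"
        using knn step_nonneg by (simp add: abs_mult)
      also have "\<dots> \<le> (\<beta> + K * \<eta>) * k2 q * 1"
        by (rule mult_mono[OF edge2[of q] step_le_1])
          (use knn B0 step_nonneg in \<open>auto intro!: mult_nonneg_nonneg\<close>)
      finally have 2: "\<bar>(V (W s q) - v2) * k2 q * step ((q - y s) / \<eta>)\<bar> \<le> (\<beta> + K * \<eta>) * k2 q" by simp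
      have "\<bar>\<psi>t s q + V (W s q) * \<psi>x s q\<bar> \<le> (\<beta> + K * \<eta>) * k1 q + (\<beta> + K * \<eta>) * k2 q"
        unfolding eq using 1 2 by linarith
      then have "\<bar>r s q\<bar> * \<bar>\<psi>t s q + V (W s q) * \<psi>x s q\<bar> \<le> M * ((\<beta> + K * \<eta>) * k1 q + (\<beta> + K * \<eta>) * k2 q)"
        using rq M_nonneg by (intro mult_mono) auto
      then show "\<bar>r s q * (\<psi>t s q + V (W s q) * \<psi>x s q)\<bar> \<le> M * (\<beta> + K * \<eta>) * k1 q + M * (\<beta> + K * \<eta>) * k2 q"
        unfolding abs_mult by (simp add: algebra_simps)
    qed
    also have "\<dots> = M * (\<beta> + K * \<eta>) * integral {-A..A} k1 + M * (\<beta> + K * \<eta>) * integral {-A..A} k2"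
      by (simp only: Henstock_Kurzweil_Integration.integral_add[OF integrable_on_mult_right[OF k(1)] integrable_on_mult_right[OF k(3)]]
          Henstock_Kurzweil_Integration.integral_mult_right)
    also have "\<dots> \<le> M * (\<beta> + K * \<eta>) * 1 + M * (\<beta> + K * \<eta>) * 1"
      using k M_nonneg B0 by (intro add_mono mult_left_mono mult_nonneg_nonneg) auto
    finally show "\<bar>b s\<bar> \<le> 2 * M * (\<beta> + K * \<eta>)" by simp
  qed
  ultimately show "\<bar>a (r t2) t2 - a (r t1) t1\<bar> \<le> 2 * M * (\<beta> + K * \<eta>) * (t2 - t1)" by simp
qed

text \<open>
  The limit \<open>\<eta> \<rightarrow> 0\<close> of vanishing edge layers.
\<close>

lemma mass_change:
  fixes y0 v1 x0 v2 t1 t2 K \<beta> :: real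
  defines "y \<equiv> \<lambda>s. y0 + v1 * (s - t1)" and "x \<equiv> \<lambda>s. x0 + v2 * (s - t1)"
  assumes t: "0 \<le> t1" "t1 \<le> t2" "t2 < T"
    and K: "\<And>s q q'. s \<in> {0..T} \<Longrightarrow> \<bar>V (W s q) - V (W s q')\<bar> \<le> K * \<bar>q - q'\<bar>" "K \<ge> 0"
    and yx: "y0 \<le> x0" "y t2 \<le> x t2"
    and b1: "\<And>s. t1 \<le> s \<Longrightarrow> s \<le> t2 \<Longrightarrow> \<bar>V (W s (y s)) - v1\<bar> \<le> \<beta>"
    and b2: "\<And>s. t1 \<le> s \<Longrightarrow> s \<le> t2 \<Longrightarrow> \<bar>V (W s (x s)) - v2\<bar> \<le> \<beta>"
  shows "\<bar>integral {y t2..x t2} (r t2) - integral {y0..x0} (r t1)\<bar> \<le> 2 * M * \<beta> * (t2 - t1)"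
proof (rule le_if_le_add_small[where c = "2 * M * K * (t2 - t1) + 4 * M"])
  fix \<eta> :: real assume \<eta>: "0 < \<eta>" "\<eta> \<le> 1"
  define A where "A = \<bar>y0\<bar> + \<bar>v1\<bar> * T + \<bar>x0\<bar> + \<bar>v2\<bar> * T + 1"
  have "\<bar>t2 - t1\<bar> \<le> T" using t by auto
  then have "\<bar>v1\<bar> * \<bar>t2 - t1\<bar> \<le> \<bar>v1\<bar> * T" "\<bar>v2\<bar> * \<bar>t2 - t1\<bar> \<le> \<bar>v2\<bar> * T" by (auto intro: mult_left_mono)
  then have "\<bar>v1 * (t2 - t1)\<bar> \<le> \<bar>v1\<bar> * T" "\<bar>v2 * (t2 - t1)\<bar> \<le> \<bar>v2\<bar> * T" by (simp_all add: abs_mult)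
  moreover have "0 \<le> \<bar>v1\<bar> * T" "0 \<le> \<bar>v2\<bar> * T" using T by auto
  ultimately have bd: "-A \<le> y t2 - 1" "x t2 + 1 \<le> A" "-A \<le> y t1 - 1" "x t1 + 1 \<le> A"
    unfolding A_def y_def x_def by (simp_all, linarith+)
  have t12: "t1 \<in> {0..T}" "t2 \<in> {0..T}" using t by auto
  have y1: "y t1 = y0" "x t1 = x0" by (simp_all add: y_def x_def)
  note e2 = step_edge_approximation[OF r[OF t12(2)] yx(2) bd(1,2) \<eta>]
  note e1 = step_edge_approximation[OF r[OF t12(1)] _ bd(3,4) \<eta>, unfolded y1, OF yx(1)]
  have m: "\<bar>integral {-A..A} (\<lambda>q. r t2 q * (step ((q - y t2) / \<eta>) * step ((x t2 - q) / \<eta>)))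
      - integral {-A..A} (\<lambda>q. r t1 q * (step ((q - y t1) / \<eta>) * step ((x t1 - q) / \<eta>)))\<bar> \<le> 2 * M * (\<beta> + K * \<eta>) * (t2 - t1)"
    unfolding y_def x_def by (rule mass_change_aux(1)[OF t K b1[unfolded y_def] b2[unfolded x_def] \<eta> A_def])
  have "\<bar>integral {y t2..x t2} (r t2) - integral {y0..x0} (r t1)\<bar> \<le> 2 * M * (\<beta> + K * \<eta>) * (t2 - t1) + 2 * M * \<eta> + 2 * M * \<eta>"
    using e1 e2 m unfolding y1 by linarith
  then show "\<bar>integral {y t2..x t2} (r t2) - integral {y0..x0} (r t1)\<bar> \<le> 2 * M * \<beta> * (t2 - t1) + (2 * M * K * (t2 - t1) + 4 * M) * \<eta>"
    by (simp add: algebra_simps)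
qed

lemma initial_mass:
  assumes K: "\<And>s q q'. s \<in> {0..T} \<Longrightarrow> \<bar>V (W s q) - V (W s q')\<bar> \<le> K * \<bar>q - q'\<bar>" "K \<ge> 0"
    and yx: "y0 \<le> x0"
  shows "integral {y0..x0} (r 0) = integral {y0..x0} r0"
proof -
  have "\<bar>integral {y0..x0} (r 0) - integral {y0..x0} r0\<bar> \<le> 0"
  proof (rule le_if_le_add_small[where c = "4 * M"])
    fix \<eta> :: real assume \<eta>: "0 < \<eta>" "\<eta> \<le> 1"
    define A where "A = \<bar>y0\<bar> + \<bar>0\<bar> * T + \<bar>x0\<bar> + \<bar>0\<bar> * T + 1"
    have 0: "0 \<in> {0..T}" using T by simp
    have bd: "-A \<le> y0 - 1" "x0 + 1 \<le> A" unfolding A_def by simp_all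
    note e1 = step_edge_approximation[OF r[OF 0] yx bd \<eta>]
    note e2 = step_edge_approximation[OF r0 yx bd \<eta>]
    have "integral {-A..A} (\<lambda>q. r 0 q * (step ((q - (y0 + 0 * (0 - 0))) / \<eta>) * step (((x0 + 0 * (0 - 0)) - q) / \<eta>)))
      = integral {-A..A} (\<lambda>q. r0 q * (step ((q - (y0 + 0 * (0 - 0))) / \<eta>) * step (((x0 + 0 * (0 - 0)) - q) / \<eta>)))"
      by (rule mass_change_aux(2)[where ?t2.0 = 0 and \<beta> = "\<bar>V (W 0 y0)\<bar> + \<bar>V (W 0 x0)\<bar>", OF _ _ _ K _ _ \<eta> A_def])
        (use T in auto)
    then show "\<bar>integral {y0..x0} (r 0) - integral {y0..x0} r0\<bar> \<le> 0 + 4 * M * \<eta>"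
      using e1 e2 by simp
  qed
  then show ?thesis by simp
qed

end

section \<open>Transport of the averaged density along straight lines\<close>

text \<open>
  A Taylor estimate that needs only a Lipschitz derivative, as is available for \<open>V\<close> and \<open>G\<close>.
\<close>

lemma Lipschitz_derivative_remainder:
  fixes f f' :: "real \<Rightarrow> real"
  assumes f: "\<And>x. x \<in> {c..d} \<Longrightarrow> (f has_real_derivative f' x) (at x)"
    and lip: "\<And>x y. x \<in> {c..d} \<Longrightarrow> y \<in> {c..d} \<Longrightarrow> \<bar>f' x - f' y\<bar> \<le> L * \<bar>x - y\<bar>"
    and ab: "a \<in> {c..d}" "b \<in> {c..d}"
  shows "\<bar>f a - f b - f' b * (a - b)\<bar> \<le> L * (a - b)\<^sup>2"
proof -
  have "\<exists>z\<in>{c..d}. \<bar>z - b\<bar> \<le> \<bar>a - b\<bar> \<and> f a - f b = f' z * (a - b)"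
  proof (cases a b rule: linorder_cases)
    case less
    have "\<exists>z. a < z \<and> z < b \<and> f b - f a = (b - a) * f' z" using less ab by (intro MVT2 f) auto
    then obtain z where "a < z" "z < b" "f b - f a = (b - a) * f' z" by blast
    then show ?thesis using ab by (intro bexI[of _ z]) (auto simp: algebra_simps)
  next
    case greater
    have "\<exists>z. b < z \<and> z < a \<and> f a - f b = (a - b) * f' z" using greater ab by (intro MVT2 f) auto
    then obtain z where "b < z" "z < a" "f a - f b = (a - b) * f' z" by blast
    then show ?thesis using ab by (intro bexI[of _ z]) (auto simp: algebra_simps)
  qed (use ab in auto)
  then obtain z where z: "z \<in> {c..d}" "\<bar>z - b\<bar> \<le> \<bar>a - b\<bar>" "f a - f b = f' z * (a - b)" by blast
  have "f a - f b - f' b * (a - b) = (f' z - f' b) * (a - b)" using z(3) by (simp add: left_diff_distrib)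
  moreover have "\<bar>(f' z - f' b) * (a - b)\<bar> \<le> L * (a - b)\<^sup>2"
  proof (cases "a = b")
    case False
    have "0 \<le> L * \<bar>a - b\<bar>" using lip[OF ab] by (meson abs_ge_zero order_trans)
    then have "0 \<le> L" using False by (simp add: zero_le_mult_iff)
    have "\<bar>f' z - f' b\<bar> \<le> L * \<bar>z - b\<bar>" by (rule lip[OF z(1) ab(2)])
    also have "\<dots> \<le> L * \<bar>a - b\<bar>" using z(2) \<open>0 \<le> L\<close> by (rule mult_left_mono)
    finally have "\<bar>f' z - f' b\<bar> * \<bar>a - b\<bar> \<le> L * \<bar>a - b\<bar> * \<bar>a - b\<bar>" by (rule mult_right_mono) simp
    then show ?thesis by (simp add: abs_mult power2_eq_square mult.assoc)
  qed simp
  ultimately show ?thesis by simp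
qed

lemma Lipschitz_of_bounded_derivative:
  fixes f f' :: "real \<Rightarrow> real"
  assumes f: "\<And>x. x \<in> {c..d} \<Longrightarrow> (f has_real_derivative f' x) (at x)"
    and bd: "\<And>x. x \<in> {c..d} \<Longrightarrow> \<bar>f' x\<bar> \<le> D"
    and ab: "a \<in> {c..d}" "b \<in> {c..d}"
  shows "\<bar>f a - f b\<bar> \<le> D * \<bar>a - b\<bar>"
proof -
  have aux: "\<bar>f v - f u\<bar> \<le> D * (v - u)" if "u < v" "u \<in> {c..d}" "v \<in> {c..d}" for u v
  proof -
    have "\<exists>z. u < z \<and> z < v \<and> f v - f u = (v - u) * f' z" using that by (intro MVT2 f) auto
    then obtain z where "u < z" "z < v" "f v - f u = (v - u) * f' z" by blast
    then show ?thesis using bd[of z] that by (simp add: abs_mult mult.commute mult_right_mono)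
  qed
  show ?thesis using aux[of a b] aux[of b a] ab
    by (cases a b rule: linorder_cases) (auto simp: abs_minus_commute)
qed

text \<open>
  The velocity enters only through its values on \<open>[-M,M]\<close>, which contains the range of \<open>W\<close>. The constants \<open>B\<close>, \<open>D\<close>
  and \<open>L\<close> bound \<open>V\<close>, \<open>V'\<close> and the Lipschitz constant of \<open>V'\<close> there.
\<close>

locale regular_flow = nonlocal_flow +
  fixes D B L :: real
  assumes V_deriv: "\<And>x. (V has_real_derivative deriv V x) (at x)"
    and V'_nonpos: "\<And>x. deriv V x \<le> 0"
    and V'_bound: "\<And>x. x \<in> {-M..M} \<Longrightarrow> \<bar>deriv V x\<bar> \<le> D"
    and V_bound: "\<And>x. x \<in> {-M..M} \<Longrightarrow> \<bar>V x\<bar> \<le> B"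
    and V'_Lipschitz: "\<And>x y. x \<in> {-M..M} \<Longrightarrow> y \<in> {-M..M} \<Longrightarrow> \<bar>deriv V x - deriv V y\<bar> \<le> L * \<bar>x - y\<bar>"
    and L_nonneg: "0 \<le> L"
begin

text \<open>
  \<open>G\<close> is the primitive of \<open>g\<close>, obtained from integration by parts. \<open>Z\<close> is the derivative of the average of \<open>U\<close> and plays
  the role of the average of \<open>\<partial>\<^sub>x U\<close>. \<open>Kx\<close> and \<open>Kt\<close> are Lipschitz constants of \<open>W\<close> in space and time, \<open>Lg\<close> is one of
  \<open>g\<close>, \<open>BG\<close> bounds \<open>U\<close>, and \<open>Cm\<close> is the constant of the transport of mass.
\<close>

definition G :: "real \<Rightarrow> real" where "G \<xi> = \<xi> * V \<xi> - primitive V \<xi>"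
definition g :: "real \<Rightarrow> real" where "g \<xi> = deriv V \<xi> * \<xi>"
definition U :: "real \<Rightarrow> real \<Rightarrow> real" where "U t x = G (W t x)"
definition Z :: "real \<Rightarrow> real \<Rightarrow> real" where "Z t x = (expavg \<epsilon> (U t) x - U t x) / \<epsilon>"
definition Kx :: real where "Kx = 2 * M / \<epsilon>"
definition Kt :: real where "Kt = 2 * M * B / \<epsilon>"
definition Lg :: real where "Lg = L * M + D"
definition BG :: real where "BG = D * M * M + \<bar>G 0\<bar>"
definition Cm :: real where "Cm = 2 * M * (D * (Kt + Kx * B))"

lemma zero_mem: "0 \<in> {-M..M}" using M_nonneg by simp
lemma D_nonneg: "0 \<le> D" using V'_bound[OF zero_mem] by linarith
lemma B_nonneg: "0 \<le> B" using V_bound[OF zero_mem] by linarith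
lemma Kx_nonneg: "0 \<le> Kx" using M_nonneg eps by (simp add: Kx_def)
lemma Kt_nonneg: "0 \<le> Kt" using M_nonneg B_nonneg eps by (simp add: Kt_def)
lemma Lg_nonneg: "0 \<le> Lg" using M_nonneg D_nonneg L_nonneg by (simp add: Lg_def)
lemma Cm_nonneg: "0 \<le> Cm" using M_nonneg B_nonneg D_nonneg Kt_nonneg Kx_nonneg by (simp add: Cm_def)

lemma G_deriv: "(G has_real_derivative g \<xi>) (at \<xi>)"
proof -
  have "((\<lambda>\<xi>. \<xi> * V \<xi> - primitive V \<xi>) has_real_derivative (1 * V \<xi> + deriv V \<xi> * \<xi>) - V \<xi>) (at \<xi>)"
    by (intro DERIV_diff DERIV_mult V_deriv DERIV_primitive V_cont DERIV_ident)
  then show ?thesis by (simp add: G_def[abs_def] g_def)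
qed

lemma g_bound: "\<xi> \<in> {-M..M} \<Longrightarrow> \<bar>g \<xi>\<bar> \<le> D * M"
  unfolding g_def abs_mult using V'_bound[of \<xi>] D_nonneg by (intro mult_mono) auto

lemma g_Lipschitz: assumes "x \<in> {-M..M}" "y \<in> {-M..M}" shows "\<bar>g x - g y\<bar> \<le> Lg * \<bar>x - y\<bar>"
proof -
  have "g x - g y = (deriv V x - deriv V y) * x + deriv V y * (x - y)" by (simp add: g_def algebra_simps)
  moreover have "\<bar>(deriv V x - deriv V y) * x\<bar> \<le> (L * \<bar>x - y\<bar>) * M"
    unfolding abs_mult using V'_Lipschitz[OF assms] assms L_nonneg by (intro mult_mono) auto
  moreover have "\<bar>deriv V y * (x - y)\<bar> \<le> D * \<bar>x - y\<bar>"
    unfolding abs_mult using V'_bound[OF assms(2)] by (intro mult_right_mono) auto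
  ultimately show ?thesis by (simp add: Lg_def algebra_simps)
qed

lemma V_Lipschitz: "x \<in> {-M..M} \<Longrightarrow> y \<in> {-M..M} \<Longrightarrow> \<bar>V x - V y\<bar> \<le> D * \<bar>x - y\<bar>"
  by (rule Lipschitz_of_bounded_derivative[OF V_deriv V'_bound])

lemma V_remainder: "x \<in> {-M..M} \<Longrightarrow> y \<in> {-M..M} \<Longrightarrow> \<bar>V x - V y - deriv V y * (x - y)\<bar> \<le> L * (x - y)\<^sup>2"
  by (rule Lipschitz_derivative_remainder[OF V_deriv V'_Lipschitz])

lemma G_Lipschitz: "x \<in> {-M..M} \<Longrightarrow> y \<in> {-M..M} \<Longrightarrow> \<bar>G x - G y\<bar> \<le> D * M * \<bar>x - y\<bar>"
  by (rule Lipschitz_of_bounded_derivative[OF G_deriv g_bound])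

lemma G_remainder: "x \<in> {-M..M} \<Longrightarrow> y \<in> {-M..M} \<Longrightarrow> \<bar>G x - G y - g y * (x - y)\<bar> \<le> Lg * (x - y)\<^sup>2"
  by (rule Lipschitz_derivative_remainder[OF G_deriv g_Lipschitz])

lemma G_bound: assumes "x \<in> {-M..M}" shows "\<bar>G x\<bar> \<le> BG"
proof -
  have "D * M * \<bar>x - 0\<bar> \<le> D * M * M" using assms D_nonneg M_nonneg by (intro mult_left_mono) auto
  then show ?thesis using G_Lipschitz[OF assms zero_mem] unfolding BG_def by linarith
qed

lemma W_mem: "t \<in> {0..T} \<Longrightarrow> W t x \<in> {-M..M}"
  using expavg_abs_le[OF eps r, of t x] by (simp add: abs_le_iff)

lemma W_abs_le: "t \<in> {0..T} \<Longrightarrow> \<bar>W t x\<bar> \<le> M"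
  by (rule expavg_abs_le[OF eps r])

lemma W_Lipschitz: "t \<in> {0..T} \<Longrightarrow> \<bar>W t x - W t y\<bar> \<le> Kx * \<bar>x - y\<bar>"
  unfolding Kx_def by (rule expavg_Lipschitz[OF eps r])

lemma VW_Lipschitz:
  assumes "t \<in> {0..T}" shows "\<bar>V (W t x) - V (W t y)\<bar> \<le> D * Kx * \<bar>x - y\<bar>"
proof -
  have "\<bar>V (W t x) - V (W t y)\<bar> \<le> D * \<bar>W t x - W t y\<bar>" by (rule V_Lipschitz[OF W_mem W_mem]) (rule assms)+
  also have "\<dots> \<le> D * (Kx * \<bar>x - y\<bar>)" by (rule mult_left_mono[OF W_Lipschitz[OF assms] D_nonneg])
  finally show ?thesis by simp
qed

lemma DKx_nonneg: "0 \<le> D * Kx" using D_nonneg Kx_nonneg by simp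

lemma W_increment:
  assumes "t \<in> {0..T}" "a \<le> b"
  shows "W t b - W t a = 1 / \<epsilon> * (integral {a..b} (W t) - integral {a..b} (r t))"
  by (rule expavg_increment(2)[OF eps r[OF assms(1)] assms(2)])

lemma W_continuous: "t \<in> {0..T} \<Longrightarrow> continuous_on S (W t)"
  by (rule expavg_continuous[OF eps r])

lemma mass_time_Lipschitz:
  assumes "0 \<le> s" "s \<le> t" "t < T" "y \<le> x"
  shows "\<bar>integral {y..x} (r t) - integral {y..x} (r s)\<bar> \<le> 2 * M * B * (t - s)"
proof -
  have "\<bar>V (W \<sigma> q) - 0\<bar> \<le> B" if "s \<le> \<sigma>" "\<sigma> \<le> t" for \<sigma> q
    using V_bound[OF W_mem[of \<sigma> q]] that assms by auto
  then show ?thesis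
    using mass_change[OF assms(1-3) VW_Lipschitz DKx_nonneg, of y x 0 0 B] assms(4) by simp
qed

text \<open>
  Masses are Lipschitz in time with a constant independent of the interval. This is an additive error in \<open>J\<close>, so the
  comparison lemma transfers it to \<open>W\<close>.
\<close>

lemma W_time_Lipschitz:
  assumes st: "0 \<le> s" "s \<le> t" "t < T"
  shows "\<bar>W t x - W s x\<bar> \<le> Kt * (t - s)"
proof -
  have tT: "t \<in> {0..T}" and sT: "s \<in> {0..T}" using st by auto
  have wi: "W \<tau> integrable_on {a..b}" if "\<tau> \<in> {0..T}" for \<tau> a b
    by (rule integrable_continuous_interval[OF W_continuous[OF that]])
  have ri: "r \<tau> integrable_on {a..b}" if "\<tau> \<in> {0..T}" for \<tau> a b by (rule bmeas_integrable[OF r[OF that]])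
  have key: "W p x - W q x \<le> 0 + 2 * M * B * (t - s) / \<epsilon>"
    if pq: "p \<in> {0..T}" "q \<in> {0..T}" "\<And>a b. a \<le> b \<Longrightarrow> \<bar>integral {a..b} (r p) - integral {a..b} (r q)\<bar> \<le> 2 * M * B * (t - s)" for p q
  proof (rule bounded_solution_le[OF eps, where f = "\<lambda>x. W p x - W q x" and J = "\<lambda>x. primitive (r p) x - primitive (r q) x" and B = "2 * M"])
    show "continuous_on UNIV (\<lambda>x. W p x - W q x)" by (intro continuous_intros W_continuous pq)
    show "W p x - W q x \<le> 2 * M" for x using W_mem[OF pq(1), of x] W_mem[OF pq(2), of x] by auto
    fix y assume xy: "x \<le> y"
    have J: "primitive (r p) y - primitive (r q) y - (primitive (r p) x - primitive (r q) x) = integral {x..y} (r p) - integral {x..y} (r q)"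
      using primitive_increment[OF ri[OF pq(1)] xy] primitive_increment[OF ri[OF pq(2)] xy] by linarith
    show "(W p y - W q y) - (W p x - W q x) = 1 / \<epsilon> * (integral {x..y} (\<lambda>x. W p x - W q x) -
        (primitive (r p) y - primitive (r q) y - (primitive (r p) x - primitive (r q) x)))"
      unfolding J Henstock_Kurzweil_Integration.integral_diff[OF wi[OF pq(1)] wi[OF pq(2)]]
      using W_increment[OF pq(1) xy] W_increment[OF pq(2) xy] by (simp add: algebra_simps)
    show "primitive (r p) y - primitive (r q) y - (primitive (r p) x - primitive (r q) x) \<le> 0 * (y - x) + 2 * M * B * (t - s)"
      unfolding J using pq(3)[OF xy] by linarith
  qed
  have "W t x - W s x \<le> 2 * M * B * (t - s) / \<epsilon>"
    using key[OF tT sT mass_time_Lipschitz[OF st]] by simp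
  moreover have "W s x - W t x \<le> 2 * M * B * (t - s) / \<epsilon>"
    using key[OF sT tT] mass_time_Lipschitz[OF st] by (simp add: abs_minus_commute)
  ultimately show ?thesis by (simp add: Kt_def abs_le_iff)
qed

text \<open>
  The foot \<open>x - h V(W(t,x))\<close> of the backward line depends monotonically on \<open>x\<close> once \<open>h\<close> is small.
\<close>

lemma foot_Lipschitz:
  assumes t: "t \<in> {0..T}" and h: "0 \<le> h" "h * (D * Kx) \<le> 1" and "y \<le> x"
  shows "y - h * V (W t y) \<le> x - h * V (W t x)"
    and "(x - h * V (W t x)) - (y - h * V (W t y)) \<le> 2 * (x - y)"
proof -
  have "\<bar>h * (V (W t x) - V (W t y))\<bar> \<le> h * (D * Kx * \<bar>x - y\<bar>)"
    unfolding abs_mult using h by (intro mult_mono VW_Lipschitz[OF t]) auto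
  also have "\<dots> = (h * (D * Kx)) * (x - y)" using \<open>y \<le> x\<close> by simp
  also have "\<dots> \<le> 1 * (x - y)" using h \<open>y \<le> x\<close> by (intro mult_right_mono) auto
  finally have "\<bar>h * V (W t x) - h * V (W t y)\<bar> \<le> x - y" by (simp add: right_diff_distrib)
  note bd = this
  show "y - h * V (W t y) \<le> x - h * V (W t x)" using bd by linarith
  have "(x - h * V (W t x)) - (y - h * V (W t y)) = (x - y) + - (h * V (W t x) - h * V (W t y))" by simp
  also have "\<dots> \<le> (x - y) + (x - y)" by (rule add_left_mono[OF abs_le_D2[OF bd]])
  finally show "(x - h * V (W t x)) - (y - h * V (W t y)) \<le> 2 * (x - y)" by simp
qed

text \<open>
  Following both end points backwards with their velocities at time \<open>t\<close>. On the way \<open>V(W)\<close> deviates from these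
  velocities by \<open>O(h)\<close>, because \<open>W\<close> is Lipschitz in both variables, so the flux through the edges is \<open>O(h)\<close> and the
  change of mass is \<open>O(h\<^sup>2)\<close>.
\<close>

lemma mass_backward:
  assumes st: "0 \<le> s" "s \<le> t" "t < T" and yx: "y \<le> x"
    and YX: "y - (t - s) * V (W t y) \<le> x - (t - s) * V (W t x)"
  shows "\<bar>integral {y..x} (r t) - integral {y - (t - s) * V (W t y)..x - (t - s) * V (W t x)} (r s)\<bar> \<le> Cm * (t - s)\<^sup>2"
proof -
  define h where "h = t - s"
  have tT: "t \<in> {0..T}" using st by auto
  have vel: "\<bar>V (W \<sigma> ((q - h * V (W t q)) + V (W t q) * (\<sigma> - s))) - V (W t q)\<bar> \<le> D * (Kt + Kx * B) * h"
    if \<sigma>: "s \<le> \<sigma>" "\<sigma> \<le> t" for \<sigma> q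
  proof -
    define p where "p = (q - h * V (W t q)) + V (W t q) * (\<sigma> - s)"
    have \<sigma>T: "\<sigma> \<in> {0..T}" using \<sigma> st by auto
    have "p - q = - (V (W t q) * (t - \<sigma>))" by (simp add: p_def h_def algebra_simps)
    then have "\<bar>p - q\<bar> = \<bar>V (W t q)\<bar> * (t - \<sigma>)" using \<sigma> by (simp add: abs_mult)
    also have "\<dots> \<le> B * h" using V_bound[OF W_mem[OF tT]] \<sigma> B_nonneg by (intro mult_mono) (auto simp: h_def)
    finally have pq: "\<bar>p - q\<bar> \<le> B * h" .
    have "\<bar>W \<sigma> p - W \<sigma> q\<bar> \<le> Kx * \<bar>p - q\<bar>" by (rule W_Lipschitz[OF \<sigma>T])
    also have "\<dots> \<le> Kx * (B * h)" by (rule mult_left_mono[OF pq Kx_nonneg])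
    finally have 1: "\<bar>W \<sigma> p - W \<sigma> q\<bar> \<le> Kx * (B * h)" .
    have "\<bar>W t q - W \<sigma> q\<bar> \<le> Kt * (t - \<sigma>)" by (rule W_time_Lipschitz) (use \<sigma> st in auto)
    also have "\<dots> \<le> Kt * h" using \<sigma> Kt_nonneg by (intro mult_left_mono) (auto simp: h_def)
    finally have "\<bar>W \<sigma> p - W t q\<bar> \<le> (Kt + Kx * B) * h" using 1 by (simp add: algebra_simps abs_le_iff)
    then have "D * \<bar>W \<sigma> p - W t q\<bar> \<le> D * ((Kt + Kx * B) * h)" using D_nonneg by (rule mult_left_mono)
    then show ?thesis using V_Lipschitz[OF W_mem[OF \<sigma>T, of p] W_mem[OF tT, of q]] unfolding p_def by simp
  qed
  have "\<bar>integral {y - h * V (W t y) + V (W t y) * (t - s)..x - h * V (W t x) + V (W t x) * (t - s)} (r t)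
     - integral {y - h * V (W t y)..x - h * V (W t x)} (r s)\<bar> \<le> 2 * M * (D * (Kt + Kx * B) * h) * (t - s)"
    by (rule mass_change[OF st VW_Lipschitz DKx_nonneg _ _ vel vel]) (use YX yx in \<open>auto simp: h_def algebra_simps\<close>)
  moreover have "q - h * V (W t q) + V (W t q) * (t - s) = q" for q by (simp add: h_def)
  ultimately show ?thesis by (simp add: h_def Cm_def power2_eq_square mult_ac)
qed

lemma U_bmeas: "t \<in> {0..T} \<Longrightarrow> bmeas BG (U t)"
  unfolding bmeas_def
proof (intro conjI allI)
  assume t: "t \<in> {0..T}"
  have "continuous_on UNIV G" using G_deriv by (meson DERIV_continuous_on has_field_derivative_at_within)
  then have "continuous_on UNIV (U t)"
    unfolding U_def by (rule continuous_on_compose2[OF _ W_continuous[OF t]]) auto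
  then show "U t \<in> borel_measurable lebesgue" by (rule continuous_imp_lebesgue_measurable)
  show "\<bar>U t x\<bar> \<le> BG" for x unfolding U_def by (rule G_bound[OF W_mem[OF t]])
qed

lemma U_continuous: assumes t: "t \<in> {0..T}" shows "continuous_on S (U t)"
proof -
  have "continuous_on UNIV G" using G_deriv by (meson DERIV_continuous_on has_field_derivative_at_within)
  then show ?thesis unfolding U_def by (rule continuous_on_compose2[OF _ W_continuous[OF t]]) auto
qed

lemma Z_continuous: "t \<in> {0..T} \<Longrightarrow> continuous_on S (Z t)"
  unfolding Z_def using eps by (intro continuous_intros expavg_continuous[OF eps U_bmeas] U_continuous) auto

lemma Z_bound: assumes "t \<in> {0..T}" shows "\<bar>Z t x\<bar> \<le> 2 * BG / \<epsilon>"
proof -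
  have "\<bar>expavg \<epsilon> (U t) x\<bar> \<le> BG" by (rule expavg_abs_le[OF eps U_bmeas[OF assms]])
  moreover have "\<bar>U t x\<bar> \<le> BG" using U_bmeas[OF assms] by (simp add: bmeas_def)
  ultimately have "\<bar>expavg \<epsilon> (U t) x - U t x\<bar> \<le> 2 * BG" by linarith
  then show ?thesis using eps by (simp add: Z_def divide_right_mono)
qed

lemma Z_increment:
  assumes t: "t \<in> {0..T}" and "a \<le> b"
  shows "Z t b - Z t a = 1 / \<epsilon> * (integral {a..b} (Z t) - (U t b - U t a))"
proof -
  note i = expavg_increment[OF eps U_bmeas[OF t] \<open>a \<le> b\<close>]
  have "integral {a..b} (Z t) = integral {a..b} (\<lambda>x. (expavg \<epsilon> (U t) x - U t x) / \<epsilon>)"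
    by (rule arg_cong[where f = "integral {a..b}"]) (simp add: fun_eq_iff Z_def)
  also have "\<dots> = (integral {a..b} (expavg \<epsilon> (U t)) - integral {a..b} (U t)) / \<epsilon>"
    using Henstock_Kurzweil_Integration.integral_diff[OF i(1) bmeas_integrable[OF U_bmeas[OF t]]]
    by (simp only: integral_divide)
  also have "\<dots> = expavg \<epsilon> (U t) b - expavg \<epsilon> (U t) a" using i(2) by simp
  finally have *: "integral {a..b} (Z t) = expavg \<epsilon> (U t) b - expavg \<epsilon> (U t) a" .
  show ?thesis unfolding * by (simp add: Z_def diff_divide_distrib)
qed

text \<open>
  Substituting \<open>p = \<xi>(q)\<close> in the integral of \<open>W(s,\<cdot>)\<close> produces the factor \<open>\<xi>' = 1 - h \<partial>\<^sub>x V(W)\<close>. Up to \<open>O(h)\<close>,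
  \<open>W(s,\<xi>(q))\<close> is \<open>W(t,q)\<close>, and \<open>W \<partial>\<^sub>x V(W) = \<partial>\<^sub>x U\<close>; this is the origin of the increment of \<open>U\<close>. In the proof the
  defect \<open>F\<close> is compared on short intervals with its first order part, the error being quadratic.
\<close>

lemma foot_change_of_variables:
  assumes st: "0 \<le> s" "s \<le> t" "t < T" and h: "(t - s) * (D * Kx) \<le> 1" and yx: "y \<le> x"
  defines "\<xi> \<equiv> \<lambda>q. q - (t - s) * V (W t q)"
  shows "\<bar>integral {\<xi> y..\<xi> x} (W s) - integral {y..x} (\<lambda>q. W s (\<xi> q)) + (t - s) * (U t x - U t y)\<bar>
    \<le> D * Kx * (Kt + Kx * B) * (t - s)\<^sup>2 * (x - y)"
proof -
  define h where "h = t - s"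
  have h0: "0 \<le> h" using st by (simp add: h_def)
  have tT: "t \<in> {0..T}" and sT: "s \<in> {0..T}" using st by auto
  have \<xi>: "\<xi> q = q - h * V (W t q)" for q by (simp add: \<xi>_def h_def)
  have mono: "\<xi> u \<le> \<xi> v" and len: "\<xi> v - \<xi> u \<le> 2 * (v - u)" if "u \<le> v" for u v
    unfolding \<xi> using foot_Lipschitz[OF tT h0 _ that] h by (simp_all add: h_def)
  have cVW: "continuous_on S (\<lambda>q. V (W t q))" for S
    by (rule continuous_on_compose2[OF V_cont W_continuous[OF tT]]) simp
  have c\<xi>: "continuous_on S \<xi>" for S unfolding \<xi>_def by (intro continuous_intros cVW)
  have cW\<xi>: "continuous_on S (\<lambda>q. W s (\<xi> q))" for S
    by (rule continuous_on_compose2[OF W_continuous[OF sT, of UNIV] c\<xi>]) simp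
  have i1: "W s integrable_on {a..b}" for a b by (rule integrable_continuous_interval[OF W_continuous[OF sT]])
  have i2: "(\<lambda>q. W s (\<xi> q)) integrable_on {a..b}" for a b by (rule integrable_continuous_interval[OF cW\<xi>])
  define F where "F q = primitive (W s) (\<xi> q) - primitive (\<lambda>q. W s (\<xi> q)) q + h * U t q" for q
  have F_inc: "F v - F u = integral {\<xi> u..\<xi> v} (W s) - integral {u..v} (\<lambda>q. W s (\<xi> q)) + h * (U t v - U t u)" if "u \<le> v" for u v
    using primitive_increment[OF i1 mono[OF that]] primitive_increment[OF i2 that] by (simp add: F_def algebra_simps)
  define C where "C = 4 * Kx + 2 * Kx + h * M * (L * Kx\<^sup>2) + h * (Lg * Kx\<^sup>2)"
  have "\<bar>F x - F y\<bar> \<le> D * Kx * (Kt + Kx * B) * h\<^sup>2 * (x - y)"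
  proof (rule Lipschitz_of_quadratic_error[OF yx, where C = C])
    fix u v assume uv: "y \<le> u" "u \<le> v" "v \<le> x"
    define d where "d = v - u"
    have d0: "0 \<le> d" using uv by (simp add: d_def)
    define w where "w = W s (\<xi> u)"
    define \<Delta>W where "\<Delta>W = W t v - W t u"
    have w_le: "\<bar>w\<bar> \<le> M" unfolding w_def by (rule W_abs_le[OF sT])
    have \<Delta>W: "\<bar>\<Delta>W\<bar> \<le> Kx * d" using W_Lipschitz[OF tT, of v u] d0 by (simp add: \<Delta>W_def d_def)
    have sq: "\<Delta>W\<^sup>2 \<le> Kx\<^sup>2 * d\<^sup>2"
      using power_mono[OF \<Delta>W abs_ge_zero, of 2] by (simp add: power_mult_distrib)
    define e1 where "e1 = integral {\<xi> u..\<xi> v} (W s) - w * (\<xi> v - \<xi> u)"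
    define e2 where "e2 = integral {u..v} (\<lambda>q. W s (\<xi> q)) - w * d"
    define e3 where "e3 = V (W t v) - V (W t u) - deriv V (W t u) * \<Delta>W"
    define e4 where "e4 = U t v - U t u - g (W t u) * \<Delta>W"
    have e1: "\<bar>e1\<bar> \<le> 4 * Kx * d\<^sup>2"
    proof -
      have "e1 = integral {\<xi> u..\<xi> v} (\<lambda>p. W s p - w)"
        using Henstock_Kurzweil_Integration.integral_diff[OF i1[of "\<xi> u" "\<xi> v"] integrable_const_ivl[of w]] mono[OF uv(2)] by (simp add: e1_def mult.commute)
      moreover have "\<bar>integral {\<xi> u..\<xi> v} (\<lambda>p. W s p - w)\<bar> \<le> (Kx * (2 * d)) * (\<xi> v - \<xi> u)"
      proof (rule abs_integral_le[OF _ mono[OF uv(2)]])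
        show "(\<lambda>p. W s p - w) integrable_on {\<xi> u..\<xi> v}" by (intro integrable_diff i1 integrable_const_ivl)
        fix p assume p: "p \<in> {\<xi> u..\<xi> v}"
        have "\<bar>W s p - w\<bar> \<le> Kx * \<bar>p - \<xi> u\<bar>" unfolding w_def by (rule W_Lipschitz[OF sT])
        also have "\<dots> \<le> Kx * (2 * d)" using p len[OF uv(2)] Kx_nonneg by (intro mult_left_mono) (auto simp: d_def)
        finally show "\<bar>W s p - w\<bar> \<le> Kx * (2 * d)" .
      qed
      moreover have "(Kx * (2 * d)) * (\<xi> v - \<xi> u) \<le> (Kx * (2 * d)) * (2 * d)"
        using len[OF uv(2)] Kx_nonneg d0 by (intro mult_left_mono) (auto simp: d_def)
      moreover have "(Kx * (2 * d)) * (2 * d) = 4 * Kx * d\<^sup>2" by (simp add: power2_eq_square)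
      ultimately show ?thesis by linarith
    qed
    have e2: "\<bar>e2\<bar> \<le> 2 * Kx * d\<^sup>2"
    proof -
      have "e2 = integral {u..v} (\<lambda>q. W s (\<xi> q) - w)"
        using Henstock_Kurzweil_Integration.integral_diff[OF i2[of u v] integrable_const_ivl[of w]] uv(2) by (simp add: e2_def d_def mult.commute)
      moreover have "\<bar>integral {u..v} (\<lambda>q. W s (\<xi> q) - w)\<bar> \<le> (Kx * (2 * d)) * (v - u)"
      proof (rule abs_integral_le[OF _ uv(2)])
        show "(\<lambda>q. W s (\<xi> q) - w) integrable_on {u..v}" by (intro integrable_diff i2 integrable_const_ivl)
        fix q assume q: "q \<in> {u..v}"
        have "\<bar>W s (\<xi> q) - w\<bar> \<le> Kx * \<bar>\<xi> q - \<xi> u\<bar>" unfolding w_def by (rule W_Lipschitz[OF sT])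
        also have "\<dots> \<le> Kx * (2 * d)" using q len[of u q] mono[of u q] Kx_nonneg by (intro mult_left_mono) (auto simp: d_def)
        finally show "\<bar>W s (\<xi> q) - w\<bar> \<le> Kx * (2 * d)" .
      qed
      moreover have "(Kx * (2 * d)) * (v - u) = 2 * Kx * d\<^sup>2" by (simp add: d_def[symmetric] power2_eq_square)
      ultimately show ?thesis by linarith
    qed
    have e3: "\<bar>e3\<bar> \<le> L * Kx\<^sup>2 * d\<^sup>2"
    proof -
      have "\<bar>e3\<bar> \<le> L * \<Delta>W\<^sup>2" unfolding e3_def \<Delta>W_def by (rule V_remainder[OF W_mem[OF tT] W_mem[OF tT]])
      also have "\<dots> \<le> L * (Kx\<^sup>2 * d\<^sup>2)" by (rule mult_left_mono[OF sq L_nonneg])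
      finally show ?thesis by (simp add: mult.assoc)
    qed
    have e4: "\<bar>e4\<bar> \<le> Lg * Kx\<^sup>2 * d\<^sup>2"
    proof -
      have "\<bar>e4\<bar> \<le> Lg * \<Delta>W\<^sup>2" unfolding e4_def \<Delta>W_def U_def by (rule G_remainder[OF W_mem[OF tT] W_mem[OF tT]])
      also have "\<dots> \<le> Lg * (Kx\<^sup>2 * d\<^sup>2)" by (rule mult_left_mono[OF sq Lg_nonneg])
      finally show ?thesis by (simp add: mult.assoc)
    qed
    have \<xi>_inc: "\<xi> v - \<xi> u = d - h * (deriv V (W t u) * \<Delta>W + e3)"
      by (simp add: \<xi> d_def e3_def algebra_simps)
    have "F v - F u = (w * (\<xi> v - \<xi> u) + e1) - (w * d + e2) + h * (g (W t u) * \<Delta>W + e4)"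
      unfolding F_inc[OF uv(2)] by (simp add: e1_def e2_def e4_def)
    also have "\<dots> = h * deriv V (W t u) * \<Delta>W * (W t u - w) + (e1 - e2 - h * w * e3 + h * e4)"
      unfolding \<xi>_inc g_def by (simp add: algebra_simps)
    finally have F_eq: "F v - F u = h * deriv V (W t u) * \<Delta>W * (W t u - w) + (e1 - e2 - h * w * e3 + h * e4)" .
    have main: "\<bar>h * deriv V (W t u) * \<Delta>W * (W t u - w)\<bar> \<le> h * D * (Kx * d) * ((Kt + Kx * B) * h)"
    proof -
      have "\<bar>W t u - W s u\<bar> \<le> Kt * h" using W_time_Lipschitz[OF st] by (simp add: h_def)
      moreover have "\<bar>W s u - w\<bar> \<le> Kx * (B * h)"
      proof -
        have "\<bar>W s u - w\<bar> \<le> Kx * \<bar>u - \<xi> u\<bar>" unfolding w_def by (rule W_Lipschitz[OF sT])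
        also have "\<bar>u - \<xi> u\<bar> = \<bar>V (W t u)\<bar> * h" using h0 by (simp add: \<xi> abs_mult)
        also have "Kx * (\<bar>V (W t u)\<bar> * h) \<le> Kx * (B * h)"
          using V_bound[OF W_mem[OF tT]] h0 Kx_nonneg by (intro mult_left_mono mult_right_mono) auto
        finally show ?thesis .
      qed
      ultimately have 1: "\<bar>W t u - w\<bar> \<le> (Kt + Kx * B) * h" by (simp add: algebra_simps abs_le_iff)
      show ?thesis
        unfolding abs_mult
        by (intro mult_mono 1 \<Delta>W V'_bound[OF W_mem[OF tT]] mult_nonneg_nonneg abs_ge_zero)
          (use h0 D_nonneg Kx_nonneg Kt_nonneg B_nonneg d0 in auto)
    qed
    have "\<bar>h * w * e3\<bar> \<le> h * M * (L * Kx\<^sup>2 * d\<^sup>2)"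
      unfolding abs_mult by (intro mult_mono w_le e3 mult_nonneg_nonneg abs_ge_zero) (use h0 M_nonneg in auto)
    moreover have "\<bar>h * e4\<bar> \<le> h * (Lg * Kx\<^sup>2 * d\<^sup>2)"
      unfolding abs_mult by (intro mult_mono e4) (use h0 in auto)
    moreover have "C * d\<^sup>2 = 4 * Kx * d\<^sup>2 + 2 * Kx * d\<^sup>2 + h * M * (L * Kx\<^sup>2 * d\<^sup>2) + h * (Lg * Kx\<^sup>2 * d\<^sup>2)"
      by (simp add: C_def algebra_simps)
    ultimately have rest: "\<bar>e1 - e2 - h * w * e3 + h * e4\<bar> \<le> C * d\<^sup>2" using e1 e2 by linarith
    have "h * D * (Kx * d) * ((Kt + Kx * B) * h) = D * Kx * (Kt + Kx * B) * h\<^sup>2 * d" by (simp add: power2_eq_square algebra_simps)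
    then show "\<bar>F v - F u\<bar> \<le> D * Kx * (Kt + Kx * B) * h\<^sup>2 * (v - u) + C * (v - u)\<^sup>2"
      using main rest unfolding F_eq d_def by linarith
  qed
  then show ?thesis unfolding F_inc[OF yx] by (simp add: h_def)
qed

definition Cw :: real where "Cw = D * Kx * (Kt + Kx * B) + Cm / \<epsilon>"

text \<open>
  The transport equation for \<open>W\<close>. The defect \<open>f\<close> satisfies the relation of averages with a source that is small by
  the transport of mass and the change of variables, so the comparison lemma bounds \<open>f\<close> and \<open>-f\<close>.
\<close>

lemma W_backward:
  assumes st: "0 \<le> s" "s \<le> t" "t < T" and h: "(t - s) * (D * Kx) \<le> 1"
  shows "\<bar>W s (x - (t - s) * V (W t x)) - (t - s) * Z t x - W t x\<bar> \<le> Cw * (t - s)\<^sup>2"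
proof -
  define h where "h = t - s"
  have h0: "0 \<le> h" using st by (simp add: h_def)
  have tT: "t \<in> {0..T}" and sT: "s \<in> {0..T}" using st by auto
  define \<xi> where "\<xi> = (\<lambda>q. q - (t - s) * V (W t q))"
  define a where "a = D * Kx * (Kt + Kx * B) * h\<^sup>2"
  define b where "b = Cm * h\<^sup>2"
  have cVW: "continuous_on S (\<lambda>q. V (W t q))" for S
    by (rule continuous_on_compose2[OF V_cont W_continuous[OF tT]]) simp
  have c\<xi>: "continuous_on S \<xi>" for S unfolding \<xi>_def by (intro continuous_intros cVW)
  have cW\<xi>: "continuous_on S (\<lambda>q. W s (\<xi> q))" for S
    by (rule continuous_on_compose2[OF W_continuous[OF sT, of UNIV] c\<xi>]) simp
  define f where "f = (\<lambda>x. W s (\<xi> x) - h * Z t x - W t x)"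
  have cf: "continuous_on S f" for S
    unfolding f_def by (intro continuous_intros cW\<xi> Z_continuous[OF tT] W_continuous[OF tT])
  have f_bound: "\<bar>f x\<bar> \<le> 2 * M + h * (2 * BG / \<epsilon>)" for x
  proof -
    have "\<bar>h * Z t x\<bar> \<le> h * (2 * BG / \<epsilon>)" unfolding abs_mult by (intro mult_mono Z_bound[OF tT]) (use h0 in auto)
    then show ?thesis using W_mem[OF tT, of x] W_mem[OF sT, of "\<xi> x"] by (auto simp: f_def abs_le_iff)
  qed
  have defect: "\<bar>integral {y..x} f - \<epsilon> * (f x - f y)\<bar> \<le> a * (x - y) + b" if yx: "y \<le> x" for y x
  proof -
    have \<xi>yx: "\<xi> y \<le> \<xi> x" unfolding \<xi>_def by (rule foot_Lipschitz(1)[OF tT _ h yx]) (use st in simp)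
    have i1: "(\<lambda>q. W s (\<xi> q)) integrable_on {y..x}" by (rule integrable_continuous_interval[OF cW\<xi>])
    have i2: "(\<lambda>q. h * Z t q) integrable_on {y..x}"
      by (intro integrable_continuous_interval continuous_intros Z_continuous[OF tT])
    have i3: "W t integrable_on {y..x}" by (rule integrable_continuous_interval[OF W_continuous[OF tT]])
    have int_f: "integral {y..x} f = integral {y..x} (\<lambda>q. W s (\<xi> q)) - h * integral {y..x} (Z t) - integral {y..x} (W t)"
      unfolding f_def
      by (simp only: Henstock_Kurzweil_Integration.integral_diff[OF integrable_diff[OF i1 i2] i3]
          Henstock_Kurzweil_Integration.integral_diff[OF i1 i2] Henstock_Kurzweil_Integration.integral_mult_right)
    \<comment> \<open>The relations of averages for the three parts of f; the masses are compared below.\<close>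
    have A: "\<epsilon> * (W s (\<xi> x) - W s (\<xi> y)) = integral {\<xi> y..\<xi> x} (W s) - integral {\<xi> y..\<xi> x} (r s)"
      using W_increment[OF sT \<xi>yx] eps by simp
    have B: "\<epsilon> * (W t x - W t y) = integral {y..x} (W t) - integral {y..x} (r t)"
      using W_increment[OF tT yx] eps by simp
    have C: "\<epsilon> * (Z t x - Z t y) = integral {y..x} (Z t) - (U t x - U t y)"
      using Z_increment[OF tT yx] eps by simp
    have "\<epsilon> * (f x - f y) = \<epsilon> * (W s (\<xi> x) - W s (\<xi> y)) - h * (\<epsilon> * (Z t x - Z t y)) - \<epsilon> * (W t x - W t y)"
      by (simp add: f_def algebra_simps)
    then have "integral {y..x} f - \<epsilon> * (f x - f y)
      = - (integral {\<xi> y..\<xi> x} (W s) - integral {y..x} (\<lambda>q. W s (\<xi> q)) + h * (U t x - U t y))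
        - (integral {y..x} (r t) - integral {\<xi> y..\<xi> x} (r s))"
      unfolding A B C int_f by (simp add: algebra_simps)
    moreover have "\<bar>integral {\<xi> y..\<xi> x} (W s) - integral {y..x} (\<lambda>q. W s (\<xi> q)) + h * (U t x - U t y)\<bar> \<le> a * (x - y)"
      using foot_change_of_variables[OF st h yx] by (simp add: \<xi>_def h_def a_def)
    moreover have "\<bar>integral {y..x} (r t) - integral {\<xi> y..\<xi> x} (r s)\<bar> \<le> b"
      using mass_backward[OF st yx] \<xi>yx by (simp add: \<xi>_def h_def b_def)
    ultimately show ?thesis by linarith
  qed
  have ci: "f integrable_on {u..v}" for u v by (rule integrable_continuous_interval[OF cf])
  have key: "\<sigma> * f x \<le> a + b / \<epsilon>" if \<sigma>: "\<sigma> = 1 \<or> \<sigma> = - 1" for \<sigma> :: real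
  proof (rule bounded_solution_le[OF eps, where f = "\<lambda>x. \<sigma> * f x" and J = "\<lambda>x. \<sigma> * (primitive f x - \<epsilon> * f x)" and B = "2 * M + h * (2 * BG / \<epsilon>)"])
    show "continuous_on UNIV (\<lambda>x. \<sigma> * f x)" by (intro continuous_intros cf)
    show "\<sigma> * f x \<le> 2 * M + h * (2 * BG / \<epsilon>)" for x using f_bound[of x] \<sigma> by (auto simp: abs_le_iff)
    fix y assume xy: "x \<le> y"
    have J: "\<sigma> * (primitive f y - \<epsilon> * f y) - \<sigma> * (primitive f x - \<epsilon> * f x) = \<sigma> * (integral {x..y} f - \<epsilon> * (f y - f x))"
      using primitive_increment[OF ci xy] by (simp add: algebra_simps)
    show "\<sigma> * f y - \<sigma> * f x = 1 / \<epsilon> * (integral {x..y} (\<lambda>x. \<sigma> * f x) -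
       (\<sigma> * (primitive f y - \<epsilon> * f y) - \<sigma> * (primitive f x - \<epsilon> * f x)))"
      unfolding J using eps by (simp add: right_diff_distrib)
    show "\<sigma> * (primitive f y - \<epsilon> * f y) - \<sigma> * (primitive f x - \<epsilon> * f x) \<le> a * (y - x) + b"
      unfolding J using defect[OF xy] \<sigma> by (auto simp: abs_le_iff)
  qed
  have "\<bar>f x\<bar> \<le> a + b / \<epsilon>" using key[of 1] key[of "-1"] by (auto simp: abs_le_iff)
  also have "a + b / \<epsilon> = Cw * h\<^sup>2" by (simp add: a_def b_def Cw_def algebra_simps)
  finally show ?thesis by (simp add: f_def \<xi>_def h_def)
qed

end

section \<open>A discrete Gronwall inequality and the maximum principle\<close>

text \<open>
  With \<open>n\<close> equal steps of length \<open>h\<close> the values at the nodes satisfy \<open>f\<^sub>k \<le> h ((1 + 4 C h)\<^sup>k - 1)\<close>, hence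
  \<open>f(b) \<le> h exp(4 C (b - a))\<close>, which tends to zero with \<open>h\<close>.
\<close>

lemma discrete_Gronwall:
  fixes f :: "real \<Rightarrow> real"
  assumes ab: "a \<le> b" and nonneg: "\<And>t. a \<le> t \<Longrightarrow> t \<le> b \<Longrightarrow> 0 \<le> f t" and start: "f a = 0"
    and C: "0 \<le> C" and h0: "0 < h0"
    and one_step: "\<And>s t. a \<le> s \<Longrightarrow> s \<le> t \<Longrightarrow> t \<le> b \<Longrightarrow> t - s \<le> h0 \<Longrightarrow>
       f t \<le> f s + C * (t - s) * (f t + f s) + C * (t - s)\<^sup>2"
  shows "f b = 0"
proof -
  define E where "E = (b - a) * exp (4 * C * (b - a))"
  have "eventually (\<lambda>n. f b \<le> E / real n) sequentially"
  proof -
    obtain N1 where N1: "(b - a) / h0 \<le> real N1" using real_arch_simple by blast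
    obtain N2 where N2: "2 * C * (b - a) \<le> real N2" using real_arch_simple by blast
    show ?thesis
      using eventually_ge_at_top[of "N1 + N2 + 1"]
    proof eventually_elim
      case (elim n)
      define h where "h = (b - a) / real n"
      have n: "real n > 0" "real N1 \<le> real n" "real N2 \<le> real n" using elim by auto
      have h: "0 \<le> h" "h \<le> h0" "C * h \<le> 1 / 2" "real n * h = b - a"
      proof -
        show "0 \<le> h" using ab n by (simp add: h_def)
        have "(b - a) / h0 \<le> real n" using N1 n by linarith
        then show "h \<le> h0" using h0 n by (simp add: h_def pos_divide_le_eq mult.commute)
        have "2 * C * (b - a) \<le> real n" using N2 n by linarith
        then show "C * h \<le> 1 / 2" using n by (simp add: h_def pos_divide_le_eq)
        show "real n * h = b - a" using n by (simp add: h_def)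
      qed
      have "f (a + real k * h) \<le> h * ((1 + 4 * (C * h)) ^ k - 1)" if "k \<le> n" for k
        using that
      proof (induction k)
        case (Suc k)
        have kh: "a + real (Suc k) * h = (a + real k * h) + h" by (simp add: algebra_simps)
        have "real (Suc k) * h \<le> real n * h" using Suc.prems h by (intro mult_right_mono) auto
        then have le: "a + real (Suc k) * h \<le> b" using h by linarith
        have ge: "a \<le> a + real k * h" using h by simp
        define u where "u = f (a + real (Suc k) * h)"
        define v where "v = f (a + real k * h)"
        define c where "c = C * h"
        have c: "0 \<le> c" "c \<le> 1 / 2" using h C by (simp_all add: c_def)
        have "u \<le> v + C * h * (u + v) + C * h\<^sup>2"
          using one_step[of "a + real k * h" "a + real (Suc k) * h"] ge le h unfolding u_def v_def kh by simp
        then have "u \<le> v + c * (u + v) + c * h" by (simp add: c_def power2_eq_square mult.assoc)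
        then have "(1 - c) * u \<le> (1 + c) * v + c * h" by (simp add: algebra_simps)
        moreover have "0 \<le> v" unfolding v_def using ge le h kh by (intro nonneg) auto
        moreover have "(1 + c) * v \<le> ((1 - c) * (1 + 4 * c)) * v"
        proof (rule mult_right_mono[OF _ \<open>0 \<le> v\<close>])
          have "c * c \<le> (1 / 2) * c" using c by (intro mult_right_mono) auto
          then show "1 + c \<le> (1 - c) * (1 + 4 * c)" by (simp add: algebra_simps)
        qed
        moreover have "c * h \<le> ((1 - c) * 2) * (c * h)"
        proof -
          have "1 * (c * h) \<le> ((1 - c) * 2) * (c * h)" using c h by (intro mult_right_mono) auto
          then show ?thesis by simp
        qed
        ultimately have "(1 - c) * u \<le> (1 - c) * ((1 + 4 * c) * v + 2 * c * h)" by (simp add: algebra_simps)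
        then have "u \<le> (1 + 4 * c) * v + 2 * c * h" using c by (simp add: mult_le_cancel_left)
        also have "(1 + 4 * c) * v \<le> (1 + 4 * c) * (h * ((1 + 4 * c) ^ k - 1))"
          using Suc c unfolding v_def c_def by (intro mult_left_mono) auto
        also have "(1 + 4 * c) * (h * ((1 + 4 * c) ^ k - 1)) + 2 * c * h = h * ((1 + 4 * c) ^ Suc k - 1) - 2 * c * h"
          by (simp add: algebra_simps)
        also have "\<dots> \<le> h * ((1 + 4 * c) ^ Suc k - 1)" using c h by simp
        finally show ?case unfolding u_def c_def by simp
      qed (simp add: start)
      from this[of n] have "f b \<le> h * ((1 + 4 * (C * h)) ^ n - 1)" using h(4) by simp
      also have "\<dots> \<le> h * exp (4 * C * (b - a))"
      proof (rule mult_left_mono[OF _ h(1)])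
        have "(1 + 4 * (C * h)) ^ n \<le> exp (4 * (C * h)) ^ n"
          using C h by (intro power_mono exp_ge_add_one_self) auto
        also have "\<dots> = exp (real n * (4 * (C * h)))" by (simp only: exp_of_nat_mult)
        also have "real n * (4 * (C * h)) = 4 * C * (real n * h)" by simp
        also have "\<dots> = 4 * C * (b - a)" by (simp only: h(4))
        finally show "(1 + 4 * (C * h)) ^ n - 1 \<le> exp (4 * C * (b - a))" by simp
      qed
      finally show ?case by (simp add: E_def h_def)
    qed
  qed
  moreover have "(\<lambda>n. E / real n) \<longlonglongrightarrow> 0" by (rule lim_const_over_n)
  ultimately have "f b \<le> 0" by (intro tendsto_lowerbound[of "\<lambda>n. E / real n" 0 sequentially "f b"]) auto
  then show ?thesis using nonneg[of b] ab by simp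
qed

context regular_flow begin

lemma V_antimono: "x \<le> y \<Longrightarrow> V y \<le> V x"
  using DERIV_nonpos_imp_nonincreasing[of x y V] V_deriv V'_nonpos by blast

lemma V_one_sided:
  assumes \<sigma>: "\<sigma> = 1 \<or> \<sigma> = (- 1 :: real)" and ab: "a \<in> {-M..M}" "b \<in> {-M..M}" and c: "\<sigma> * (a - b) \<le> c" "0 \<le> c"
  shows "- \<sigma> * (V a - V b) \<le> D * c"
proof (cases "\<sigma> * (a - b) \<le> 0")
  case True
  then have "- \<sigma> * (V a - V b) \<le> 0" using \<sigma> V_antimono[of a b] V_antimono[of b a] by auto
  also have "0 \<le> D * c" using D_nonneg c by simp
  finally show ?thesis .
next
  case False
  have "- \<sigma> * (V a - V b) \<le> \<bar>V a - V b\<bar>" using \<sigma> by auto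
  also have "\<dots> \<le> D * \<bar>a - b\<bar>" by (rule V_Lipschitz[OF ab])
  also have "\<bar>a - b\<bar> = \<sigma> * (a - b)" using \<sigma> False by auto
  also have "D * (\<sigma> * (a - b)) \<le> D * c" by (rule mult_left_mono[OF c(1) D_nonneg])
  finally show ?thesis .
qed

text \<open>
  The sign \<open>\<sigma>\<close> treats the upper and the lower bound together. Let \<open>A\<close> be the supremum of \<open>\<sigma> (\<integral> \<rho> - k (x - y))\<close> divided by
  \<open>1 + (x - y)\<close>. On an interval where the bound is violated, \<open>\<sigma> W\<close> exceeds \<open>\<sigma> k\<close> by \<open>O(A)\<close> at most, so
  \<open>\<epsilon> \<partial>\<^sub>x W = W - \<rho>\<close> and the monotonicity of \<open>V\<close> imply that the length of the interval changes in the favourable direction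
  up to \<open>O(A h)\<close> when it is followed backwards. Since mass is preserved, \<open>A\<close> satisfies the discrete Gronwall
  inequality. The weight \<open>1 + (x - y)\<close> makes the supremum finite without any prior knowledge of the solution.
\<close>

lemma maximum_principle:
  assumes \<sigma>: "\<sigma> = 1 \<or> \<sigma> = (- 1 :: real)" and k: "0 \<le> k"
    and init: "\<And>y x. y \<le> x \<Longrightarrow> \<sigma> * (integral {y..x} r0 - k * (x - y)) \<le> 0"
    and t: "0 \<le> t" "t < T"
  shows "y \<le> x \<Longrightarrow> \<sigma> * (integral {y..x} (r t) - k * (x - y)) \<le> 0"
    and "\<sigma> * (W t z - k) \<le> 0"
proof -
  define e where "e s p = \<sigma> * (integral {fst p..snd p} (r s) - k * (snd p - fst p))" for s and p :: "real \<times> real"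
  define P where "P = {p :: real \<times> real. fst p \<le> snd p}"
  define A where "A s = (SUP p\<in>P. e s p / (1 + (snd p - fst p)))" for s
  have e_le: "e s p / (1 + (snd p - fst p)) \<le> M + k" if "s \<in> {0..T}" "p \<in> P" for s p
  proof -
    define d where "d = snd p - fst p"
    have d: "0 \<le> d" using that by (simp add: d_def P_def)
    have "\<bar>integral {fst p..snd p} (r s)\<bar> \<le> M * d"
      unfolding d_def using that by (intro bmeas_abs_integral_le r) (auto simp: P_def)
    moreover have "0 \<le> k * d" using k d by simp
    moreover have "\<sigma> * (u - v) \<le> \<bar>u\<bar> + v" if "0 \<le> v" for u v using \<sigma> that by auto
    ultimately have "e s p \<le> M * d + k * d" unfolding e_def d_def[symmetric] by (meson add_right_mono order_trans)
    also have "\<dots> \<le> (M + k) * (1 + d)" using M_nonneg k by (simp add: algebra_simps)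
    finally show ?thesis unfolding d_def[symmetric] using d by (simp add: pos_divide_le_eq)
  qed
  have bdd: "bdd_above ((\<lambda>p. e s p / (1 + (snd p - fst p))) ` P)" if "s \<in> {0..T}" for s
    using e_le[OF that] by (intro bdd_aboveI2) auto
  have P0: "(0, 0) \<in> P" by (simp add: P_def)
  have A_ge: "e s p \<le> A s * (1 + (snd p - fst p))" if "s \<in> {0..T}" "p \<in> P" for s p
  proof -
    have "e s p / (1 + (snd p - fst p)) \<le> A s" unfolding A_def by (rule cSUP_upper[OF that(2) bdd[OF that(1)]])
    moreover have "0 < 1 + (snd p - fst p)" using that by (simp add: P_def)
    ultimately show ?thesis by (simp add: pos_divide_le_eq)
  qed
  have A_nonneg: "0 \<le> A s" if "s \<in> {0..T}" for s
    using A_ge[OF that P0] by (simp add: e_def)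
  have A_leI: "A s \<le> c" if "\<And>p. p \<in> P \<Longrightarrow> e s p \<le> c * (1 + (snd p - fst p))" for s c
    unfolding A_def
  proof (rule cSUP_least)
    fix p assume p: "p \<in> P"
    then have "0 < 1 + (snd p - fst p)" by (simp add: P_def)
    then show "e s p / (1 + (snd p - fst p)) \<le> c" using that[OF p] by (simp add: pos_divide_le_eq)
  qed (use P0 in auto)
  have mass: "\<sigma> * (integral {y..x} (r s) - k * (x - y)) \<le> A s * (1 + (x - y))" if "s \<in> {0..T}" "y \<le> x" for s y x
    using A_ge[OF that(1), of "(y, x)"] that(2) by (simp add: e_def P_def)
  have f_inc: "\<sigma> * (W s x - k) - \<sigma> * (W s y - k) = 1 / \<epsilon> * (integral {y..x} (\<lambda>q. \<sigma> * (W s q - k)) - \<sigma> * (integral {y..x} (r s) - k * (x - y)))"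
    if s: "s \<in> {0..T}" and yx: "y \<le> x" for s y x
  proof -
    have wi: "W s integrable_on {y..x}" by (rule integrable_continuous_interval[OF W_continuous[OF s]])
    have "integral {y..x} (\<lambda>q. \<sigma> * (W s q - k)) = \<sigma> * (integral {y..x} (W s) - k * (x - y))"
      using Henstock_Kurzweil_Integration.integral_diff[OF wi integrable_const_ivl[of k]] yx
      by (simp add: mult.commute)
    moreover have "\<sigma> * (W s x - k) - \<sigma> * (W s y - k) = \<sigma> * (W s x - W s y)" by (simp add: algebra_simps)
    ultimately show ?thesis unfolding W_increment[OF s yx] by (simp add: algebra_simps)
  qed
  have W_le: "\<sigma> * (W s z - k) \<le> A s + A s / \<epsilon>" if s: "s \<in> {0..T}" for s z
  proof (rule bounded_solution_le[OF eps, where f = "\<lambda>x. \<sigma> * (W s x - k)" and J = "\<lambda>x. \<sigma> * (primitive (r s) x - k * x)" and B = "M + k"])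
    show "continuous_on UNIV (\<lambda>x. \<sigma> * (W s x - k))" by (intro continuous_intros W_continuous[OF s])
    show "\<sigma> * (W s x - k) \<le> M + k" for x using W_abs_le[OF s, of x] \<sigma> k by (auto simp: abs_le_iff)
    fix x assume zx: "z \<le> x"
    have J: "\<sigma> * (primitive (r s) x - k * x) - \<sigma> * (primitive (r s) z - k * z) = \<sigma> * (integral {z..x} (r s) - k * (x - z))"
      using primitive_increment[OF bmeas_integrable[OF r[OF s]] zx] by (simp add: algebra_simps)
    show "\<sigma> * (W s x - k) - \<sigma> * (W s z - k) = 1 / \<epsilon> * (integral {z..x} (\<lambda>x. \<sigma> * (W s x - k)) -
       (\<sigma> * (primitive (r s) x - k * x) - \<sigma> * (primitive (r s) z - k * z)))"
      unfolding J by (rule f_inc[OF s zx])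
    show "\<sigma> * (primitive (r s) x - k * x) - \<sigma> * (primitive (r s) z - k * z) \<le> A s * (x - z) + A s"
      unfolding J using mass[OF s zx] by (simp add: algebra_simps)
  qed
  define c1 where "c1 = (1 + 1 / \<epsilon>) / \<epsilon>"
  have c1: "0 \<le> c1" using eps by (simp add: c1_def)
  define C where "C = D * Kx + k * D * c1 + Cm"
  have C0: "0 \<le> C" "D * Kx \<le> C" "k * D * c1 \<le> C" "Cm \<le> C"
    using DKx_nonneg D_nonneg k c1 Cm_nonneg by (simp_all add: C_def)
  have one_step: "A t' \<le> A s + C * (t' - s) * (A t' + A s) + C * (t' - s)\<^sup>2"
    if st: "0 \<le> s" "s \<le> t'" "t' < T" and small: "t' - s \<le> 1 / (D * Kx + 1)" for s t'
  proof (rule A_leI)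
    define h where "h = t' - s"
    have h: "0 \<le> h" using st by (simp add: h_def)
    have tT: "t' \<in> {0..T}" and sT: "s \<in> {0..T}" using st by auto
    have hD: "h * (D * Kx) \<le> 1"
    proof -
      have "h * (D * Kx + 1) \<le> 1" using small DKx_nonneg by (simp add: h_def pos_le_divide_eq)
      then show ?thesis using h by (simp add: algebra_simps)
    qed
    have A0: "0 \<le> A t'" "0 \<le> A s" using A_nonneg tT sT by auto
    fix p assume p: "p \<in> P"
    obtain y x where pyx: "p = (y, x)" by (cases p)
    have yx: "y \<le> x" using p by (simp add: P_def pyx)
    define d where "d = x - y"
    have d: "0 \<le> d" using yx by (simp add: d_def)
    let ?R = "A s + C * h * (A t' + A s) + C * h\<^sup>2"
    have R0: "0 \<le> ?R" using A0 C0 h by simp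
    have "\<sigma> * (integral {y..x} (r t') - k * (x - y)) \<le> ?R * (1 + d)"
    proof (cases "\<sigma> * (integral {y..x} (r t') - k * (x - y)) \<le> 0")
      case True
      have "0 \<le> ?R * (1 + d)" using R0 d by simp
      then show ?thesis using True by linarith
    next
      case False
      define Y where "Y = y - h * V (W t' y)"
      define X where "X = x - h * V (W t' x)"
      have YX: "Y \<le> X" unfolding X_def Y_def by (rule foot_Lipschitz(1)[OF tT h hD yx])
      define dV where "dV = V (W t' x) - V (W t' y)"
      have XY: "X - Y = d - h * dV" by (simp add: X_def Y_def d_def dV_def algebra_simps)
      have XY_le: "X - Y \<le> d + h * (D * Kx * d)"
      proof -
        have "\<bar>dV\<bar> \<le> D * Kx * d" using VW_Lipschitz[OF tT, of x y] d by (simp add: dV_def d_def)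
        then have "- dV \<le> D * Kx * d" by linarith
        then have "h * (- dV) \<le> h * (D * Kx * d)" using h by (rule mult_left_mono)
        then show ?thesis unfolding XY by simp
      qed
      have dW: "\<sigma> * (W t' x - W t' y) \<le> c1 * A t' * d"
      proof -
        have "integral {y..x} (\<lambda>q. \<sigma> * (W t' q - k)) \<le> (A t' + A t' / \<epsilon>) * d"
        proof -
          have "integral {y..x} (\<lambda>q. \<sigma> * (W t' q - k)) \<le> integral {y..x} (\<lambda>q. A t' + A t' / \<epsilon>)"
            by (rule integral_le)
              (use W_le[OF tT] in \<open>auto intro!: integrable_continuous_interval continuous_intros W_continuous[OF tT]\<close>)
          then show ?thesis using yx by (simp add: d_def mult.commute)
        qed
        then have "integral {y..x} (\<lambda>q. \<sigma> * (W t' q - k)) - \<sigma> * (integral {y..x} (r t') - k * (x - y)) \<le> (A t' + A t' / \<epsilon>) * d"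
          using False by linarith
        then have "1 / \<epsilon> * (integral {y..x} (\<lambda>q. \<sigma> * (W t' q - k)) - \<sigma> * (integral {y..x} (r t') - k * (x - y))) \<le> 1 / \<epsilon> * ((A t' + A t' / \<epsilon>) * d)"
          using eps by (intro mult_left_mono) auto
        also have "1 / \<epsilon> * ((A t' + A t' / \<epsilon>) * d) = c1 * A t' * d" by (simp add: c1_def algebra_simps add_divide_distrib)
        finally show ?thesis using f_inc[OF tT yx] by (simp add: algebra_simps)
      qed
      have sV: "- \<sigma> * dV \<le> D * (c1 * A t' * d)"
        unfolding dV_def by (rule V_one_sided[OF \<sigma> W_mem[OF tT] W_mem[OF tT] dW]) (use c1 A0 d in auto)
      have bwd: "\<bar>integral {y..x} (r t') - integral {Y..X} (r s)\<bar> \<le> Cm * h\<^sup>2"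
        using mass_backward[OF st yx] YX by (simp add: X_def Y_def h_def)
      then have "\<sigma> * (integral {y..x} (r t') - k * (x - y)) \<le> \<sigma> * (integral {Y..X} (r s) - k * (X - Y)) + \<sigma> * k * ((X - Y) - d) + Cm * h\<^sup>2"
        using \<sigma> by (auto simp: abs_le_iff d_def algebra_simps)
      also have "\<sigma> * (integral {Y..X} (r s) - k * (X - Y)) \<le> A s * (1 + (X - Y))" by (rule mass[OF sT YX])
      also have "A s * (1 + (X - Y)) \<le> A s * (1 + d + h * (D * Kx) * (1 + d))"
      proof (rule mult_left_mono[OF _ A0(2)])
        have "(h * (D * Kx)) * d \<le> (h * (D * Kx)) * (1 + d)"
          by (intro mult_left_mono mult_nonneg_nonneg h DKx_nonneg) simp
        moreover have "h * (D * Kx * d) = (h * (D * Kx)) * d" by simp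
        ultimately have "h * (D * Kx * d) \<le> h * (D * Kx) * (1 + d)" by linarith
        then show "1 + (X - Y) \<le> 1 + d + h * (D * Kx) * (1 + d)" using XY_le by linarith
      qed
      also have "\<sigma> * k * ((X - Y) - d) = k * h * (- \<sigma> * dV)" unfolding XY by simp
      also have "k * h * (- \<sigma> * dV) \<le> k * h * (D * (c1 * A t' * (1 + d)))"
      proof -
        have "D * (c1 * A t' * d) \<le> D * (c1 * A t' * (1 + d))"
          using D_nonneg c1 A0 by (intro mult_left_mono) auto
        then show ?thesis using sV k h by (intro mult_left_mono) auto
      qed
      finally have "\<sigma> * (integral {y..x} (r t') - k * (x - y))
         \<le> A s * (1 + d + h * (D * Kx) * (1 + d)) + k * h * (D * (c1 * A t' * (1 + d))) + Cm * h\<^sup>2" by simp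
      moreover have "Cm * h\<^sup>2 \<le> (1 + d) * (C * h\<^sup>2)"
      proof -
        have "1 * (Cm * h\<^sup>2) \<le> (1 + d) * (C * h\<^sup>2)" using d C0 Cm_nonneg by (intro mult_mono mult_right_mono) auto
        then show ?thesis by simp
      qed
      moreover have "h * (D * Kx) * (1 + d) * A s \<le> h * C * (1 + d) * A s"
        using h d A0 C0 by (intro mult_right_mono mult_left_mono) auto
      moreover have "h * (k * D * c1) * (1 + d) * A t' \<le> h * C * (1 + d) * A t'"
        using h d A0 C0 by (intro mult_right_mono mult_left_mono) auto
      ultimately show ?thesis by (simp add: algebra_simps)
    qed
    then show "e t' p \<le> (A s + C * (t' - s) * (A t' + A s) + C * (t' - s)\<^sup>2) * (1 + (snd p - fst p))"
      by (simp add: e_def pyx h_def d_def)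
  qed
  have A_start: "A 0 = 0"
  proof (rule antisym)
    show "A 0 \<le> 0"
    proof (rule A_leI)
      fix p assume "p \<in> P"
      then have "fst p \<le> snd p" by (simp add: P_def)
      then show "e 0 p \<le> 0 * (1 + (snd p - fst p))"
        using init initial_mass[OF VW_Lipschitz DKx_nonneg] by (simp add: e_def)
    qed
    show "0 \<le> A 0" using A_nonneg T by simp
  qed
  have "A t = 0"
  proof (rule discrete_Gronwall[where f = A and a = 0 and C = C and ?h0.0 = "1 / (D * Kx + 1)"])
    show "0 < 1 / (D * Kx + 1)" using DKx_nonneg by simp
    show "A t' \<le> A s + C * (t' - s) * (A t' + A s) + C * (t' - s)\<^sup>2"
      if "0 \<le> s" "s \<le> t'" "t' \<le> t" "t' - s \<le> 1 / (D * Kx + 1)" for s t'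
      using that t by (intro one_step) auto
  qed (use t A_nonneg A_start C0 in auto)
  moreover have tT: "t \<in> {0..T}" using t by auto
  ultimately show "\<sigma> * (W t z - k) \<le> 0" using W_le[OF tT, of z] by simp
  show "\<sigma> * (integral {y..x} (r t) - k * (x - y)) \<le> 0" if "y \<le> x"
    using mass[OF tT that] \<open>A t = 0\<close> by simp
qed

end

section \<open>The one-sided Lipschitz estimate\<close>

context regular_flow begin

text \<open>
  Bounds for \<open>Z\<close> and for the error in the transport of \<open>U\<close>.
\<close>

definition Zb :: real where "Zb = 2 * BG / \<epsilon>"
definition CU :: real where "CU = D * M * Cw + Lg * (Zb + Cw * T)\<^sup>2"

lemma BG_nonneg: "0 \<le> BG" using D_nonneg M_nonneg by (simp add: BG_def)
lemma Zb_nonneg: "0 \<le> Zb" using BG_nonneg eps by (simp add: Zb_def)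
lemma Cw_nonneg: "0 \<le> Cw"
  using D_nonneg Kx_nonneg Kt_nonneg B_nonneg Cm_nonneg eps by (simp add: Cw_def)
lemma CU_nonneg: "0 \<le> CU"
  using D_nonneg M_nonneg Cw_nonneg Lg_nonneg by (simp add: CU_def)

text \<open>
  The chain rule turns the transport of \<open>W\<close> into \<open>\<partial>\<^sub>t U + V(W) \<partial>\<^sub>x U = - g(W) Z\<close>.
\<close>

lemma U_backward:
  assumes st: "0 \<le> s" "s \<le> t" "t < T" and h: "(t - s) * (D * Kx) \<le> 1"
  shows "\<bar>U s (x - (t - s) * V (W t x)) - U t x - (t - s) * (g (W t x) * Z t x)\<bar> \<le> CU * (t - s)\<^sup>2"
proof -
  define h where "h = t - s"
  have h0: "0 \<le> h" "h \<le> T" using st by (auto simp: h_def)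
  have tT: "t \<in> {0..T}" and sT: "s \<in> {0..T}" using st by auto
  define X where "X = x - h * V (W t x)"
  define w where "w = W s X - W t x"
  have w: "\<bar>w - h * Z t x\<bar> \<le> Cw * h\<^sup>2"
    using W_backward[OF st h, of x] by (simp add: w_def X_def h_def algebra_simps)
  have "\<bar>w\<bar> \<le> h * (Zb + Cw * T)"
  proof -
    have "\<bar>h * Z t x\<bar> \<le> h * Zb" unfolding abs_mult Zb_def using h0 by (intro mult_mono Z_bound[OF tT]) auto
    moreover have "Cw * h\<^sup>2 \<le> h * (Cw * T)"
    proof -
      have "(Cw * h) * h \<le> (Cw * h) * T" using h0 Cw_nonneg by (intro mult_left_mono) auto
      then show ?thesis by (simp add: power2_eq_square algebra_simps)
    qed
    ultimately show ?thesis using w by (simp add: algebra_simps abs_le_iff)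
  qed
  then have "w\<^sup>2 \<le> (h * (Zb + Cw * T))\<^sup>2" using power_mono[of "\<bar>w\<bar>" "h * (Zb + Cw * T)" 2] by simp
  then have "Lg * w\<^sup>2 \<le> Lg * ((Zb + Cw * T)\<^sup>2 * h\<^sup>2)"
    using Lg_nonneg by (intro mult_left_mono) (simp_all add: power_mult_distrib mult.commute)
  moreover have "\<bar>U s X - U t x - g (W t x) * w\<bar> \<le> Lg * w\<^sup>2"
    unfolding U_def w_def by (rule G_remainder[OF W_mem[OF sT] W_mem[OF tT]])
  moreover have "\<bar>g (W t x) * (w - h * Z t x)\<bar> \<le> D * M * (Cw * h\<^sup>2)"
    unfolding abs_mult using D_nonneg M_nonneg by (intro mult_mono g_bound[OF W_mem[OF tT]] w) auto
  moreover have "g (W t x) * (w - h * Z t x) = g (W t x) * w - h * (g (W t x) * Z t x)" by (simp add: algebra_simps)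
  moreover have "CU * h\<^sup>2 = D * M * (Cw * h\<^sup>2) + Lg * ((Zb + Cw * T)\<^sup>2 * h\<^sup>2)" by (simp add: CU_def algebra_simps)
  ultimately show ?thesis unfolding X_def[symmetric] h_def[symmetric] by linarith
qed

lemma g_nonpos: "0 \<le> \<xi> \<Longrightarrow> g \<xi> \<le> 0"
  unfolding g_def using V'_nonpos[of \<xi>] by (simp add: mult_nonpos_nonneg)

lemma G_antimono: assumes "0 \<le> a" "a \<le> b" shows "G b \<le> G a"
  by (rule DERIV_nonpos_imp_nonincreasing[OF assms(2)]) (use G_deriv g_nonpos assms in fastforce)

text \<open>
  \<open>G - S V\<close> has derivative \<open>V'(\<xi>) (\<xi> - S)\<close>, which is nonnegative below \<open>S\<close>.
\<close>

lemma G_diff_le: assumes "a \<le> b" "b \<le> S" shows "G a - G b \<le> S * (V a - V b)"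
proof -
  have "G a - S * V a \<le> G b - S * V b"
  proof (rule DERIV_nonneg_imp_nondecreasing[OF assms(1)])
    fix x assume "a \<le> x" "x \<le> b"
    have "((\<lambda>x. G x - S * V x) has_real_derivative g x - S * deriv V x) (at x)"
      by (intro DERIV_diff G_deriv DERIV_cmult V_deriv)
    moreover have "g x - S * deriv V x = (- deriv V x) * (S - x)" by (simp add: g_def algebra_simps)
    moreover have "0 \<le> (- deriv V x) * (S - x)" using V'_nonpos[of x] \<open>x \<le> b\<close> assms by (intro mult_nonneg_nonneg) auto
    ultimately show "\<exists>y. ((\<lambda>x. G x - S * V x) has_real_derivative y) (at x) \<and> 0 \<le> y" by auto
  qed
  then show ?thesis by (simp add: algebra_simps)
qed

text \<open>
  The differential inequality at a maximum point, for difference quotients. The pair \<open>y \<le> x\<close> violates the bound with slope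
  \<open>\<mu>\<close>, while every pair violates it by at most \<open>E\<close>, which gives \<open>Z \<le> \<mu> + c E\<close>. The left hand side measures the
  deficit in \<open>d/dt (U(x) - U(y) - \<mu> (x - y))\<close> when \<open>\<mu>' = - \<kappa> \<mu>\<^sup>2 / R\<close>; all errors are proportional to \<open>E\<close>.
\<close>

lemma Oleinik_key_inequality:
  fixes \<kappa> R S I \<mu> E c \<delta> t x y :: real
  defines "\<Delta> \<equiv> x - y"
  defines "\<Delta>V \<equiv> V (W t x) - V (W t y)"
  assumes t: "t \<in> {0..T}" and \<kappa>: "0 < \<kappa>" and R: "0 < R" "S \<le> R" and I: "0 \<le> I"
    and rng: "\<And>z. W t z \<in> {I..S}"
    and slope: "W t y - W t x \<le> (S - I) / \<epsilon> * \<Delta>"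
    and cond: "(\<kappa> = 1 \<and> (\<forall>a b. I \<le> a \<longrightarrow> a \<le> b \<longrightarrow> b \<le> S \<longrightarrow> g b \<le> g a \<and> (g a - g b) * (S - I) \<le> G a - G b))
      \<or> (\<forall>a b. I \<le> a \<longrightarrow> a \<le> b \<longrightarrow> b \<le> S \<longrightarrow> 0 \<le> g b - g a \<and> g b - g a \<le> (1 - \<kappa>) * (V a - V b))"
    and \<mu>: "0 \<le> \<mu>" and E: "0 \<le> E" and c: "0 \<le> c"
    and Z_le: "\<And>z. Z t z \<le> \<mu> + c * E"
    and yx: "y \<le> x" "\<Delta> \<le> \<delta>" and \<delta>: "(Zb + D * M * Kx) / \<epsilon> * \<delta> \<le> \<mu>"
    and big: "\<mu> * \<Delta> < U t x - U t y"
  shows "0 \<le> \<Delta>V"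
    and "- (2 * B * c + D * M * c * \<delta> / \<epsilon>) * E \<le> (g (W t x) * Z t x - g (W t y) * Z t y) + \<mu> * \<Delta>V - \<kappa> * \<mu>\<^sup>2 / R * \<Delta>"
proof -
  define a where "a = W t x"
  define b where "b = W t y"
  define \<Delta>U where "\<Delta>U = U t x - U t y"
  have \<Delta>: "0 \<le> \<Delta>" using yx by (simp add: \<Delta>_def)
  have \<Delta>U0: "0 < \<Delta>U" "\<mu> * \<Delta> \<le> \<Delta>U"
    using big mult_nonneg_nonneg[OF \<mu> \<Delta>] unfolding \<Delta>U_def by linarith+
  have ab: "a < b"
  proof (rule ccontr)
    assume "\<not> a < b"
    then have "G a \<le> G b" using rng[of y] I by (intro G_antimono) (auto simp: b_def)
    then show False using \<Delta>U0 by (simp add: \<Delta>U_def U_def a_def b_def)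
  qed
  have rab: "I \<le> a" "b \<le> S" "0 \<le> b" "0 \<le> a" using rng[of x] rng[of y] I by (auto simp: a_def b_def)
  show \<Delta>V: "0 \<le> \<Delta>V" using V_antimono[of a b] ab by (simp add: \<Delta>V_def a_def b_def)
  have \<Delta>V_le: "\<Delta>V \<le> 2 * B" using V_bound[OF W_mem[OF t, of x]] V_bound[OF W_mem[OF t, of y]] by (simp add: \<Delta>V_def abs_le_iff)
  \<comment> \<open>The compression of the interval dominates the decay of the slope.\<close>
  have "\<mu> * \<Delta> \<le> R * \<Delta>V"
  proof -
    have "\<Delta>U \<le> S * \<Delta>V" using G_diff_le[of a b S] ab rab by (simp add: \<Delta>U_def U_def \<Delta>V_def a_def b_def)
    also have "\<dots> \<le> R * \<Delta>V" using R \<Delta>V by (intro mult_right_mono) auto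
    finally show ?thesis using \<Delta>U0 by linarith
  qed
  then have "(\<kappa> * \<mu> / R) * (\<mu> * \<Delta>) \<le> (\<kappa> * \<mu> / R) * (R * \<Delta>V)" using \<kappa> \<mu> R by (intro mult_left_mono) auto
  then have time: "(1 - \<kappa>) * (\<mu> * \<Delta>V) \<le> \<mu> * \<Delta>V - \<kappa> * \<mu>\<^sup>2 / R * \<Delta>"
    using R by (simp add: power2_eq_square algebra_simps)
  have zi: "Z t integrable_on {y..x}" by (rule integrable_continuous_interval[OF Z_continuous[OF t]])
  define J where "J = integral {y..x} (Z t)"
  have J_le: "J \<le> (\<mu> + c * E) * \<Delta>"
  proof -
    have "J \<le> integral {y..x} (\<lambda>q. \<mu> + c * E)" unfolding J_def by (rule integral_le[OF zi]) (use Z_le in auto)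
    then show ?thesis using yx by (simp add: \<Delta>_def mult.commute)
  qed
  have \<Delta>Z: "Z t x - Z t y = 1 / \<epsilon> * (J - \<Delta>U)"
    using Z_increment[OF t yx(1)] by (simp add: J_def \<Delta>U_def)
  have split: "g a * Z t x - g b * Z t y = (g a - g b) * Z t x + (- g b) / \<epsilon> * (\<Delta>U - J)"
  proof -
    have "g a * Z t x - g b * Z t y = (g a - g b) * Z t x + g b * (Z t x - Z t y)" by (simp add: algebra_simps)
    then show ?thesis unfolding \<Delta>Z using eps by (simp add: field_simps)
  qed
  have gb: "0 \<le> - g b" "- g b \<le> D * M"
    using g_nonpos[OF rab(3)] g_bound[OF W_mem[OF t, of y]] by (auto simp: b_def abs_le_iff)
  have second: "- (D * M * c * \<delta> / \<epsilon>) * E \<le> (- g b) / \<epsilon> * (\<Delta>U - J)"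
  proof -
    have "- (c * E * \<Delta>) \<le> \<Delta>U - J" using J_le \<Delta>U0 by (simp add: algebra_simps)
    then have "(- g b) / \<epsilon> * (- (c * E * \<Delta>)) \<le> (- g b) / \<epsilon> * (\<Delta>U - J)"
      using gb eps by (intro mult_left_mono divide_nonneg_pos) auto
    moreover have "(- g b) / \<epsilon> * (c * E * \<Delta>) \<le> (D * M) / \<epsilon> * (c * E * \<delta>)"
      using gb eps c E \<Delta> yx D_nonneg M_nonneg
      by (intro mult_mono divide_right_mono mult_left_mono mult_nonneg_nonneg divide_nonneg_pos) auto
    moreover have "(D * M) / \<epsilon> * (c * E * \<delta>) = (D * M * c * \<delta> / \<epsilon>) * E" by simp
    ultimately show ?thesis by (simp add: algebra_simps)
  qed
  have pos2: "0 \<le> 2 * B * c * E" "0 \<le> (D * M * c * \<delta> / \<epsilon>) * E"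
    using B_nonneg c E D_nonneg M_nonneg \<Delta> yx eps by auto
  have final: "- (2 * B * c + D * M * c * \<delta> / \<epsilon>) * E \<le> (g a - g b) * Z t x + (- g b) / \<epsilon> * (\<Delta>U - J) + (1 - \<kappa>) * (\<mu> * \<Delta>V)"
    using cond
  proof
    assume C: "\<kappa> = 1 \<and> (\<forall>a b. I \<le> a \<longrightarrow> a \<le> b \<longrightarrow> b \<le> S \<longrightarrow> g b \<le> g a \<and> (g a - g b) * (S - I) \<le> G a - G b)"
    then have \<Delta>g: "g b \<le> g a" "(g a - g b) * (S - I) \<le> G a - G b" using rab ab by auto
    show ?thesis
    proof (cases "0 \<le> Z t x")
      case True
      then have "0 \<le> (g a - g b) * Z t x" using \<Delta>g by simp
      then show ?thesis using second pos2 C by (simp add: algebra_simps)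
    next
      case False
      \<comment> \<open>Here the sign of the first term is bad. The condition bounds \<open>g a - g b\<close> by \<open>(- g b) \<Delta> / \<epsilon>\<close>, and since the interval
        is short, Z varies on it by at most \<open>\<mu>\<close>; the relaxation term then compensates.\<close>
      have SI: "0 < S - I" using ab rab by simp
      have "\<exists>z>a. z < b \<and> G b - G a = (b - a) * g z" using ab G_deriv by (intro MVT2) auto
      then obtain z where z: "a < z" "z < b" "G b - G a = (b - a) * g z" by blast
      have "g b \<le> g z" using C z rab by auto
      then have "(b - a) * (- g z) \<le> (b - a) * (- g b)" using ab by (intro mult_left_mono) auto
      then have "G a - G b \<le> (b - a) * (- g b)" using z(3) by simp
      also have "\<dots> \<le> ((S - I) / \<epsilon> * \<Delta>) * (- g b)" using slope gb by (intro mult_right_mono) (auto simp: a_def b_def)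
      finally have "(g a - g b) * (S - I) \<le> ((- g b) / \<epsilon> * \<Delta>) * (S - I)" using \<Delta>g(2) by (simp add: mult_ac)
      then have "g a - g b \<le> (- g b) / \<epsilon> * \<Delta>" using SI by (simp only: mult_le_cancel_right_pos)
      then have 1: "((- g b) / \<epsilon> * \<Delta>) * Z t x \<le> (g a - g b) * Z t x" using False by (intro mult_right_mono_neg) auto
      have Z_lip: "Z t q \<le> Z t x + (Zb + D * M * Kx) / \<epsilon> * \<Delta>" if q: "q \<in> {y..x}" for q
      proof -
        have "\<bar>integral {q..x} (Z t)\<bar> \<le> Zb * (x - q)"
          using q Z_bound[OF t] unfolding Zb_def
          by (intro abs_integral_le integrable_continuous_interval Z_continuous[OF t]) auto
        moreover have "\<bar>U t x - U t q\<bar> \<le> D * M * Kx * (x - q)"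
        proof -
          have "\<bar>U t x - U t q\<bar> \<le> D * M * \<bar>W t x - W t q\<bar>" unfolding U_def by (rule G_Lipschitz[OF W_mem[OF t] W_mem[OF t]])
          also have "\<dots> \<le> D * M * (Kx * \<bar>x - q\<bar>)" using D_nonneg M_nonneg by (intro mult_left_mono W_Lipschitz[OF t]) auto
          finally show ?thesis using q by simp
        qed
        moreover have "(Zb + D * M * Kx) * (x - q) \<le> (Zb + D * M * Kx) * \<Delta>"
          using q Zb_nonneg D_nonneg M_nonneg Kx_nonneg by (intro mult_left_mono) (auto simp: \<Delta>_def)
        ultimately have "- (integral {q..x} (Z t) - (U t x - U t q)) \<le> (Zb + D * M * Kx) * \<Delta>"
          by (simp add: algebra_simps abs_le_iff)
        then have "1 / \<epsilon> * (- (integral {q..x} (Z t) - (U t x - U t q))) \<le> 1 / \<epsilon> * ((Zb + D * M * Kx) * \<Delta>)"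
          using eps by (intro mult_left_mono) auto
        moreover have "Z t q - Z t x = 1 / \<epsilon> * (- (integral {q..x} (Z t) - (U t x - U t q)))"
          using Z_increment[OF t, of q x] q by (simp add: algebra_simps)
        ultimately show ?thesis by simp
      qed
      have "(Zb + D * M * Kx) / \<epsilon> * \<Delta> \<le> (Zb + D * M * Kx) / \<epsilon> * \<delta>"
        using yx(2) Zb_nonneg D_nonneg M_nonneg Kx_nonneg eps by (intro mult_left_mono divide_nonneg_pos) auto
      then have "Z t q \<le> Z t x + \<mu>" if "q \<in> {y..x}" for q using Z_lip[OF that] \<delta> by linarith
      then have "J \<le> integral {y..x} (\<lambda>q. Z t x + \<mu>)" unfolding J_def by (intro integral_le[OF zi]) auto
      then have "J \<le> (Z t x + \<mu>) * \<Delta>" using yx by (simp add: \<Delta>_def mult.commute)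
      then have "- (Z t x * \<Delta>) \<le> \<Delta>U - J" using \<Delta>U0 by (simp add: algebra_simps)
      then have "(- g b) / \<epsilon> * (- (Z t x * \<Delta>)) \<le> (- g b) / \<epsilon> * (\<Delta>U - J)"
        using gb eps by (intro mult_left_mono divide_nonneg_pos) auto
      then have "0 \<le> (g a - g b) * Z t x + (- g b) / \<epsilon> * (\<Delta>U - J)" using 1 by (simp add: algebra_simps)
      then show ?thesis using pos2 C by (simp add: algebra_simps)
    qed
  next
    assume D': "\<forall>a b. I \<le> a \<longrightarrow> a \<le> b \<longrightarrow> b \<le> S \<longrightarrow> 0 \<le> g b - g a \<and> g b - g a \<le> (1 - \<kappa>) * (V a - V b)"
    then have \<Delta>g: "0 \<le> g b - g a" "g b - g a \<le> (1 - \<kappa>) * \<Delta>V" using rab ab by (auto simp: \<Delta>V_def a_def b_def)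
    have "(g b - g a) * Z t x \<le> (g b - g a) * (\<mu> + c * E)" by (rule mult_left_mono[OF Z_le \<Delta>g(1)])
    also have "\<dots> \<le> ((1 - \<kappa>) * \<Delta>V) * (\<mu> + c * E)" using \<Delta>g \<mu> c E by (intro mult_right_mono) auto
    also have "\<dots> = (1 - \<kappa>) * (\<mu> * \<Delta>V) + (1 - \<kappa>) * \<Delta>V * (c * E)" by (simp add: algebra_simps)
    also have "(1 - \<kappa>) * \<Delta>V * (c * E) \<le> 2 * B * (c * E)"
    proof (rule mult_right_mono)
      have "(1 - \<kappa>) * \<Delta>V \<le> 1 * \<Delta>V" using \<kappa> \<Delta>V by (intro mult_right_mono) auto
      then show "(1 - \<kappa>) * \<Delta>V \<le> 2 * B" using \<Delta>V_le by linarith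
    qed (use c E in simp)
    finally show ?thesis using second by (simp add: algebra_simps)
  qed
  then show "- (2 * B * c + D * M * c * \<delta> / \<epsilon>) * E \<le> (g (W t x) * Z t x - g (W t y) * Z t y) + \<mu> * \<Delta>V - \<kappa> * \<mu>\<^sup>2 / R * \<Delta>"
    using time split unfolding a_def b_def by linarith
qed

text \<open>
  \<open>E(t)\<close> is the largest violation of the bound with slope \<open>\<mu>(t) = R / (\<kappa> t)\<close> among pairs at distance at most \<open>\<delta>\<close>; longer
  intervals are chains of short ones. For small \<open>t\<close> the slope exceeds the Lipschitz constant of \<open>U\<close>, so \<open>E\<close> vanishes
  at some time \<open>t0\<close>. A violating pair approaches when it is followed backwards, hence remains admissible, and the key
  inequality gives the discrete Gronwall inequality for \<open>E\<close>.
\<close>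

lemma Oleinik_estimate:
  fixes \<kappa> R S I t1 :: real
  assumes \<kappa>: "0 < \<kappa>" and R: "0 < R" "S \<le> R" and I: "0 \<le> I"
    and rng: "\<And>t z. 0 \<le> t \<Longrightarrow> t < T \<Longrightarrow> W t z \<in> {I..S}"
    and slope: "\<And>t x y. 0 \<le> t \<Longrightarrow> t < T \<Longrightarrow> y \<le> x \<Longrightarrow> W t y - W t x \<le> (S - I) / \<epsilon> * (x - y)"
    and cond: "(\<kappa> = 1 \<and> (\<forall>a b. I \<le> a \<longrightarrow> a \<le> b \<longrightarrow> b \<le> S \<longrightarrow> g b \<le> g a \<and> (g a - g b) * (S - I) \<le> G a - G b))
      \<or> (\<forall>a b. I \<le> a \<longrightarrow> a \<le> b \<longrightarrow> b \<le> S \<longrightarrow> 0 \<le> g b - g a \<and> g b - g a \<le> (1 - \<kappa>) * (V a - V b))"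
    and t1: "0 < t1" "t1 < T" and yx: "y \<le> x"
  shows "U t1 x - U t1 y \<le> R / (\<kappa> * t1) * (x - y)"
proof -
  define KU where "KU = D * M * Kx"
  have KU: "0 \<le> KU" using D_nonneg M_nonneg Kx_nonneg by (simp add: KU_def)
  have U_lip: "U t x - U t y \<le> KU * (x - y)" if "t \<in> {0..T}" "y \<le> x" for t x y
  proof -
    have "\<bar>U t x - U t y\<bar> \<le> D * M * \<bar>W t x - W t y\<bar>" unfolding U_def by (rule G_Lipschitz[OF W_mem[OF that(1)] W_mem[OF that(1)]])
    also have "\<dots> \<le> D * M * (Kx * \<bar>x - y\<bar>)" using D_nonneg M_nonneg by (intro mult_left_mono W_Lipschitz[OF that(1)]) auto
    finally show ?thesis using that by (simp add: KU_def)
  qed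
  define \<mu> where "\<mu> = (\<lambda>t. R / (\<kappa> * t))"
  have \<mu>_pos: "0 < \<mu> t" if "0 < t" for t using that R \<kappa> by (simp add: \<mu>_def)
  define t0 where "t0 = min t1 (R / (\<kappa> * (KU + 1)))"
  have t0: "0 < t0" "t0 \<le> t1" using t1 R \<kappa> KU by (auto simp: t0_def)
  have \<mu>0: "KU \<le> \<mu> t0"
  proof -
    have "t0 * (\<kappa> * (KU + 1)) \<le> R"
      using \<kappa> KU pos_le_divide_eq[of "\<kappa> * (KU + 1)" t0 R] by (simp add: t0_def)
    then have "(KU + 1) * (\<kappa> * t0) \<le> R" by (simp add: algebra_simps)
    then have "KU + 1 \<le> \<mu> t0" using t0 \<kappa> by (simp add: \<mu>_def pos_le_divide_eq)
    then show ?thesis by simp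
  qed
  define Lz where "Lz = (Zb + D * M * Kx) / \<epsilon>"
  have Lz: "0 \<le> Lz" using Zb_nonneg KU eps by (simp add: Lz_def KU_def)
  define \<delta> where "\<delta> = \<mu> t1 / (Lz + 1)"
  have \<delta>: "0 < \<delta>" using \<mu>_pos[OF t1(1)] Lz by (simp add: \<delta>_def)
  have \<mu>_mono: "\<mu> t \<le> \<mu> s" if "0 < s" "s \<le> t" for s t
    unfolding \<mu>_def using that R \<kappa> by (intro divide_left_mono mult_left_mono mult_pos_pos) auto
  have Lz\<delta>: "Lz * \<delta> \<le> \<mu> t" if "0 < t" "t \<le> t1" for t
  proof -
    have "Lz * \<delta> \<le> (Lz + 1) * \<delta>" using \<delta> by (simp add: distrib_right)
    also have "\<dots> = \<mu> t1" using Lz by (simp add: \<delta>_def)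
    also have "\<dots> \<le> \<mu> t" by (rule \<mu>_mono[OF that])
    finally show ?thesis .
  qed
  define P where "P = {p :: real \<times> real. fst p \<le> snd p \<and> snd p - fst p \<le> \<delta>}"
  define e where "e t p = U t (snd p) - U t (fst p) - \<mu> t * (snd p - fst p)" for t and p :: "real \<times> real"
  define E where "E t = (SUP p\<in>P. e t p)" for t
  have P0: "(0, 0) \<in> P" using \<delta> by (simp add: P_def)
  have U_abs: "\<bar>U t x\<bar> \<le> BG" if "t \<in> {0..T}" for t x using U_bmeas[OF that] by (simp add: bmeas_def)
  have bdd: "bdd_above (e t ` P)" if t: "0 < t" "t \<le> t1" for t
  proof (rule bdd_aboveI2)
    fix p assume "p \<in> P"
    then have "0 \<le> \<mu> t * (snd p - fst p)" using \<mu>_pos[OF t(1)] by (simp add: P_def)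
    moreover have tT: "t \<in> {0..T}" using t t1 by auto
    ultimately show "e t p \<le> 2 * BG" using U_abs[OF tT, of "snd p"] U_abs[OF tT, of "fst p"] by (simp add: e_def abs_le_iff)
  qed
  have E_ge: "e t p \<le> E t" if "0 < t" "t \<le> t1" "p \<in> P" for t p
    unfolding E_def by (rule cSUP_upper[OF that(3) bdd[OF that(1,2)]])
  have E_nonneg: "0 \<le> E t" if "0 < t" "t \<le> t1" for t using E_ge[OF that P0] by (simp add: e_def)
  have E_leI: "E t \<le> b" if "\<And>p. p \<in> P \<Longrightarrow> e t p \<le> b" for t b
    unfolding E_def using P0 by (intro cSUP_least that) auto
  have short: "U t x - U t y \<le> \<mu> t * (x - y) + E t" if "0 < t" "t \<le> t1" "y \<le> x" "x - y \<le> \<delta>" for t x y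
    using E_ge[OF that(1,2), of "(y, x)"] that by (simp add: e_def P_def)
  have chain: "U t x - U t y \<le> \<mu> t * (x - y) + real n * E t"
    if t: "0 < t" "t \<le> t1" and "y \<le> x" "x - y \<le> real n * \<delta>" for t x y n
    using that(3,4)
  proof (induction n arbitrary: x)
    case 0 then show ?case by simp
  next
    case (Suc n)
    define z where "z = max y (x - \<delta>)"
    have "z - y \<le> real n * \<delta>" using Suc.prems \<delta> by (auto simp: z_def max_def algebra_simps)
    then have "U t z - U t y \<le> \<mu> t * (z - y) + real n * E t" by (intro Suc.IH) (auto simp: z_def)
    moreover have "U t x - U t z \<le> \<mu> t * (x - z) + E t" using Suc.prems \<delta> by (intro short t) (auto simp: z_def)
    ultimately show ?case by (simp add: algebra_simps)
  qed
  have long: "U t x - U t y \<le> (\<mu> t + E t / \<delta>) * (x - y) + E t" if t: "0 < t" "t \<le> t1" and "y \<le> x" for t x y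
  proof -
    define n where "n = nat \<lceil>(x - y) / \<delta>\<rceil>"
    have nn: "0 \<le> (x - y) / \<delta>" using that \<delta> by simp
    have n: "(x - y) / \<delta> \<le> real n" "real n \<le> (x - y) / \<delta> + 1"
      using nn unfolding n_def by linarith+
    have "U t x - U t y \<le> \<mu> t * (x - y) + real n * E t"
      by (rule chain[OF t \<open>y \<le> x\<close>]) (use n(1) \<delta> in \<open>simp add: pos_divide_le_eq\<close>)
    also have "real n * E t \<le> ((x - y) / \<delta> + 1) * E t" by (rule mult_right_mono[OF n(2) E_nonneg[OF t]])
    finally show ?thesis by (simp add: algebra_simps)
  qed
  define c where "c = 1 / \<delta> + 1 / \<epsilon>"
  have c: "0 \<le> c" using \<delta> eps by (simp add: c_def)
  have Z_le: "Z t z \<le> \<mu> t + c * E t" if t: "0 < t" "t \<le> t1" for t z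
  proof -
    have tT: "t \<in> {0..T}" using t t1 by auto
    have "Z t z \<le> (\<mu> t + E t / \<delta>) + E t / \<epsilon>"
    proof (rule bounded_solution_le[OF eps Z_continuous[OF tT]])
      show "Z t x \<le> 2 * BG / \<epsilon>" for x using Z_bound[OF tT, of x] by linarith
      show "Z t y - Z t z = 1 / \<epsilon> * (integral {z..y} (Z t) - (U t y - U t z))" if "z \<le> y" for y
        by (rule Z_increment[OF tT that])
      show "U t y - U t z \<le> (\<mu> t + E t / \<delta>) * (y - z) + E t" if "z \<le> y" for y by (rule long[OF t that])
    qed
    then show ?thesis by (simp add: c_def algebra_simps add_divide_distrib)
  qed
  define C1 where "C1 = 2 * B * c + D * M * c * \<delta> / \<epsilon>"
  define C\<mu> where "C\<mu> = R / (\<kappa> * t0 ^ 3)"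
  define C where "C = C1 + 2 * CU + C\<mu> * \<delta>"
  have C1: "0 \<le> C1" using B_nonneg c D_nonneg M_nonneg \<delta> eps by (simp add: C1_def)
  have C\<mu>: "0 \<le> C\<mu>" using R \<kappa> t0 by (simp add: C\<mu>_def)
  have C: "0 \<le> C" "C1 \<le> C" "2 * CU + C\<mu> * \<delta> \<le> C" using C1 C\<mu> CU_nonneg \<delta> by (simp_all add: C_def)
  have one_step: "E t \<le> E s + C * (t - s) * (E t + E s) + C * (t - s)\<^sup>2"
    if st: "t0 \<le> s" "s \<le> t" "t \<le> t1" and small: "t - s \<le> 1 / (D * Kx + 1)" for s t
  proof (rule E_leI)
    define h where "h = t - s"
    have h: "0 \<le> h" using st by (simp add: h_def)
    have s0: "0 < s" and t0': "0 < t" and st': "0 \<le> s" "t < T" "s \<le> t1" using st t0 t1 by auto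
    have tT: "t \<in> {0..T}" and sT: "s \<in> {0..T}" using st st' by auto
    have hD: "h * (D * Kx) \<le> 1"
    proof -
      have "h * (D * Kx + 1) \<le> 1" using small DKx_nonneg by (simp add: h_def pos_le_divide_eq)
      then show ?thesis using h by (simp add: algebra_simps)
    qed
    have Et: "0 \<le> E t" "0 \<le> E s" using E_nonneg s0 t0' st st' by auto
    fix p assume p: "p \<in> P"
    obtain y x where pyx: "p = (y, x)" by (cases p)
    have yx: "y \<le> x" "x - y \<le> \<delta>" using p by (simp_all add: P_def pyx)
    define \<Delta> where "\<Delta> = x - y"
    have \<Delta>: "0 \<le> \<Delta>" "\<Delta> \<le> \<delta>" using yx by (simp_all add: \<Delta>_def)
    have goal: "U t x - U t y - \<mu> t * \<Delta> \<le> E s + C1 * h * E t + (2 * CU + C\<mu> * \<delta>) * h\<^sup>2"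
    proof (cases "\<mu> t * \<Delta> < U t x - U t y")
      case False
      have "0 \<le> E s + C1 * h * E t + (2 * CU + C\<mu> * \<delta>) * h\<^sup>2"
        using Et C1 h CU_nonneg C\<mu> \<delta> by (intro add_nonneg_nonneg mult_nonneg_nonneg) auto
      then show ?thesis using False by linarith
    next
      case True
      define \<Delta>V where "\<Delta>V = V (W t x) - V (W t y)"
      have key: "0 \<le> \<Delta>V"
        "- C1 * E t \<le> (g (W t x) * Z t x - g (W t y) * Z t y) + \<mu> t * \<Delta>V - \<kappa> * (\<mu> t)\<^sup>2 / R * \<Delta>"
        unfolding \<Delta>V_def C1_def \<Delta>_def
        by (rule Oleinik_key_inequality[OF tT \<kappa> R I rng slope cond _ _ c Z_le yx _ True[unfolded \<Delta>_def]];
            use st' st t0' Et yx \<mu>_pos[OF t0'] Lz\<delta>[OF t0'] in \<open>auto simp: Lz_def\<close>)+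
      define Y where "Y = y - h * V (W t y)"
      define X where "X = x - h * V (W t x)"
      have YX: "Y \<le> X" unfolding X_def Y_def by (rule foot_Lipschitz(1)[OF tT h hD yx(1)])
      have XY: "X - Y = \<Delta> - h * \<Delta>V" by (simp add: X_def Y_def \<Delta>_def \<Delta>V_def algebra_simps)
      have "X - Y \<le> \<delta>" using XY key(1) h \<Delta>(2) mult_nonneg_nonneg[OF h key(1)] by linarith
      then have Es: "U s X - U s Y - \<mu> s * (X - Y) \<le> E s" using short[OF s0 st'(3) YX] by linarith
      have UX: "\<bar>U s X - U t x - h * (g (W t x) * Z t x)\<bar> \<le> CU * h\<^sup>2"
        and UY: "\<bar>U s Y - U t y - h * (g (W t y) * Z t y)\<bar> \<le> CU * h\<^sup>2"
        using U_backward[OF st'(1) st(2) st'(2), of x] U_backward[OF st'(1) st(2) st'(2), of y] hD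
        by (simp_all add: X_def Y_def h_def)
      have \<mu>s: "\<mu> s \<le> \<mu> t + h * (\<kappa> * (\<mu> t)\<^sup>2 / R) + C\<mu> * h\<^sup>2"
      proof -
        have "\<mu> s - \<mu> t - h * (\<kappa> * (\<mu> t)\<^sup>2 / R) = R / (\<kappa> * (t\<^sup>2 * s)) * h\<^sup>2"
        proof -
          have "\<mu> s = R / \<kappa> / s" "\<mu> t = R / \<kappa> / t" by (simp_all add: \<mu>_def)
          moreover have "h * (\<kappa> * (\<mu> t)\<^sup>2 / R) = R / \<kappa> * (h / t\<^sup>2)"
            using R \<kappa> by (simp add: \<mu>_def power2_eq_square mult_ac)
          moreover have "1 / s - 1 / t - h / t\<^sup>2 = h\<^sup>2 / (t\<^sup>2 * s)"
            using s0 t0' by (simp add: h_def field_simps power2_eq_square)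
          ultimately have "\<mu> s - \<mu> t - h * (\<kappa> * (\<mu> t)\<^sup>2 / R) = R / \<kappa> * (h\<^sup>2 / (t\<^sup>2 * s))"
            by (metis (no_types, opaque_lifting) divide_inverse right_diff_distrib inverse_eq_divide)
          then show ?thesis by simp
        qed
        also have "\<dots> \<le> C\<mu> * h\<^sup>2"
        proof (rule mult_right_mono)
          have "t0 ^ 3 \<le> t\<^sup>2 * s"
          proof -
            have "t0\<^sup>2 * t0 \<le> t\<^sup>2 * s" using st t0 by (intro mult_mono power_mono) auto
            then show ?thesis by (simp add: power3_eq_cube power2_eq_square)
          qed
          then show "R / (\<kappa> * (t\<^sup>2 * s)) \<le> C\<mu>"
            unfolding C\<mu>_def using R \<kappa> t0 s0 t0' by (intro divide_left_mono mult_left_mono mult_pos_pos) auto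
        qed simp
        finally show ?thesis by linarith
      qed
      have mid: "\<mu> s * (X - Y) \<le> \<mu> t * \<Delta> + h * (\<kappa> * (\<mu> t)\<^sup>2 / R * \<Delta>) + C\<mu> * \<delta> * h\<^sup>2 - h * (\<mu> t * \<Delta>V)"
      proof -
        have "\<mu> s * \<Delta> \<le> (\<mu> t + h * (\<kappa> * (\<mu> t)\<^sup>2 / R) + C\<mu> * h\<^sup>2) * \<Delta>" by (rule mult_right_mono[OF \<mu>s \<Delta>(1)])
        moreover have "C\<mu> * h\<^sup>2 * \<Delta> \<le> C\<mu> * h\<^sup>2 * \<delta>" using C\<mu> \<Delta> by (intro mult_left_mono) auto
        moreover have "\<mu> t * (h * \<Delta>V) \<le> \<mu> s * (h * \<Delta>V)" using \<mu>_mono[OF s0 st(2)] h key(1) by (intro mult_right_mono) auto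
        ultimately show ?thesis unfolding XY by (simp add: algebra_simps)
      qed
      have "h * (- C1 * E t) \<le> h * ((g (W t x) * Z t x - g (W t y) * Z t y) + \<mu> t * \<Delta>V - \<kappa> * (\<mu> t)\<^sup>2 / R * \<Delta>)"
        by (rule mult_left_mono[OF key(2) h])
      then have key': "- (C1 * h * E t) \<le> h * (g (W t x) * Z t x) - h * (g (W t y) * Z t y) + h * (\<mu> t * \<Delta>V) - h * (\<kappa> * (\<mu> t)\<^sup>2 / R * \<Delta>)"
        by (simp add: algebra_simps)
      have "(2 * CU + C\<mu> * \<delta>) * h\<^sup>2 = CU * h\<^sup>2 + CU * h\<^sup>2 + C\<mu> * \<delta> * h\<^sup>2" by (simp add: algebra_simps)
      then show ?thesis using Es UX UY mid key' by linarith
    qed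
    have "C1 * h * E t \<le> C * h * (E t + E s)"
    proof -
      have "C1 * h * E t \<le> C * h * E t" using C h Et by (intro mult_right_mono) auto
      moreover have "0 \<le> C * h * E s" using C h Et by simp
      ultimately show ?thesis by (simp add: distrib_left)
    qed
    moreover have "(2 * CU + C\<mu> * \<delta>) * h\<^sup>2 \<le> C * h\<^sup>2" using C(3) by (rule mult_right_mono) simp
    ultimately have "U t x - U t y - \<mu> t * \<Delta> \<le> E s + C * h * (E t + E s) + C * h\<^sup>2" using goal by linarith
    then show "e t p \<le> E s + C * (t - s) * (E t + E s) + C * (t - s)\<^sup>2"
      by (simp add: e_def pyx h_def \<Delta>_def)
  qed
  have E_start: "E t0 = 0"
  proof (rule antisym)
    show "E t0 \<le> 0"
    proof (rule E_leI)
      fix p assume "p \<in> P"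
      then have le: "fst p \<le> snd p" by (simp add: P_def)
      have "U t0 (snd p) - U t0 (fst p) \<le> KU * (snd p - fst p)" by (rule U_lip[OF _ le]) (use t0 t1 in auto)
      also have "\<dots> \<le> \<mu> t0 * (snd p - fst p)" using le by (intro mult_right_mono \<mu>0) auto
      finally show "e t0 p \<le> 0" by (simp add: e_def)
    qed
    show "0 \<le> E t0" using E_nonneg t0 by simp
  qed
  have "E t1 = 0"
  proof (rule discrete_Gronwall[where f = E and a = t0 and C = C and ?h0.0 = "1 / (D * Kx + 1)"])
    show "0 < 1 / (D * Kx + 1)" using DKx_nonneg by simp
    show "E t \<le> E s + C * (t - s) * (E t + E s) + C * (t - s)\<^sup>2"
      if "t0 \<le> s" "s \<le> t" "t \<le> t1" "t - s \<le> 1 / (D * Kx + 1)" for s t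
      by (rule one_step[OF that])
  qed (use t0 E_nonneg E_start C in auto)
  then show ?thesis using long[OF t1(1) order_refl yx] by (simp add: \<mu>_def)
qed

end

section \<open>Essential suprema and the structural conditions in integrated form\<close>

lemma integral_nonneg_off_negligible:
  fixes f :: "real \<Rightarrow> real"
  assumes f: "f integrable_on S" and N: "negligible N" and nn: "\<And>x. x \<in> S - N \<Longrightarrow> 0 \<le> f x"
  shows "0 \<le> integral S f"
proof -
  define f' where "f' = (\<lambda>x. if x \<in> N then 0 else f x)"
  have "integral S f = integral S f'" by (rule integral_spike[OF N]) (auto simp: f'_def)
  moreover have "f' integrable_on S" by (rule integrable_spike[OF f N]) (auto simp: f'_def)
  then have "0 \<le> integral S f'" by (rule integral_nonneg) (use nn in \<open>auto simp: f'_def\<close>)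
  ultimately show ?thesis by simp
qed

lemma AE_imp_negligible:
  assumes "AE x in lebesgue. Q x"
  obtains N where "negligible N" "\<And>x. x \<notin> N \<Longrightarrow> Q (x :: real)"
proof -
  obtain N where "\<And>x. x \<in> space lebesgue - N \<Longrightarrow> Q x" "N \<in> null_sets lebesgue"
    using AE_E3[OF assms] by blast
  then show ?thesis using that[of N] by (auto simp: negligible_iff_null_sets)
qed

text \<open>
  For a bounded function the extended real essential supremum is finite, so its real value carries the same
  information.
\<close>

lemma ereal_ess_sup:
  assumes "Linf f" shows "ereal (ess_sup f) = esssup lebesgue (\<lambda>x. ereal (f x))"
proof -
  obtain m where f: "f \<in> borel_measurable lebesgue" and m: "AE x in lebesgue. \<bar>f x\<bar> \<le> m"
    using assms by (auto simp: Linf_def)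
  have fe: "(\<lambda>x. ereal (f x)) \<in> borel_measurable lebesgue" using f by simp
  let ?s = "esssup lebesgue (\<lambda>x. ereal (f x))"
  have "?s \<le> ereal m" by (rule esssup_I[OF fe]) (use m in eventually_elim, auto)
  moreover have "ereal (- m) \<le> ?s"
  proof -
    have "ereal (- m) = esssup lebesgue (\<lambda>x :: real. ereal (- m))"
      by (rule esssup_const[symmetric]) simp
    also have "\<dots> \<le> ?s" by (rule esssup_AE_mono) (simp, use m in eventually_elim, auto)
    finally show ?thesis .
  qed
  ultimately have "\<bar>?s\<bar> \<noteq> \<infinity>" by auto
  then show ?thesis unfolding ess_sup_def by (rule ereal_real')
qed

lemma ess_sup_AE:
  assumes "Linf f" shows "AE x in lebesgue. f x \<le> ess_sup f"
  using esssup_AE[of "\<lambda>x. ereal (f x)" lebesgue] unfolding ereal_ess_sup[OF assms, symmetric] by simp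

lemma ess_sup_le: assumes "Linf f" "AE x in lebesgue. f x \<le> c" shows "ess_sup f \<le> c"
proof -
  have "ereal (ess_sup f) \<le> ereal c"
    unfolding ereal_ess_sup[OF assms(1)]
    by (rule esssup_I) (use assms in \<open>auto simp: Linf_def\<close>)
  then show ?thesis by simp
qed

lemma Linf_uminus: "Linf f \<Longrightarrow> Linf (\<lambda>x. - f x)" and Linf_abs: "Linf f \<Longrightarrow> Linf (\<lambda>x. \<bar>f x\<bar>)"
  by (auto simp: Linf_def intro!: borel_measurable_uminus borel_measurable_abs)

lemma ess_inf_AE: assumes "Linf f" shows "AE x in lebesgue. ess_inf f \<le> f x"
  using ess_sup_AE[OF Linf_uminus[OF assms]] by eventually_elim (simp add: ess_inf_def)

context regular_flow begin

text \<open>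
  In integrated form \<open>g' = V' + \<xi> V''\<close>, where \<open>q\<close> is a bounded representative of \<open>V''\<close>.
\<close>

lemma g_increment:
  assumes V2: "Linf_loc V2" and inc: "\<And>u v. u \<le> v \<Longrightarrow> deriv V v - deriv V u = integral {u..v} V2"
    and ab: "a \<le> b"
  shows "\<exists>q N. negligible N \<and> (\<forall>x\<in>{a..b} - N. V2 x = q x)
    \<and> (\<lambda>x. q x * x + deriv V x) integrable_on {a..b}
    \<and> g b - g a = integral {a..b} (\<lambda>x. q x * x + deriv V x)"
proof -
  define A where "A = \<bar>a\<bar> + \<bar>b\<bar>"
  obtain K q where q: "bmeas K q" "AE x in lebesgue. x \<in> {-A..A} \<longrightarrow> V2 x = q x"
    using Linf_loc_locally_bounded[OF V2] by blast
  obtain N where N: "negligible N" "\<And>x. x \<notin> N \<Longrightarrow> x \<in> {-A..A} \<longrightarrow> V2 x = q x"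
    using AE_imp_negligible[OF q(2)] by metis
  have Nab: "V2 x = q x" if "x \<in> {a..b} - N" for x using N(2)[of x] that by (auto simp: A_def)
  have P: "deriv V v - deriv V u = integral {u..v} q" if "a \<le> u" "u \<le> v" "v \<le> b" for u v
  proof -
    have "integral {u..v} V2 = integral {u..v} q"
      by (rule integral_spike[OF N(1)]) (use Nab that in auto)
    then show ?thesis using inc[OF that(2)] by simp
  qed
  note i = integral_product_increment[OF ab q(1) P DERIV_ident continuous_on_const]
  show ?thesis
    by (intro exI[of _ q] exI[of _ N] conjI ballI) (use N(1) Nab i in \<open>simp_all add: g_def\<close>)
qed

lemma V_increment: assumes "a \<le> b"
  shows "deriv V integrable_on {a..b}" "V b - V a = integral {a..b} (deriv V)"
proof -
  have "(deriv V has_integral V b - V a) {a..b}"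
    by (rule fundamental_theorem_of_calculus[OF assms])
      (use V_deriv in \<open>auto simp: has_real_derivative_iff_has_vector_derivative[symmetric] intro: has_field_derivative_at_within\<close>)
  then show "deriv V integrable_on {a..b}" "V b - V a = integral {a..b} (deriv V)" by (auto simp: integral_unique)
qed

lemma G_increment: assumes "a \<le> b"
  shows "g integrable_on {a..b}" "G b - G a = integral {a..b} g"
proof -
  have "(g has_integral G b - G a) {a..b}"
    by (rule fundamental_theorem_of_calculus[OF assms])
      (use G_deriv in \<open>auto simp: has_real_derivative_iff_has_vector_derivative[symmetric] intro: has_field_derivative_at_within\<close>)
  then show "g integrable_on {a..b}" "G b - G a = integral {a..b} g" by (auto simp: integral_unique)
qed

lemma integrated_condition_C:
  assumes V2: "Linf_loc V2" and inc: "\<And>u v. u \<le> v \<Longrightarrow> deriv V v - deriv V u = integral {u..v} V2"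
    and ae: "AE \<xi> in lebesgue. weak_deriv (deriv V) \<xi> = V2 \<xi>"
    and C: "condition_C V \<rho>0"
    and ab: "ess_inf \<rho>0 \<le> a" "a \<le> b" "b \<le> ess_sup \<rho>0"
  shows "g b \<le> g a" and "(g a - g b) * (ess_sup \<rho>0 - ess_inf \<rho>0) \<le> G a - G b"
proof -
  define s where "s = ess_sup \<rho>0 - ess_inf \<rho>0"
  have "\<exists>q N. negligible N \<and> (\<forall>x\<in>{a..b} - N. V2 x = q x)
    \<and> (\<lambda>x. q x * x + deriv V x) integrable_on {a..b}
    \<and> g b - g a = integral {a..b} (\<lambda>x. q x * x + deriv V x)"
    by (rule g_increment[OF V2 inc ab(2)])
  then obtain q N where q: "negligible N" "\<forall>x\<in>{a..b} - N. V2 x = q x"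
    "(\<lambda>x. q x * x + deriv V x) integrable_on {a..b}"
    "g b - g a = integral {a..b} (\<lambda>x. q x * x + deriv V x)"
    by (elim exE conjE)
  have "AE \<xi> in lebesgue. \<xi> \<in> {ess_inf \<rho>0..ess_sup \<rho>0} \<longrightarrow>
     0 \<le> (- deriv V \<xi> - V2 \<xi> * \<xi>) * s \<and> (- deriv V \<xi> - V2 \<xi> * \<xi>) * s \<le> - deriv V \<xi> * \<xi>"
    using C ae unfolding condition_C_def s_def by eventually_elim simp
  then obtain N' where N': "negligible N'" "\<And>\<xi>. \<xi> \<notin> N' \<Longrightarrow> \<xi> \<in> {ess_inf \<rho>0..ess_sup \<rho>0} \<longrightarrow>
     0 \<le> (- deriv V \<xi> - V2 \<xi> * \<xi>) * s \<and> (- deriv V \<xi> - V2 \<xi> * \<xi>) * s \<le> - deriv V \<xi> * \<xi>"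
    using AE_imp_negligible by blast
  have N: "negligible (N \<union> N')" using q(1) N'(1) by (rule negligible_Un)
  have pt: "0 \<le> - (q x * x + deriv V x) * s" "- (q x * x + deriv V x) * s \<le> - g x" if "x \<in> {a..b} - (N \<union> N')" for x
    using N'(2)[of x] bspec[OF q(2), of x] that ab by (auto simp: g_def algebra_simps)
  have i: "(\<lambda>x. - (q x * x + deriv V x) * s) integrable_on {a..b}"
    using q(3) by (intro integrable_on_mult_left integrable_neg)
  have eq: "integral {a..b} (\<lambda>x. - (q x * x + deriv V x) * s) = (g a - g b) * s"
  proof -
    have "integral {a..b} (\<lambda>x. - (q x * x + deriv V x) * s) = - integral {a..b} (\<lambda>x. q x * x + deriv V x) * s"
      by (simp only: Henstock_Kurzweil_Integration.integral_mult_left Henstock_Kurzweil_Integration.integral_neg)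
    then show ?thesis unfolding q(4)[symmetric] by (simp add: algebra_simps)
  qed
  have "0 \<le> integral {a..b} (\<lambda>x. - (q x * x + deriv V x) * s)"
    by (rule integral_nonneg_off_negligible[OF i N pt(1)])
  then have 1: "0 \<le> (g a - g b) * s" unfolding eq .
  show "g b \<le> g a"
  proof (cases "a = b")
    case False
    then have "s > 0" using ab by (simp add: s_def)
    then show ?thesis using 1 by (simp add: zero_le_mult_iff)
  qed simp
  have "0 \<le> integral {a..b} (\<lambda>x. - g x - (- (q x * x + deriv V x) * s))"
  proof (rule integral_nonneg_off_negligible[OF _ N])
    show "(\<lambda>x. - g x - (- (q x * x + deriv V x) * s)) integrable_on {a..b}"
      by (rule integrable_diff[OF integrable_neg[OF G_increment(1)[OF ab(2)]] i])
    show "0 \<le> - g x - (- (q x * x + deriv V x) * s)" if "x \<in> {a..b} - (N \<union> N')" for x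
      using pt(2)[OF that] by linarith
  qed
  also have "\<dots> = (G a - G b) - (g a - g b) * s"
  proof -
    have "integral {a..b} (\<lambda>x. - g x - (- (q x * x + deriv V x) * s)) = integral {a..b} (\<lambda>x. - g x) - (g a - g b) * s"
      unfolding eq[symmetric]
      by (rule Henstock_Kurzweil_Integration.integral_diff[OF integrable_neg[OF G_increment(1)[OF ab(2)]] i])
    moreover have "integral {a..b} (\<lambda>x. - g x) = G a - G b"
      using G_increment(2)[OF ab(2)] by simp
    ultimately show ?thesis by (simp only:)
  qed
  finally show "(g a - g b) * (ess_sup \<rho>0 - ess_inf \<rho>0) \<le> G a - G b" by (simp add: s_def)
qed

lemma integrated_condition_D:
  assumes V2: "Linf_loc V2" and inc: "\<And>u v. u \<le> v \<Longrightarrow> deriv V v - deriv V u = integral {u..v} V2"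
    and ae: "AE \<xi> in lebesgue. weak_deriv (deriv V) \<xi> = V2 \<xi>"
    and D: "condition_D \<kappa> V \<rho>0"
    and ab: "ess_inf \<rho>0 \<le> a" "a \<le> b" "b \<le> ess_sup \<rho>0"
  shows "0 \<le> g b - g a" and "g b - g a \<le> (1 - \<kappa>) * (V a - V b)"
proof -
  have "\<exists>q N. negligible N \<and> (\<forall>x\<in>{a..b} - N. V2 x = q x)
    \<and> (\<lambda>x. q x * x + deriv V x) integrable_on {a..b}
    \<and> g b - g a = integral {a..b} (\<lambda>x. q x * x + deriv V x)"
    by (rule g_increment[OF V2 inc ab(2)])
  then obtain q N where q: "negligible N" "\<forall>x\<in>{a..b} - N. V2 x = q x"
    "(\<lambda>x. q x * x + deriv V x) integrable_on {a..b}"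
    "g b - g a = integral {a..b} (\<lambda>x. q x * x + deriv V x)"
    by (elim exE conjE)
  have "AE \<xi> in lebesgue. \<xi> \<in> {ess_inf \<rho>0..ess_sup \<rho>0} \<longrightarrow>
     - deriv V \<xi> \<le> V2 \<xi> * \<xi> \<and> V2 \<xi> * \<xi> \<le> - (2 - \<kappa>) * deriv V \<xi>"
    using D ae unfolding condition_D_def by eventually_elim simp
  then obtain N' where N': "negligible N'" "\<And>\<xi>. \<xi> \<notin> N' \<Longrightarrow> \<xi> \<in> {ess_inf \<rho>0..ess_sup \<rho>0} \<longrightarrow>
     - deriv V \<xi> \<le> V2 \<xi> * \<xi> \<and> V2 \<xi> * \<xi> \<le> - (2 - \<kappa>) * deriv V \<xi>"
    using AE_imp_negligible by blast
  have N: "negligible (N \<union> N')" using q(1) N'(1) by (rule negligible_Un)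
  have pt: "0 \<le> q x * x + deriv V x" "0 \<le> - (1 - \<kappa>) * deriv V x - (q x * x + deriv V x)" if "x \<in> {a..b} - (N \<union> N')" for x
    using N'(2)[of x] bspec[OF q(2), of x] that ab by (auto simp: algebra_simps)
  show "0 \<le> g b - g a"
    unfolding q(4) by (rule integral_nonneg_off_negligible[OF q(3) N pt(1)])
  have i: "(\<lambda>x. - (1 - \<kappa>) * deriv V x) integrable_on {a..b}"
    by (intro integrable_on_mult_right V_increment(1) ab(2))
  have "0 \<le> integral {a..b} (\<lambda>x. - (1 - \<kappa>) * deriv V x - (q x * x + deriv V x))"
    by (rule integral_nonneg_off_negligible[OF integrable_diff[OF i q(3)] N pt(2)])
  also have "\<dots> = integral {a..b} (\<lambda>x. - (1 - \<kappa>) * deriv V x) - (g b - g a)"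
    unfolding q(4) by (rule Henstock_Kurzweil_Integration.integral_diff[OF i q(3)])
  also have "integral {a..b} (\<lambda>x. - (1 - \<kappa>) * deriv V x) = - (1 - \<kappa>) * (V b - V a)"
    unfolding V_increment(2)[OF ab(2)] by (rule Henstock_Kurzweil_Integration.integral_mult_right)
  finally show "g b - g a \<le> (1 - \<kappa>) * (V a - V b)" by (simp add: algebra_simps)
qed

lemma g_Lipschitz_on: "Lg-lipschitz_on {-M..M} g"
  by (rule lipschitz_onI) (use g_Lipschitz Lg_nonneg in \<open>auto simp: dist_real_def\<close>)

lemma g_W_continuous:
  assumes t: "t \<in> {0..T}" shows "continuous_on UNIV (\<lambda>x. g (W t x))"
  by (rule continuous_on_compose2[OF lipschitz_on_continuous_on[OF g_Lipschitz_on] W_continuous[OF t]]) (use W_mem[OF t] in auto)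

text \<open>
  The derivative of \<open>W\<close> in space, as given by the relation \<open>\<epsilon> \<partial>\<^sub>x W = W - \<rho>\<close>.
\<close>

definition Wx :: "real \<Rightarrow> real \<Rightarrow> real" where "Wx t x = (W t x - r t x) / \<epsilon>"

lemma Wx_bmeas: assumes t: "t \<in> {0..T}" shows "bmeas (2 * M / \<epsilon>) (Wx t)"
  unfolding bmeas_def
proof (intro conjI allI)
  show "Wx t \<in> borel_measurable lebesgue"
    unfolding Wx_def[abs_def] using r[OF t] bmeas_expavg[OF eps r[OF t]]
    by (auto simp: bmeas_def intro!: borel_measurable_divide borel_measurable_diff)
  fix x
  have "\<bar>W t x\<bar> \<le> M" "\<bar>r t x\<bar> \<le> M" using W_abs_le[OF t] r[OF t] by (auto simp: bmeas_def)
  then have "\<bar>W t x - r t x\<bar> \<le> 2 * M" by linarith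
  then show "\<bar>Wx t x\<bar> \<le> 2 * M / \<epsilon>" using eps by (simp add: Wx_def divide_right_mono)
qed

lemma W_increment_Wx:
  assumes t: "t \<in> {0..T}" and "u \<le> v" shows "W t v - W t u = integral {u..v} (Wx t)"
proof -
  have wi: "W t integrable_on {u..v}" by (rule integrable_continuous_interval[OF W_continuous[OF t]])
  have "integral {u..v} (Wx t) = (integral {u..v} (W t) - integral {u..v} (r t)) / \<epsilon>"
    unfolding Wx_def[abs_def] integral_divide
    by (simp only: Henstock_Kurzweil_Integration.integral_diff[OF wi bmeas_integrable[OF r[OF t]]])
  then show ?thesis using W_increment[OF t \<open>u \<le> v\<close>] by simp
qed

lemma has_weak_deriv_W:
  assumes t: "t \<in> {0..T}" shows "has_weak_deriv (W t) (Wx t)"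
proof -
  have "\<exists>K q. bmeas K q \<and> (AE x in lebesgue. x \<in> {-A..A} \<longrightarrow> Wx t x = q x)" for A
    using Wx_bmeas[OF t] by (intro exI[of _ "2 * M / \<epsilon>"] exI[of _ "Wx t"]) auto
  from integral_by_parts_test[OF this L1_loc_bmeas[OF Wx_bmeas[OF t]] W_increment_Wx[OF t]]
  show ?thesis
    unfolding has_weak_deriv_def
    using L1_loc_continuous[OF W_continuous[OF t]] L1_loc_bmeas[OF Wx_bmeas[OF t]] by blast
qed

text \<open>
  By the chain rule the increments of \<open>U\<close> are the integrals of \<open>g(W) \<partial>\<^sub>x W\<close>, so the bound on increments is a bound on all
  interval integrals.
\<close>

lemma Lipschitz_bound_imp_AE:
  assumes t: "t \<in> {0..T}" and bound: "\<And>x y. y \<le> x \<Longrightarrow> U t x - U t y \<le> m * (x - y)"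
  shows "AE x in lebesgue. g (W t x) * weak_deriv (W t) x \<le> m"
proof -
  define w where "w = Wx t"
  have bw: "bmeas (2 * M / \<epsilon>) w" unfolding w_def by (rule Wx_bmeas[OF t])
  have inc: "W t v - W t u = integral {u..v} w" if "u \<le> v" for u v
    unfolding w_def by (rule W_increment_Wx[OF t that])
  note cg = g_W_continuous[OF t]
  have chain: "(\<lambda>x. g (W t x) * w x) integrable_on {a..b}" "U t b - U t a = integral {a..b} (\<lambda>x. g (W t x) * w x)" if "a \<le> b" for a b
    unfolding U_def
    by (rule integral_chain_increment[OF that bw inc W_mem[OF t] G_deriv g_Lipschitz_on]; assumption)+
  note cg = g_W_continuous[OF t]
  have "AE x in lebesgue. 0 \<le> m - g (W t x) * w x"
  proof (rule AE_nonneg_if_interval_integrals_nonneg)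
    fix a b :: real
    have "(\<lambda>x. w x * g (W t x)) absolutely_integrable_on {a..b}"
      by (intro absolutely_integrable_continuous_mult bmeas_absolutely_integrable[OF bw] continuous_on_subset[OF cg]) auto
    moreover have "(\<lambda>x. m) absolutely_integrable_on {a..b}"
      by (intro absolutely_integrable_continuous_real continuous_on_const)
    ultimately show "(\<lambda>x. m - g (W t x) * w x) absolutely_integrable_on {a..b}"
      by (simp add: mult.commute set_integral_diff(1))
  next
    fix a b :: real assume ab: "a \<le> b"
    have "integral {a..b} (\<lambda>x. m - g (W t x) * w x) = m * (b - a) - (U t b - U t a)"
      using Henstock_Kurzweil_Integration.integral_diff[OF integrable_const_ivl[of m] chain(1)[OF ab]] chain(2)[OF ab] ab
      by (simp add: mult.commute)
    then show "0 \<le> integral {a..b} (\<lambda>x. m - g (W t x) * w x)" using bound[OF ab] by simp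
  qed
  then show ?thesis using weak_deriv_AE[OF has_weak_deriv_W[OF t]]
    by eventually_elim (simp add: w_def)
qed

end

section \<open>From weak solutions to the estimate\<close>

text \<open>
  Lebesgue measure is complete, so both sides are measurable or both integrals are zero by convention. In the weak
  formulation this replaces a discussion of the measurability of the derivatives of test functions.
\<close>

lemma lebesgue_integral_cong_AE:
  fixes f g :: "real \<Rightarrow> real"
  assumes ae: "AE x in lebesgue. f x = g x" shows "(LINT x|lebesgue. f x) = (LINT x|lebesgue. g x)"
proof (cases "f \<in> borel_measurable lebesgue")
  case True
  then have "g \<in> borel_measurable lebesgue" using borel_measurable_AE ae by blast
  then show ?thesis using True ae by (intro integral_cong_AE)
next
  case False
  moreover have "AE x in lebesgue. g x = f x" using ae by eventually_elim simp
  then have "g \<notin> borel_measurable lebesgue" using False borel_measurable_AE by blast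
  ultimately show ?thesis
    using not_integrable_integral_eq borel_measurable_integrable by metis
qed

definition clip :: "real \<Rightarrow> (real \<Rightarrow> real) \<Rightarrow> real \<Rightarrow> real" where
  "clip M f x = max (- M) (min M (f x))"

lemma bmeas_clip: "f \<in> borel_measurable lebesgue \<Longrightarrow> 0 \<le> M \<Longrightarrow> bmeas M (clip M f)"
  unfolding bmeas_def clip_def[abs_def]
  by (auto simp: abs_le_iff intro!: borel_measurable_max borel_measurable_min)

lemma clip_AE: "AE x in lebesgue. \<bar>f x\<bar> \<le> M \<Longrightarrow> AE x in lebesgue. clip M f x = f x"
  by (erule eventually_mono) (auto simp: clip_def abs_le_iff)

text \<open>
  The profile at \<open>t0\<close> is a limit in \<open>L\<^sup>1\<^sub>l\<^sub>o\<^sub>c\<close> of profiles at nearby times at which the bound holds, and its excess over the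
  bound is dominated by its distance to them.
\<close>

lemma C_L1_loc_bound_all_times:
  assumes C: "C_L1_loc T \<rho>" and T: "T > 0"
    and bound: "AE t in lebesgue. t \<in> {0<..<T} \<longrightarrow> (AE x in lebesgue. \<bar>\<rho> t x\<bar> \<le> M)"
    and t0: "t0 \<in> {0..T}"
  shows "AE x in lebesgue. \<bar>\<rho> t0 x\<bar> \<le> M"
proof -
  have L: "L1_loc (\<rho> t)" if "t \<in> {0..T}" for t using C that by (simp add: C_L1_loc_def)
  have "AE x in lebesgue. x \<in> {-real n..real n} \<longrightarrow> \<bar>\<rho> t0 x\<bar> \<le> M" for n
  proof -
    define K where "K = {-real n..real n}"
    have abs: "\<rho> t absolutely_integrable_on K" if "t \<in> {0..T}" for t
      unfolding K_def by (rule L1_loc_absolutely_integrable[OF L[OF that]])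
    define h where "h = (\<lambda>x. indicator K x * max 0 (\<bar>\<rho> t0 x\<bar> - M))"
    have ih: "integrable lebesgue h"
    proof -
      have 1: "(\<lambda>x. \<bar>\<rho> t0 x\<bar>) absolutely_integrable_on K" using set_integrable_abs[OF abs[OF t0]] .
      have 2: "(\<lambda>x. M) absolutely_integrable_on K" unfolding K_def by (intro absolutely_integrable_continuous_real continuous_on_const)
      have "integrable lebesgue (\<lambda>x. max 0 (indicator K x * \<bar>\<rho> t0 x\<bar> - indicator K x * M))"
        using 1 2 by (intro integrable_max integrable_zero Bochner_Integration.integrable_diff) (simp_all add: set_integrable_def)
      moreover have "(\<lambda>x. max 0 (indicator K x * \<bar>\<rho> t0 x\<bar> - indicator K x * M)) = h"
        by (auto simp: h_def indicator_def)
      ultimately show ?thesis by simp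
    qed
    have hn: "AE x in lebesgue. 0 \<le> h x" by (auto simp: h_def)
    have "(LINT x|lebesgue. h x) \<le> e" if "e > 0" for e
    proof -
      have "((\<lambda>t. LINT x:K|lebesgue. \<bar>\<rho> t x - \<rho> t0 x\<bar>) \<longlongrightarrow> 0) (at t0 within {0..T})"
        using C t0 compact_Icc unfolding C_L1_loc_def K_def by blast
      then have "eventually (\<lambda>t. (LINT x:K|lebesgue. \<bar>\<rho> t x - \<rho> t0 x\<bar>) < e) (at t0 within {0..T})"
        using that by (rule order_tendstoD(2))
      then obtain d where d: "d > 0" "\<And>t. t \<in> {0..T} \<Longrightarrow> t \<noteq> t0 \<Longrightarrow> \<bar>t - t0\<bar> < d \<Longrightarrow> (LINT x:K|lebesgue. \<bar>\<rho> t x - \<rho> t0 x\<bar>) < e"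
        unfolding eventually_at dist_real_def by blast
      obtain t where t: "t \<in> {0<..<T}" "t \<noteq> t0" "\<bar>t - t0\<bar> < d" "AE x in lebesgue. \<bar>\<rho> t x\<bar> \<le> M"
      proof (cases "t0 < T")
        case True
        then have "t0 < min (t0 + d) T" using d(1) by simp
        from AE_imp_ex_in_interval[OF bound this] obtain t where
          t: "t0 < t" "t < min (t0 + d) T" "t \<in> {0<..<T} \<longrightarrow> (AE x in lebesgue. \<bar>\<rho> t x\<bar> \<le> M)" by blast
        moreover have "t \<in> {0<..<T}" using t t0 by auto
        ultimately show ?thesis by (intro that[of t]) auto
      next
        case False
        then have "max (t0 - d) 0 < t0" using d(1) t0 T by auto
        from AE_imp_ex_in_interval[OF bound this] obtain t where
          t: "max (t0 - d) 0 < t" "t < t0" "t \<in> {0<..<T} \<longrightarrow> (AE x in lebesgue. \<bar>\<rho> t x\<bar> \<le> M)" by blast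
        moreover have "t \<in> {0<..<T}" using t t0 by auto
        ultimately show ?thesis by (intro that[of t]) auto
      qed
      have tT: "t \<in> {0..T}" using t by auto
      have id: "integrable lebesgue (\<lambda>x. indicator K x * \<bar>\<rho> t x - \<rho> t0 x\<bar>)"
        using set_integrable_abs[OF set_integral_diff(1)[OF abs[OF tT] abs[OF t0]]] by (simp add: set_integrable_def)
      have "(LINT x|lebesgue. h x) \<le> (LINT x|lebesgue. indicator K x * \<bar>\<rho> t x - \<rho> t0 x\<bar>)"
        by (rule integral_mono_AE[OF ih id]) (use t(4) in eventually_elim, auto simp: h_def indicator_def)
      also have "\<dots> < e" using d(2)[OF tT t(2,3)] by (simp add: set_lebesgue_integral_def)
      finally show ?thesis by simp
    qed
    then have "(LINT x|lebesgue. h x) \<le> 0" using field_le_epsilon[of "LINT x|lebesgue. h x" 0] by simp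
    then have "(LINT x|lebesgue. h x) = 0" using integral_nonneg_AE[OF hn] by linarith
    then have "AE x in lebesgue. h x = 0" using integral_nonneg_eq_0_iff_AE[OF ih hn] by blast
    then show ?thesis by eventually_elim (auto simp: h_def K_def indicator_def split: if_splits)
  qed
  then have "AE x in lebesgue. \<forall>n. x \<in> {-real n..real n} \<longrightarrow> \<bar>\<rho> t0 x\<bar> \<le> M"
    unfolding AE_all_countable by blast
  then show ?thesis
  proof eventually_elim
    case (elim x)
    obtain n where "\<bar>x\<bar> \<le> real n" using real_arch_simple by blast
    then show ?case using elim by (auto simp: abs_le_iff)
  qed
qed

text \<open>
  Clipping every profile and the initial datum at a common bound changes them on null sets only, which affects neither
  the averages nor the weak formulation.
\<close>

lemma weak_solution_imp_nonlocal_flow: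
  assumes ws: "weak_solution V \<epsilon> \<rho>0 T \<rho>" and \<rho>0: "Linf \<rho>0"
    and eps: "\<epsilon> > 0" and T: "T > 0" and V: "continuous_on UNIV V"
  obtains M r0 r where "nonlocal_flow V \<epsilon> T M r0 r"
    "AE x in lebesgue. r0 x = \<rho>0 x" "\<And>t. t \<in> {0..T} \<Longrightarrow> nonlocal \<epsilon> \<rho> t = expavg \<epsilon> (r t)"
proof -
  have C: "C_L1_loc T \<rho>" and LL: "Linf_Linf T \<rho>" using ws by (auto simp: weak_solution_def)
  obtain M0 where M0: "AE t in lebesgue. t \<in> {0<..<T} \<longrightarrow> Linf (\<rho> t) \<and> (AE x in lebesgue. \<bar>\<rho> t x\<bar> \<le> M0)"
    using LL by (auto simp: Linf_Linf_def)
  obtain M1 where M1: "\<rho>0 \<in> borel_measurable lebesgue" "AE x in lebesgue. \<bar>\<rho>0 x\<bar> \<le> M1"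
    using \<rho>0 by (auto simp: Linf_def)
  define M where "M = max 0 (max M0 M1)"
  define r where "r = (\<lambda>t. clip M (\<rho> t))"
  define r0 where "r0 = clip M \<rho>0"
  have M: "0 \<le> M" "M0 \<le> M" "M1 \<le> M" by (auto simp: M_def)
  have meas: "\<rho> t \<in> borel_measurable lebesgue" if "t \<in> {0..T}" for t
    using C that by (intro locally_integrable_imp_measurable L1_loc_absolutely_integrable) (simp add: C_L1_loc_def)
  have "AE t in lebesgue. t \<in> {0<..<T} \<longrightarrow> (AE x in lebesgue. \<bar>\<rho> t x\<bar> \<le> M)"
    using M0
  proof eventually_elim
    case (elim t)
    show ?case
    proof
      assume "t \<in> {0<..<T}"
      then have "AE x in lebesgue. \<bar>\<rho> t x\<bar> \<le> M0" using elim by blast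
      then show "AE x in lebesgue. \<bar>\<rho> t x\<bar> \<le> M" by eventually_elim (use M in auto)
    qed
  qed
  from C_L1_loc_bound_all_times[OF C T this]
  have rae: "AE x in lebesgue. r t x = \<rho> t x" if "t \<in> {0..T}" for t
    unfolding r_def by (intro clip_AE) (use that in auto)
  have "AE x in lebesgue. \<bar>\<rho>0 x\<bar> \<le> M" using M1(2) by eventually_elim (use M in auto)
  then have r0ae: "AE x in lebesgue. r0 x = \<rho>0 x" unfolding r0_def by (rule clip_AE)
  have rb: "bmeas M (r t)" if "t \<in> {0..T}" for t unfolding r_def by (rule bmeas_clip[OF meas[OF that] M(1)])
  have r0b: "bmeas M r0" unfolding r0_def by (rule bmeas_clip[OF M1(1) M(1)])
  have nl: "nonlocal \<epsilon> \<rho> t = expavg \<epsilon> (r t)" if "t \<in> {0..T}" for t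
    unfolding nonlocal_eq_expavg
  proof (rule expavg_cong_AE[OF meas[OF that]])
    show "r t \<in> borel_measurable lebesgue" using rb[OF that] by (simp add: bmeas_def)
    show "AE x in lebesgue. \<rho> t x = r t x" using rae[OF that] by eventually_elim simp
  qed
  have "nonlocal_flow V \<epsilon> T M r0 r"
  proof
    show "\<epsilon> > 0" "T > 0" "continuous_on UNIV V" by fact+
    show "bmeas M (r t)" if "t \<in> {0..T}" for t by (rule rb[OF that])
    show "bmeas M r0" by (rule r0b)
    show "((\<lambda>t. integral {-A..A} (\<lambda>x. \<bar>r t x - r t0 x\<bar>)) \<longlongrightarrow> 0) (at t0 within {0..T})" if t0: "t0 \<in> {0..T}" for t0 A
    proof (rule Lim_transform_eventually)
      show "((\<lambda>t. LINT x:{-A..A}|lebesgue. \<bar>\<rho> t x - \<rho> t0 x\<bar>) \<longlongrightarrow> 0) (at t0 within {0..T})"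
        using C t0 compact_Icc unfolding C_L1_loc_def by blast
      have "eventually (\<lambda>t. t \<in> {0..T}) (at t0 within {0..T})" by (simp add: eventually_at_filter)
      then show "eventually (\<lambda>t. (LINT x:{-A..A}|lebesgue. \<bar>\<rho> t x - \<rho> t0 x\<bar>) = integral {-A..A} (\<lambda>x. \<bar>r t x - r t0 x\<bar>)) (at t0 within {0..T})"
      proof eventually_elim
        case (elim t)
        have "(LINT x:{-A..A}|lebesgue. \<bar>\<rho> t x - \<rho> t0 x\<bar>) = (LINT x:{-A..A}|lebesgue. \<bar>r t x - r t0 x\<bar>)"
          unfolding set_lebesgue_integral_def
          by (rule lebesgue_integral_cong_AE) (use rae[OF elim] rae[OF t0] in eventually_elim, simp)
        also have "\<dots> = integral {-A..A} (\<lambda>x. \<bar>r t x - r t0 x\<bar>)"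
          by (intro set_lebesgue_integral_eq_integral(2) set_integrable_abs set_integral_diff(1)
              bmeas_absolutely_integrable[OF rb[OF elim]] bmeas_absolutely_integrable[OF rb[OF t0]])
        finally show ?case .
      qed
    qed
    fix \<phi> assume "spacetime_test_fun T \<phi>"
    then have "(LINT t:{0<..<T}|lebesgue. (LINT x|lebesgue.
             \<rho> t x * deriv (\<lambda>s. \<phi> (s, x)) t + V (nonlocal \<epsilon> \<rho> t x) * \<rho> t x * deriv (\<lambda>y. \<phi> (t, y)) x))
        + (LINT x|lebesgue. \<rho>0 x * \<phi> (0, x)) = 0"
      using ws by (simp add: weak_solution_def)
    moreover have "(LINT x|lebesgue. \<rho>0 x * \<phi> (0, x)) = (LINT x|lebesgue. r0 x * \<phi> (0, x))"
      by (rule lebesgue_integral_cong_AE) (use r0ae in eventually_elim, simp)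
    moreover have "(LINT t:{0<..<T}|lebesgue. (LINT x|lebesgue.
             \<rho> t x * deriv (\<lambda>s. \<phi> (s, x)) t + V (nonlocal \<epsilon> \<rho> t x) * \<rho> t x * deriv (\<lambda>y. \<phi> (t, y)) x))
      = (LINT t:{0<..<T}|lebesgue. (LINT x|lebesgue.
             r t x * deriv (\<lambda>s. \<phi> (s, x)) t + V (expavg \<epsilon> (r t) x) * r t x * deriv (\<lambda>y. \<phi> (t, y)) x))"
    proof (rule set_lebesgue_integral_cong)
      show "\<forall>t. t \<in> {0<..<T} \<longrightarrow> (LINT x|lebesgue.
             \<rho> t x * deriv (\<lambda>s. \<phi> (s, x)) t + V (nonlocal \<epsilon> \<rho> t x) * \<rho> t x * deriv (\<lambda>y. \<phi> (t, y)) x)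
        = (LINT x|lebesgue. r t x * deriv (\<lambda>s. \<phi> (s, x)) t + V (expavg \<epsilon> (r t) x) * r t x * deriv (\<lambda>y. \<phi> (t, y)) x)"
      proof (intro allI impI)
        fix t assume "t \<in> {0<..<T}"
        then have t: "t \<in> {0..T}" by auto
        show "(LINT x|lebesgue. \<rho> t x * deriv (\<lambda>s. \<phi> (s, x)) t + V (nonlocal \<epsilon> \<rho> t x) * \<rho> t x * deriv (\<lambda>y. \<phi> (t, y)) x)
          = (LINT x|lebesgue. r t x * deriv (\<lambda>s. \<phi> (s, x)) t + V (expavg \<epsilon> (r t) x) * r t x * deriv (\<lambda>y. \<phi> (t, y)) x)"
          unfolding nl[OF t]
          by (rule lebesgue_integral_cong_AE) (use rae[OF t] in eventually_elim, simp)
      qed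
    qed simp
    ultimately show "(LINT t:{0<..<T}|lebesgue. (LINT x|lebesgue.
             r t x * deriv (\<lambda>s. \<phi> (s, x)) t + V (expavg \<epsilon> (r t) x) * r t x * deriv (\<lambda>y. \<phi> (t, y)) x))
        + (LINT x|lebesgue. r0 x * \<phi> (0, x)) = 0" by simp
  qed
  then show ?thesis by (rule that[OF _ r0ae nl])
qed

context regular_flow begin

text \<open>
  Collects the hypotheses of the one-sided estimate: the range of \<open>W\<close> and the bound on \<open>-\<partial>\<^sub>x W\<close> come from the maximum
  principle with the essential bounds of the initial datum.
\<close>

lemma Oleinik_estimate_AE:
  assumes \<rho>0: "Linf \<rho>0" "AE x in lebesgue. 0 \<le> \<rho>0 x" and r0: "AE x in lebesgue. r0 x = \<rho>0 x"
    and V2: "Linf_loc V2" "\<And>u v. u \<le> v \<Longrightarrow> deriv V v - deriv V u = integral {u..v} V2"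
      "AE \<xi> in lebesgue. weak_deriv (deriv V) \<xi> = V2 \<xi>"
    and \<kappa>: "0 < \<kappa>" and cond: "condition_C V \<rho>0 \<and> \<kappa> = 1 \<or> condition_D \<kappa> V \<rho>0"
    and R: "0 < R" "Linf_norm \<rho>0 \<le> R" and t: "0 < t" "t < T"
  shows "AE x in lebesgue. g (W t x) * weak_deriv (W t) x \<le> R / (\<kappa> * t)"
proof -
  define S where "S = ess_sup \<rho>0"
  define I where "I = ess_inf \<rho>0"
  have S_AE: "AE x in lebesgue. \<rho>0 x \<le> S" unfolding S_def by (rule ess_sup_AE[OF \<rho>0(1)])
  have I_AE: "AE x in lebesgue. I \<le> \<rho>0 x" unfolding I_def by (rule ess_inf_AE[OF \<rho>0(1)])
  have I0: "0 \<le> I"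
  proof -
    have "ess_sup (\<lambda>x. - \<rho>0 x) \<le> 0" by (rule ess_sup_le[OF Linf_uminus[OF \<rho>0(1)]]) (use \<rho>0(2) in simp)
    then show ?thesis by (simp add: I_def ess_inf_def)
  qed
  have IS: "I \<le> S"
  proof -
    have "AE x in lebesgue. I \<le> \<rho>0 x \<and> \<rho>0 x \<le> S" using S_AE I_AE by eventually_elim simp
    from AE_imp_ex_in_interval[OF this, of 0 1] show ?thesis by auto
  qed
  have SR: "S \<le> R"
  proof -
    have "AE x in lebesgue. \<bar>\<rho>0 x\<bar> \<le> Linf_norm \<rho>0" unfolding Linf_norm_def by (rule ess_sup_AE[OF Linf_abs[OF \<rho>0(1)]])
    then have "AE x in lebesgue. \<rho>0 x \<le> Linf_norm \<rho>0" by eventually_elim auto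
    then have "S \<le> Linf_norm \<rho>0" unfolding S_def by (rule ess_sup_le[OF \<rho>0(1)])
    then show ?thesis using R by simp
  qed
  obtain N where N: "negligible N" "\<And>x. x \<notin> N \<Longrightarrow> I \<le> r0 x \<and> r0 x \<le> S"
  proof -
    have "AE x in lebesgue. I \<le> r0 x \<and> r0 x \<le> S" using S_AE I_AE r0 by eventually_elim simp
    then show ?thesis using AE_imp_negligible that by blast
  qed

  have init_upper: "1 * (integral {y..x} r0 - S * (x - y)) \<le> 0" if "y \<le> x" for y x
  proof -
    have "0 \<le> integral {y..x} (\<lambda>q. S - r0 q)"
      by (rule integral_nonneg_off_negligible[OF integrable_diff[OF integrable_const_ivl bmeas_integrable[OF nonlocal_flow.r0[OF nonlocal_flow_axioms]]] N(1)])
        (use N(2) in auto)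
    then show ?thesis
      using Henstock_Kurzweil_Integration.integral_diff[OF integrable_const_ivl[of S] bmeas_integrable[OF nonlocal_flow.r0[OF nonlocal_flow_axioms]], of y x] that
      by (simp add: mult.commute)
  qed
  have init_lower: "(- 1) * (integral {y..x} r0 - I * (x - y)) \<le> 0" if "y \<le> x" for y x
  proof -
    have "0 \<le> integral {y..x} (\<lambda>q. r0 q - I)"
      by (rule integral_nonneg_off_negligible[OF integrable_diff[OF bmeas_integrable[OF nonlocal_flow.r0[OF nonlocal_flow_axioms]] integrable_const_ivl] N(1)])
        (use N(2) in auto)
    then show ?thesis
      using Henstock_Kurzweil_Integration.integral_diff[OF bmeas_integrable[OF nonlocal_flow.r0[OF nonlocal_flow_axioms]] integrable_const_ivl[of I], of y x] that
      by (simp add: mult.commute)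
  qed
  have S0: "0 \<le> S" using I0 IS by simp
  note upper = maximum_principle[OF disjI1[OF refl] S0 init_upper]
  note lower = maximum_principle[OF disjI2[OF refl] I0 init_lower]
  have rng: "W s z \<in> {I..S}" if "0 \<le> s" "s < T" for s z
    using upper(2)[OF _ that, of z] lower(2)[OF _ that, of z] by simp
  have slope: "W s y - W s x \<le> (S - I) / \<epsilon> * (x - y)" if s: "0 \<le> s" "s < T" and yx: "y \<le> x" for s x y
  proof -
    have sT: "s \<in> {0..T}" using s by auto
    have "integral {y..x} (\<lambda>q. I) \<le> integral {y..x} (W s)"
      by (rule integral_le) (use rng[OF s] in \<open>auto intro!: integrable_continuous_interval W_continuous[OF sT]\<close>)
    then have "I * (x - y) \<le> integral {y..x} (W s)" using yx by (simp add: mult.commute)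
    moreover have "integral {y..x} (r s) \<le> S * (x - y)" using upper(1)[OF _ s yx] by simp
    ultimately have "- (integral {y..x} (W s) - integral {y..x} (r s)) \<le> (S - I) * (x - y)" by (simp add: algebra_simps)
    then have "1 / \<epsilon> * (- (integral {y..x} (W s) - integral {y..x} (r s))) \<le> 1 / \<epsilon> * ((S - I) * (x - y))"
      using eps by (intro mult_left_mono) auto
    moreover have "W s y - W s x = 1 / \<epsilon> * (- (integral {y..x} (W s) - integral {y..x} (r s)))"
      using W_increment[OF sT yx] by (simp add: algebra_simps)
    ultimately show ?thesis by simp
  qed
  have cond': "(\<kappa> = 1 \<and> (\<forall>a b. I \<le> a \<longrightarrow> a \<le> b \<longrightarrow> b \<le> S \<longrightarrow> g b \<le> g a \<and> (g a - g b) * (S - I) \<le> G a - G b))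
      \<or> (\<forall>a b. I \<le> a \<longrightarrow> a \<le> b \<longrightarrow> b \<le> S \<longrightarrow> 0 \<le> g b - g a \<and> g b - g a \<le> (1 - \<kappa>) * (V a - V b))"
    using cond
  proof
    assume C: "condition_C V \<rho>0 \<and> \<kappa> = 1"
    then show ?thesis using integrated_condition_C[OF V2] unfolding S_def I_def by blast
  next
    assume D: "condition_D \<kappa> V \<rho>0"
    then show ?thesis using integrated_condition_D[OF V2 D] unfolding S_def I_def by blast
  qed
  have tT: "t \<in> {0..T}" using t by auto
  have U: "U t x - U t y \<le> R / (\<kappa> * t) * (x - y)" if "y \<le> x" for x y
    by (rule Oleinik_estimate[OF \<kappa> R(1) SR I0 rng slope cond' t that])
  show ?thesis by (rule Lipschitz_bound_imp_AE[OF tT U])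
qed

end

theorem theorem2p3:
  fixes \<kappa>1 \<kappa> \<epsilon> :: real and V \<rho>0 :: "real \<Rightarrow> real" and \<rho> :: "real \<Rightarrow> real \<Rightarrow> real"
  assumes "\<kappa>1 > 0"
    and "Linf \<rho>0" and "AE x in lebesgue. 0 \<le> \<rho>0 x"
    and "W2inf_loc V" and "antimono V"
    and "condition_C V \<rho>0 \<and> \<kappa> = 1 \<or> condition_D \<kappa>1 V \<rho>0 \<and> \<kappa> = \<kappa>1"
    and "\<epsilon> > 0"
    and "\<And>T. T > 0 \<Longrightarrow> weak_solution V \<epsilon> \<rho>0 T \<rho>"
  shows "\<forall>t>0. esssup lebesgue (\<lambda>x. ereal (deriv V (nonlocal \<epsilon> \<rho> t x) * nonlocal \<epsilon> \<rho> t x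
                                       * weak_deriv (nonlocal \<epsilon> \<rho> t) x))
               \<le> ereal (Linf_norm \<rho>0 / (\<kappa> * t))"
proof (intro allI impI)
  fix t :: real assume t: "t > 0"
  define T where "T = t + 1"
  have T: "T > 0" "t < T" "t \<in> {0..T}" using t by (auto simp: T_def)
  obtain V2 where V2: "Linf_loc V2" "\<And>x. (V has_real_derivative deriv V x) (at x)"
    "\<And>u v. u \<le> v \<Longrightarrow> deriv V v - deriv V u = integral {u..v} V2"
    "AE x in lebesgue. weak_deriv (deriv V) x = V2 x" "\<And>x. deriv V x \<le> 0"
    using W2inf_loc_antimono_C1[OF assms(4,5)] by blast
  have cV: "continuous_on UNIV V" using V2(2) by (meson DERIV_continuous_on has_field_derivative_at_within)
  obtain M r0 r where flow: "nonlocal_flow V \<epsilon> T M r0 r" and r0: "AE x in lebesgue. r0 x = \<rho>0 x"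
    and nl: "\<And>t. t \<in> {0..T} \<Longrightarrow> nonlocal \<epsilon> \<rho> t = expavg \<epsilon> (r t)"
    using weak_solution_imp_nonlocal_flow[OF assms(8)[OF T(1)] assms(2,7) T(1) cV] by blast
  have M: "0 \<le> M" by (rule nonlocal_flow.M_nonneg[OF flow])
  obtain L q where q: "bmeas L q" "AE x in lebesgue. x \<in> {-M..M} \<longrightarrow> V2 x = q x"
    using Linf_loc_locally_bounded[OF V2(1)] by blast
  obtain N where N: "negligible N" "\<And>x. x \<notin> N \<Longrightarrow> x \<in> {-M..M} \<longrightarrow> V2 x = q x"
    using AE_imp_negligible[OF q(2)] by metis
  have L: "0 \<le> L" by (rule bmeas_nonneg[OF q(1)])
  have aux: "\<bar>deriv V v - deriv V u\<bar> \<le> L * (v - u)" if "-M \<le> u" "u \<le> v" "v \<le> M" for u v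
  proof -
    have "integral {u..v} V2 = integral {u..v} q" by (rule integral_spike[OF N(1)]) (use N(2) that in auto)
    then show ?thesis using V2(3)[OF that(2)] bmeas_abs_integral_le[OF q(1) that(2)] by simp
  qed
  have V'_lip: "\<bar>deriv V x - deriv V y\<bar> \<le> L * \<bar>x - y\<bar>" if "x \<in> {-M..M}" "y \<in> {-M..M}" for x y
    using aux[of x y] aux[of y x] that by (cases "x \<le> y") (auto simp: abs_minus_commute)
  define D where "D = \<bar>deriv V 0\<bar> + L * M"
  have V'_bound: "\<bar>deriv V x\<bar> \<le> D" if "x \<in> {-M..M}" for x
  proof -
    have "L * \<bar>x - 0\<bar> \<le> L * M" using that L by (intro mult_left_mono) auto
    then show ?thesis using V'_lip[OF that, of 0] M unfolding D_def by fastforce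
  qed
  define B where "B = \<bar>V 0\<bar> + D * M"
  have V_bound: "\<bar>V x\<bar> \<le> B" if "x \<in> {-M..M}" for x
  proof -
    have "0 \<le> D" using L M by (simp add: D_def)
    then have "D * \<bar>x - 0\<bar> \<le> D * M" using that by (intro mult_left_mono) auto
    moreover have "\<bar>V x - V 0\<bar> \<le> D * \<bar>x - 0\<bar>"
      by (rule Lipschitz_of_bounded_derivative[OF V2(2) V'_bound that]) (use M in auto)
    ultimately show ?thesis unfolding B_def by linarith
  qed
  interpret F: regular_flow V \<epsilon> T M r0 r D B L
    by (intro regular_flow.intro regular_flow_axioms.intro flow V2(2,5) V'_bound V_bound V'_lip L)
  have \<kappa>: "0 < \<kappa>" using assms(1,6) by auto
  have cond: "condition_C V \<rho>0 \<and> \<kappa> = 1 \<or> condition_D \<kappa> V \<rho>0" using assms(6) by auto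
  define n where "n = Linf_norm \<rho>0"
  have n0: "0 \<le> n"
  proof -
    have "AE x in lebesgue. \<bar>\<rho>0 x\<bar> \<le> n" unfolding n_def Linf_norm_def by (rule ess_sup_AE[OF Linf_abs[OF assms(2)]])
    from AE_imp_ex_in_interval[OF this, of 0 1] show ?thesis by fastforce
  qed
  let ?z = "\<lambda>x. F.g (expavg \<epsilon> (r t) x) * weak_deriv (expavg \<epsilon> (r t)) x"
  \<comment> \<open>The estimate requires a positive bound R, while the norm of the initial datum may vanish.\<close>
  have "AE x in lebesgue. ?z x \<le> (n + 1 / real (Suc k)) / (\<kappa> * t)" for k
    by (rule F.Oleinik_estimate_AE[OF assms(2,3) r0 V2(1,3,4) \<kappa> cond _ _ t T(2)])
      (use n0 in \<open>auto simp: n_def add_nonneg_pos\<close>)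
  then have "AE x in lebesgue. \<forall>k. ?z x \<le> (n + 1 / real (Suc k)) / (\<kappa> * t)"
    unfolding AE_all_countable by blast
  then have ae: "AE x in lebesgue. ?z x \<le> n / (\<kappa> * t)"
  proof eventually_elim
    case (elim x)
    have "(\<lambda>k. (n + 1 / real (Suc k)) / (\<kappa> * t)) \<longlonglongrightarrow> (n + 0) / (\<kappa> * t)"
      using LIMSEQ_inverse_real_of_nat \<kappa> t by (intro tendsto_intros) (auto simp: inverse_eq_divide)
    then show ?case using elim by (intro LIMSEQ_le_const[where X = "\<lambda>k. (n + 1 / real (Suc k)) / (\<kappa> * t)"]) auto
  qed
  have "has_weak_deriv (expavg \<epsilon> (r t)) (weak_deriv (expavg \<epsilon> (r t)))"
    by (rule has_weak_deriv_weak_deriv[OF F.has_weak_deriv_W[OF T(3)]])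
  then have "L1_loc (weak_deriv (expavg \<epsilon> (r t)))" by (simp add: has_weak_deriv_def)
  then have "weak_deriv (expavg \<epsilon> (r t)) \<in> borel_measurable lebesgue"
    by (intro locally_integrable_imp_measurable L1_loc_absolutely_integrable)
  moreover have "(\<lambda>x. F.g (expavg \<epsilon> (r t) x)) \<in> borel_measurable lebesgue"
    by (rule continuous_imp_lebesgue_measurable[OF F.g_W_continuous[OF T(3)]])
  ultimately have meas: "?z \<in> borel_measurable lebesgue" by (rule borel_measurable_times[rotated])
  have "esssup lebesgue (\<lambda>x. ereal (?z x)) \<le> ereal (n / (\<kappa> * t))"
    by (rule esssup_I) (use meas ae in auto)
  then show "esssup lebesgue (\<lambda>x. ereal (deriv V (nonlocal \<epsilon> \<rho> t x) * nonlocal \<epsilon> \<rho> t x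
                                       * weak_deriv (nonlocal \<epsilon> \<rho> t) x))
               \<le> ereal (Linf_norm \<rho>0 / (\<kappa> * t))"
    unfolding nl[OF T(3)] F.g_def n_def .
qed

end
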